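(* Polytree Learning (PT) can be solved exactly in time $3^n \cdot |\mathcal{I}|^{\mathcal{O}(1)}$, where $n$ is the number of nodes and $|\mathcal{I}|$ is the length of the encoding of the input.
   Context: A directed acyclic graph (DAG) $D=(V,A)$ is a polytree if its skeleton (the undirected graph obtained by forgetting arc orientations) is a forest. For $v\in V$, $D_v$ denotes the set of parents of $v$ in $D$. Polytree Learning (PT): the input is a node set $V$ with $|V|=n$ and, for every $v\in V$, a local score function $f_v\colon 2^{V\setminus\{v\}}\to\mathbb{R}\cup\{-\infty\}$ given in the non-zero encoding: the input lists a family $\mathcal{F}_v$ of potential parent sets of $v$ together with the values $f_v(S)$ for $S\in\mathcal{F}_v$, and $f_v(S)=-\infty$ for every $S\notin\mathcal{F}_v$; scores are normalized so that $\emptyset\in\mathcal{F}_v$ and $f_v(\emptyset)=0$ for every $v$. The score of a DAG $D$ is $f(D)=\sum_{v\in V} f_v(D_v)$. The task is to output a polytree $D=(V,A)$ of maximum score. $|\mathcal{I}|$ denotes the length of the encoding of the input.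
   Formalization: The listed local scores are taken to be rational numbers (fractions of binary integers) or −∞, since arbitrary real scores have no finite encoding and the input length |I| would be undefined; running time is measured on a logarithmic-cost RAM. *)

theory Defs
  imports "HOL-Library.Extended_Real" "HOL-Library.Discrete_Functions"
begin

section \<open>Polytree Learning\<close>

text \<open>The node set is \<open>{..<n}\<close>; a digraph on it is given by its set of arcs.\<close>

type_synonym arcs = "(nat \<times> nat) set"

definition parents :: "arcs \<Rightarrow> nat \<Rightarrow> nat set" where
  "parents A v = {u. (u, v) \<in> A}"

definition is_dag :: "nat \<Rightarrow> arcs \<Rightarrow> bool" where
  "is_dag n A \<longleftrightarrow> A \<subseteq> {..<n} \<times> {..<n} \<and> acyclic A"

definition skeleton :: "arcs \<Rightarrow> nat set set" where
  "skeleton A = {{u, v} | u v. (u, v) \<in> A}"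

definition ucycle :: "nat set set \<Rightarrow> nat list \<Rightarrow> bool" where
  "ucycle E vs \<longleftrightarrow> 3 \<le> length vs \<and> distinct vs \<and>
     (\<forall>i < length vs. {vs ! i, vs ! (Suc i mod length vs)} \<in> E)"

definition is_forest :: "nat set set \<Rightarrow> bool" where
  "is_forest E \<longleftrightarrow> (\<nexists>vs. ucycle E vs)"

definition is_polytree :: "nat \<Rightarrow> arcs \<Rightarrow> bool" where
  "is_polytree n A \<longleftrightarrow> is_dag n A \<and> is_forest (skeleton A)"

text \<open>\<open>F v\<close> is the family of potential parent sets of \<open>v\<close> and \<open>f v\<close> its local score function.\<close>

definition pt_instance ::
  "nat \<Rightarrow> (nat \<Rightarrow> nat set set) \<Rightarrow> (nat \<Rightarrow> nat set \<Rightarrow> ereal) \<Rightarrow> bool" where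
  "pt_instance n F f \<longleftrightarrow> (\<forall>v < n.
     F v \<subseteq> Pow ({..<n} - {v}) \<and>
     {} \<in> F v \<and> f v {} = 0 \<and>
     (\<forall>S. f v S \<noteq> \<infinity>) \<and>
     (\<forall>S. S \<notin> F v \<longrightarrow> f v S = - \<infinity>))"

definition score :: "nat \<Rightarrow> (nat \<Rightarrow> nat set \<Rightarrow> ereal) \<Rightarrow> arcs \<Rightarrow> ereal" where
  "score n f A = (\<Sum>v<n. f v (parents A v))"

definition optimal_polytree :: "nat \<Rightarrow> (nat \<Rightarrow> nat set \<Rightarrow> ereal) \<Rightarrow> arcs \<Rightarrow> bool" where
  "optimal_polytree n f A \<longleftrightarrow>
     is_polytree n A \<and> (\<forall>B. is_polytree n B \<longrightarrow> score n f B \<le> score n f A)"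

section \<open>Encodings\<close>

text \<open>Inputs and outputs are sequences of integers, whose length is measured in bits:
  every integer contributes its binary digits and a sign bit.\<close>

definition int_len :: "int \<Rightarrow> nat" where
  "int_len x = floor_log (nat \<bar>x\<bar>) + 2"

definition code_len :: "int list \<Rightarrow> nat" where
  "code_len xs = sum_list (map int_len xs)"

text \<open>An entry \<open>(us, p, q)\<close> lists the elements \<open>us\<close> of a potential parent set and its score
  \<open>p / q\<close>; the denominator \<open>0\<close> stands for the score \<open>-\<infinity>\<close>.\<close>

type_synonym entry = "nat list \<times> int \<times> int"

definition score_val :: "int \<Rightarrow> int \<Rightarrow> ereal" where
  "score_val p q = (if q = 0 then - \<infinity> else ereal (of_int p / of_int q))"

definition entry_code :: "entry \<Rightarrow> int list" where
  "entry_code e = (case e of (us, p, q) \<Rightarrow> int (length us) # map int us @ [p, q])"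

definition node_code :: "entry list \<Rightarrow> int list" where
  "node_code es = int (length es) # concat (map entry_code es)"

definition input_code :: "entry list list \<Rightarrow> int list" where
  "input_code ess = int (length ess) # concat (map node_code ess)"

text \<open>The lists of parent sets and their elements may come in any order, but without repetition.\<close>

definition encodes ::
  "nat \<Rightarrow> (nat \<Rightarrow> nat set set) \<Rightarrow> (nat \<Rightarrow> nat set \<Rightarrow> ereal) \<Rightarrow> int list \<Rightarrow> bool" where
  "encodes n F f xs \<longleftrightarrow> (\<exists>ess. xs = input_code ess \<and> length ess = n \<and>
     (\<forall>v < n.
        distinct (map (\<lambda>(us, p, q). set us) (ess ! v)) \<and>
        F v = (\<lambda>(us, p, q). set us) ` set (ess ! v) \<and>
        (\<forall>(us, p, q) \<in> set (ess ! v).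
           distinct us \<and> 0 \<le> q \<and> f v (set us) = score_val p q)))"

definition encodes_arcs :: "arcs \<Rightarrow> int list \<Rightarrow> bool" where
  "encodes_arcs A ys \<longleftrightarrow> (\<exists>as. distinct as \<and> set as = A \<and>
     ys = concat (map (\<lambda>(u, v). [int u, int v]) as))"

section \<open>Random access machine with logarithmic cost\<close>

text \<open>RAM programs in structured form. A program has finitely many integer registers and finitely
  many arrays with indirect addressing. Every operation is charged for the bit lengths of the
  integers it handles, addresses included; multiplication and division are charged for the
  schoolbook methods, i.e. the product of the bit lengths.\<close>

datatype aexp =
    Const int
  | Reg nat
  | Arr nat aexp
  | Add aexp aexp
  | Sub aexp aexp
  | Mul aexp aexp
  | Div aexp aexp
  | Mod aexp aexp

datatype bexp =
    Less aexp aexp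
  | Equal aexp aexp
  | Neg bexp
  | Conj bexp bexp

datatype com =
    Skip
  | Assign nat aexp
  | Store nat aexp aexp
  | Seq com com
  | Cond bexp com com
  | Loop bexp com

type_synonym state = "(nat \<Rightarrow> int) \<times> (nat \<Rightarrow> int \<Rightarrow> int)"

fun aval :: "aexp \<Rightarrow> state \<Rightarrow> int" where
  "aval (Const c) s = c"
| "aval (Reg x) s = fst s x"
| "aval (Arr a e) s = snd s a (aval e s)"
| "aval (Add d e) s = aval d s + aval e s"
| "aval (Sub d e) s = aval d s - aval e s"
| "aval (Mul d e) s = aval d s * aval e s"
| "aval (Div d e) s = aval d s div aval e s"
| "aval (Mod d e) s = aval d s mod aval e s"

fun acost :: "aexp \<Rightarrow> state \<Rightarrow> nat" where
  "acost (Const c) s = int_len c"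
| "acost (Reg x) s = int_len (fst s x)"
| "acost (Arr a e) s = acost e s + int_len (aval e s) + int_len (snd s a (aval e s))"
| "acost (Add d e) s = acost d s + acost e s + int_len (aval d s) + int_len (aval e s)"
| "acost (Sub d e) s = acost d s + acost e s + int_len (aval d s) + int_len (aval e s)"
| "acost (Mul d e) s = acost d s + acost e s + int_len (aval d s) * int_len (aval e s)"
| "acost (Div d e) s = acost d s + acost e s + int_len (aval d s) * int_len (aval e s)"
| "acost (Mod d e) s = acost d s + acost e s + int_len (aval d s) * int_len (aval e s)"

fun bval :: "bexp \<Rightarrow> state \<Rightarrow> bool" where
  "bval (Less d e) s \<longleftrightarrow> aval d s < aval e s"
| "bval (Equal d e) s \<longleftrightarrow> aval d s = aval e s"
| "bval (Neg b) s \<longleftrightarrow> \<not> bval b s"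
| "bval (Conj b c) s \<longleftrightarrow> bval b s \<and> bval c s"

fun bcost :: "bexp \<Rightarrow> state \<Rightarrow> nat" where
  "bcost (Less d e) s = acost d s + acost e s + int_len (aval d s) + int_len (aval e s)"
| "bcost (Equal d e) s = acost d s + acost e s + int_len (aval d s) + int_len (aval e s)"
| "bcost (Neg b) s = bcost b s + 1"
| "bcost (Conj b c) s = bcost b s + bcost c s + 1"

text \<open>\<open>exec c s t s'\<close>: started in \<open>s\<close>, the program \<open>c\<close> halts in \<open>s'\<close> after time \<open>t\<close>.\<close>

inductive exec :: "com \<Rightarrow> state \<Rightarrow> nat \<Rightarrow> state \<Rightarrow> bool" where
  Skip: "exec Skip s 1 s"
| Assign: "exec (Assign x e) s (acost e s + int_len (aval e s))
     ((fst s)(x := aval e s), snd s)"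
| Store: "exec (Store a i e) s
     (acost i s + acost e s + int_len (aval i s) + int_len (aval e s))
     (fst s, (snd s)(a := (snd s a)(aval i s := aval e s)))"
| Seq: "exec c s t s' \<Longrightarrow> exec d s' t' s'' \<Longrightarrow> exec (Seq c d) s (t + t') s''"
| CondT: "bval b s \<Longrightarrow> exec c s t s' \<Longrightarrow> exec (Cond b c d) s (bcost b s + t) s'"
| CondF: "\<not> bval b s \<Longrightarrow> exec d s t s' \<Longrightarrow> exec (Cond b c d) s (bcost b s + t) s'"
| LoopF: "\<not> bval b s \<Longrightarrow> exec (Loop b c) s (bcost b s) s"
| LoopT: "bval b s \<Longrightarrow> exec c s t s' \<Longrightarrow> exec (Loop b c) s' t' s'' \<Longrightarrow>
     exec (Loop b c) s (bcost b s + t + t') s''"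

inductive_cases exec_cases:
  "exec Skip s t s'" "exec (Assign x e) s t s'" "exec (Store a i e) s t s'"
  "exec (Seq c d) s t s'" "exec (Cond b c d) s t s'" "exec (Loop b c) s t s'"

lemma exec_deterministic:
  "exec c s t s' \<Longrightarrow> exec c s u s'' \<Longrightarrow> u = t \<and> s'' = s'"
proof (induction arbitrary: u s'' rule: exec.induct)
  case (Skip s)
  then show ?case by (auto elim: exec_cases(1))
next
  case (Assign x e s)
  then show ?case by (auto elim: exec_cases(2))
next
  case (Store a i e s)
  then show ?case by (auto elim: exec_cases(3))
next
  case (Seq c s t s' d t' r)
  from Seq.prems show ?case by (rule exec_cases(4)) (use Seq.IH in metis)
next
  case (CondT b s c t s' d)
  from CondT.prems show ?case by (rule exec_cases(5)) (use CondT.IH CondT.hyps in metis)+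
next
  case (CondF b s d t s' c)
  from CondF.prems show ?case by (rule exec_cases(5)) (use CondF.IH CondF.hyps in metis)+
next
  case (LoopF b s c)
  from LoopF.prems show ?case by (rule exec_cases(6)) (use LoopF.hyps in metis)+
next
  case (LoopT b s c t s' t' r)
  from LoopT.prems show ?case by (rule exec_cases(6)) (use LoopT.IH LoopT.hyps in metis)+
qed

text \<open>The input sits in array 0 with its number of integers in register 0; the output is read off
  array 1, with its number of integers in register 1. Everything else is initially 0.\<close>

definition init_state :: "int list \<Rightarrow> state" where
  "init_state xs =
     ((\<lambda>x. if x = 0 then int (length xs) else 0),
      (\<lambda>a i. if a = 0 \<and> 0 \<le> i \<and> i < int (length xs) then xs ! nat i else 0))"

definition result :: "state \<Rightarrow> int list" where
  "result s = map (\<lambda>i. snd s 1 (int i)) [0..<nat (fst s 1)]"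

definition runs :: "com \<Rightarrow> int list \<Rightarrow> nat \<Rightarrow> int list \<Rightarrow> bool" where
  "runs c xs t ys \<longleftrightarrow> (\<exists>s. exec c (init_state xs) t s \<and> result s = ys)"

text \<open>Every instance with scores in \<open>\<rat> \<union> {-\<infinity>}\<close> has an encoding.\<close>

lemma encodes_exists:
  assumes inst: "pt_instance n F f"
    and rat: "\<And>v S. v < n \<Longrightarrow> S \<in> F v \<Longrightarrow> f v S = - \<infinity> \<or> f v S \<in> ereal ` \<rat>"
  shows "\<exists>xs. encodes n F f xs"
proof -
  have score: "\<exists>p q. 0 \<le> q \<and> f v S = score_val p q" if "v < n" "S \<in> F v" for v S
    using rat[OF that]
  proof
    assume "f v S = - \<infinity>"
    then show ?thesis by (intro exI[of _ 0]) (simp add: score_val_def)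
  next
    assume "f v S \<in> ereal ` \<rat>"
    then obtain r where r: "f v S = ereal r" "r \<in> \<rat>" by blast
    from r(2) obtain p q :: int where "q > 0" "r = of_int p / of_int q"
      by (meson Rats_cases')
    with r(1) show ?thesis
      by (intro exI[of _ p] exI[of _ q]) (simp add: score_val_def)
  qed
  have "\<exists>es. distinct (map (\<lambda>(us, p, q). set us) es) \<and>
      F v = (\<lambda>(us, p, q). set us) ` set es \<and>
      (\<forall>(us, p, q) \<in> set es. distinct us \<and> 0 \<le> q \<and> f v (set us) = score_val p q)"
    if v: "v < n" for v
  proof -
    have "F v \<subseteq> Pow ({..<n} - {v})" using inst v by (simp add: pt_instance_def)
    then have sub: "F v \<subseteq> Pow {..<n}" by blast
    then have "finite (F v)" by (rule finite_subset) simp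
    then obtain Ss where Ss: "set Ss = F v" "distinct Ss"
      using finite_distinct_list by blast
    have fin: "finite S" if "S \<in> F v" for S
      using sub that by (meson PowD finite_lessThan finite_subset subsetD)
    obtain P Q where PQ: "\<And>S. S \<in> F v \<Longrightarrow> 0 \<le> Q S \<and> f v S = score_val (P S) (Q S)"
      using score[OF v] by metis
    let ?e = "\<lambda>S. (sorted_list_of_set S, P S, Q S)"
    have "map (\<lambda>(us, p, q). set us) (map ?e Ss) = Ss"
      using fin Ss(1) unfolding map_map by (intro map_idI) auto
    then have "distinct (map (\<lambda>(us, p, q). set us) (map ?e Ss))"
      "F v = (\<lambda>(us, p, q). set us) ` set (map ?e Ss)"
      using Ss by (metis, metis set_map)
    moreover have "\<forall>(us, p, q) \<in> set (map ?e Ss).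
        distinct us \<and> 0 \<le> q \<and> f v (set us) = score_val p q"
      using PQ fin Ss(1) by auto
    ultimately show ?thesis by (intro exI conjI)
  qed
  then have "\<forall>v \<in> {..<n}. \<exists>es. distinct (map (\<lambda>(us, p, q). set us) es) \<and>
      F v = (\<lambda>(us, p, q). set us) ` set es \<and>
      (\<forall>(us, p, q) \<in> set es. distinct us \<and> 0 \<le> q \<and> f v (set us) = score_val p q)"
    by simp
  from bchoice[OF this] obtain E where E: "\<forall>v \<in> {..<n}.
      distinct (map (\<lambda>(us, p, q). set us) (E v)) \<and>
      F v = (\<lambda>(us, p, q). set us) ` set (E v) \<and>
      (\<forall>(us, p, q) \<in> set (E v). distinct us \<and> 0 \<le> q \<and> f v (set us) = score_val p q)" ..
  have nth: "map E [0..<n] ! v = E v" if "v < n" for v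
    using that by simp
  have "encodes n F f (input_code (map E [0..<n]))"
    unfolding encodes_def
  proof (intro exI[of _ "map E [0..<n]"] conjI allI impI)
    fix v assume v: "v < n"
    note Ev = E[rule_format, unfolded lessThan_iff, OF v, folded nth[OF v]]
    show "distinct (map (\<lambda>(us, p, q). set us) (map E [0..<n] ! v))"
      "F v = (\<lambda>(us, p, q). set us) ` set (map E [0..<n] ! v)"
      "\<forall>(us, p, q) \<in> set (map E [0..<n] ! v).
         distinct us \<and> 0 \<le> q \<and> f v (set us) = score_val p q"
      by (fact Ev[THEN conjunct1] Ev[THEN conjunct2, THEN conjunct1]
          Ev[THEN conjunct2, THEN conjunct2])+
  qed simp_all
  then show ?thesis ..
qed

end

theory Submission
  imports Defs "HOL-Library.Nat_Bijection"
begin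

text \<open>Parent sets of negative score can be replaced by the empty set, so scores are nonnegative and,
  after multiplication with a common denominator, integers. Let \<open>M d X\<close> be the maximum weight of a
  polytree inside the node set \<open>X\<close> in which \<open>d\<close> has no parents (\<open>d = n\<close> means no restriction). In an
  optimal polytree pick a child \<open>y\<close> of \<open>d\<close>, or any node with parents if \<open>d\<close> has no child. Deleting the
  arcs into \<open>y\<close> splits \<open>X\<close> into a part of \<open>y\<close>, in which \<open>y\<close> has become parentless, and one part for
  every parent; \<open>d\<close> lies in the part of a parent. Attaching the parents one at a time, each step is a
  maximum over ordered pairs of disjoint subsets, of which there are \<open>3 ^ n\<close>. Relaxing the table with
  all entries \<open>n\<close> times suffices, since every part has fewer nodes with parents.\<close>

section \<open>Timed program logic\<close>

text \<open>Obstacle: while the parents of \<open>y\<close> are being attached, the part of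
  \<open>y\<close> must leave \<open>y\<close> parentless. If the forbidden node \<open>d\<close>
  could lie in that part as well, two nodes would have to be parentless there, then three, and the
  table would need a set of forbidden nodes as index. The choice of \<open>y\<close> keeps
  \<open>d\<close> out of this part, so one forbidden node always suffices and the table has
  \<open>(n + 1) * 2 ^ n\<close> entries. A maximum weight alone does not tell which polytree
  attains it. Instead of back pointers, the low \<open>n * n\<close> bits of a weight carry the
  adjacency matrix. This code is additive over disjoint arc sets, so it is maintained by the same
  additions as the score, and the final table entry is at once value and answer. Time: each single
  operation of the program is executed at most \<open>4 * L ^ 5 * 3 ^ n\<close> times, where
  \<open>L\<close> is the input length, and costs a constant times \<open>B ^ 2\<close> for a bit
  bound \<open>B\<close> polynomial in \<open>L\<close>. The constants depend on the program only
  and move into the exponent because \<open>2 <= L\<close>.\<close>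

lemma int_len_bound:
  assumes "\<bar>x\<bar> < 2 ^ b" "1 \<le> b"
  shows "int_len x \<le> b + 1"
proof (cases "x = 0")
  case True
  then show ?thesis using assms by (simp add: int_len_def)
next
  case False
  have "2 ^ floor_log (nat \<bar>x\<bar>) \<le> nat \<bar>x\<bar>"
    using False by (intro floor_log_exp2_le) simp
  also have "\<dots> < 2 ^ b"
    using assms(1) by (simp add: nat_less_iff)
  finally have "floor_log (nat \<bar>x\<bar>) < b" by simp
  then show ?thesis by (simp add: int_len_def)
qed

lemma abs_less_int_len: "\<bar>x\<bar> < 2 ^ int_len x"
proof -
  have "nat \<bar>x\<bar> < 2 * 2 ^ floor_log (nat \<bar>x\<bar>)"
    by (rule floor_log_exp2_gt)
  also have "\<dots> \<le> 2 ^ int_len x"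
    unfolding int_len_def by simp
  finally have "int (nat \<bar>x\<bar>) < int (2 ^ int_len x)"
    by (simp only: of_nat_less_iff)
  then show ?thesis by simp
qed

text \<open>One bound for the entire state, so that the cost of an operation depends on
  \<open>B\<close> and on the program text only.\<close>

definition bnd :: "nat \<Rightarrow> state \<Rightarrow> bool" where
  "bnd B s \<longleftrightarrow> (\<forall>x. \<bar>fst s x\<bar> < 2 ^ B) \<and> (\<forall>a i. \<bar>snd s a i\<bar> < 2 ^ B)"

text \<open>Chosen so that \<open>2 ^ (B * asize e)\<close> bounds the value of \<open>e\<close>. A
  constant counts with its magnitude instead of its bit length: crude, but independent of the
  state.\<close>

fun asize :: "aexp \<Rightarrow> nat" where
  "asize (Const c) = nat \<bar>c\<bar> + 1"
| "asize (Reg x) = 1"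
| "asize (Arr a e) = asize e + 1"
| "asize (Add d e) = asize d + asize e"
| "asize (Sub d e) = asize d + asize e"
| "asize (Mul d e) = asize d + asize e"
| "asize (Div d e) = asize d + asize e"
| "asize (Mod d e) = asize d + asize e"

fun bsize :: "bexp \<Rightarrow> nat" where
  "bsize (Less d e) = asize d + asize e"
| "bsize (Equal d e) = asize d + asize e"
| "bsize (Neg b) = bsize b + 1"
| "bsize (Conj b c) = bsize b + bsize c"

lemma asize_pos: "1 \<le> asize e"
  by (induction e) auto

lemma bsize_pos: "1 \<le> bsize b"
  by (induction b) (use asize_pos in \<open>auto intro: trans_le_add1 simp: Suc_le_eq\<close>)

lemma add_le_mult_powers:
  fixes x y :: int
  assumes "\<bar>x\<bar> < 2 ^ a" "\<bar>y\<bar> < 2 ^ b" "1 \<le> a" "1 \<le> b"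
  shows "\<bar>x\<bar> + \<bar>y\<bar> < 2 ^ (a + b)"
proof -
  have "(2::int) \<le> 2 ^ a" "(2::int) \<le> 2 ^ b"
    using assms(3,4) self_le_power[of "2::int"] by simp_all
  \<comment> \<open>Expanding this product gives
    \<open>2 * (2 ^ a + 2 ^ b) <= 2 ^ a * 2 ^ b + 4\<close>, and the 4 is again at most
    \<open>2 ^ a * 2 ^ b\<close>.\<close>
  then have "0 \<le> ((2::int) ^ a - 2) * (2 ^ b - 2)" by simp
  then have "(2::int) ^ a * 2 + 2 ^ b * 2 \<le> 2 ^ a * 2 ^ b + 4" by (simp add: algebra_simps)
  moreover have "(4::int) \<le> 2 ^ a * 2 ^ b"
    using mult_mono[of 2 "(2::int) ^ a" 2 "2 ^ b"] \<open>2 \<le> 2 ^ a\<close> \<open>2 \<le> 2 ^ b\<close> by simp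
  ultimately show ?thesis using assms(1,2) unfolding power_add by linarith
qed

text \<open>Sums are estimated as generously as products, which makes the exponent additive for
  every binary operation.\<close>

lemma aval_bound:
  assumes s: "bnd B s" and B: "1 \<le> B"
  shows "\<bar>aval e s\<bar> < 2 ^ (B * asize e)"
proof (induction e)
  case (Const c)
  have "nat \<bar>c\<bar> < 2 ^ nat \<bar>c\<bar>" by (rule less_exp)
  then have "int (nat \<bar>c\<bar>) < int (2 ^ nat \<bar>c\<bar>)" by (simp only: of_nat_less_iff)
  also have "\<dots> \<le> 2 ^ (B * asize (Const c))"
    proof -
    have "nat \<bar>c\<bar> \<le> B * asize (Const c)"
      using B mult_le_mono[of 1 B "nat \<bar>c\<bar>" "asize (Const c)"] by simp
    then show ?thesis by (simp add: power_increasing)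
  qed
  finally show ?case by simp
next
  case (Reg x)
  then show ?case using s by (simp add: bnd_def)
next
  case (Arr a e)
  have "(2::int) ^ B \<le> 2 ^ (B * asize (Arr a e))"
    by (rule power_increasing) simp_all
  moreover have "\<bar>aval (Arr a e) s\<bar> < 2 ^ B" using s by (simp add: bnd_def)
  ultimately show ?case by linarith
next
  case (Add d e)
  have "1 \<le> B * asize d" "1 \<le> B * asize e" using B asize_pos by simp_all
  from add_le_mult_powers[OF Add this] show ?case by (simp add: distrib_left)
next
  case (Sub d e)
  have "1 \<le> B * asize d" "1 \<le> B * asize e" using B asize_pos by simp_all
  from add_le_mult_powers[OF Sub this] show ?case by (simp add: distrib_left)
next
  case (Mul d e)
  then show ?case
    by (auto simp: distrib_left power_add abs_mult intro: mult_strict_mono')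
next
  case (Div d e)
  have "\<bar>aval d s div aval e s\<bar> \<le> \<bar>aval d s\<bar>"
  proof (cases "aval e s = 0")
    case False
    then show ?thesis
      using div_le_dividend[of "nat \<bar>aval d s\<bar>" "nat \<bar>aval e s\<bar>"]
      by (smt (verit) div_by_1 div_neg_pos_less0 int_div_less_self neg_imp_zdiv_nonneg_iff
          pos_imp_zdiv_nonneg_iff zdiv_mono2_neg div_minus_right zdiv_mono2)
  qed simp
  also have "\<dots> < 2 ^ (B * asize d)" by (rule Div)
  also have "(2::int) ^ (B * asize d) \<le> 2 ^ (B * asize (Div d e))"
    by (rule power_increasing) simp_all
  finally show ?case by simp
next
  case (Mod d e)
  have "1 \<le> B * asize d" "1 \<le> B * asize e" using B asize_pos by simp_all
  \<comment> \<open>Modulo zero returns the dividend, so the divisor alone is no bound.\<close>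
  moreover have "\<bar>aval d s mod aval e s\<bar> \<le> \<bar>aval d s\<bar> + \<bar>aval e s\<bar>"
    by (smt (verit) mod_by_0 neg_mod_bound neg_mod_sign pos_mod_bound pos_mod_sign)
  ultimately show ?case using add_le_mult_powers[OF Mod] by (fastforce simp: distrib_left)
qed

lemma int_len_aval:
  assumes "bnd B s" "1 \<le> B"
  shows "int_len (aval e s) \<le> 2 * B * asize e"
proof -
  have "1 \<le> B * asize e" using assms(2) asize_pos by simp
  with int_len_bound[OF aval_bound[OF assms] this] show ?thesis by linarith
qed

text \<open>In \<open>4 * B^2 * (a + b)^2\<close> the squares pay for evaluating the two operands;
  the cross term \<open>8 * B^2 * (a * b)\<close> is left to pay for the operation itself. This is
  why costs are bounded by a square of the size.\<close>

lemma two_operands_le: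
  fixes a b B :: nat
  assumes "1 \<le> a" "1 \<le> b" "1 \<le> B"
  shows "2 * B * a + 2 * B * b \<le> 8 * B\<^sup>2 * (a * b)" "1 \<le> 8 * B\<^sup>2 * (a * b)"
proof -
  have "a \<le> a * b" "b \<le> a * b" "B \<le> B\<^sup>2" using assms by (simp_all add: power2_eq_square)
  then have "B * a \<le> B\<^sup>2 * (a * b)" "B * b \<le> B\<^sup>2 * (a * b)"
    using mult_le_mono[of B "B\<^sup>2" a "a * b"] mult_le_mono[of B "B\<^sup>2" b "a * b"] by blast+
  then show "2 * B * a + 2 * B * b \<le> 8 * B\<^sup>2 * (a * b)" by linarith
  show "1 \<le> 8 * B\<^sup>2 * (a * b)" using assms by (simp add: Suc_le_eq)
qed

lemma acost_bound:
  assumes s: "bnd B s" and B: "1 \<le> B"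
  shows "acost e s \<le> 4 * B\<^sup>2 * (asize e)\<^sup>2"
proof -
  note len = int_len_aval[OF s B]
  have sq: "B * k \<le> B\<^sup>2 * k" for k
    using B by (simp add: power2_eq_square)
  have add: "acost d s + acost e s + int_len (aval d s) + int_len (aval e s)
      \<le> 4 * B\<^sup>2 * (asize d + asize e)\<^sup>2"
    if "acost d s \<le> 4 * B\<^sup>2 * (asize d)\<^sup>2" "acost e s \<le> 4 * B\<^sup>2 * (asize e)\<^sup>2" for d e
    using that two_operands_le(1)[OF asize_pos asize_pos B, of d e] len[of d] len[of e]
    by (simp add: power2_sum algebra_simps)
  have mul: "acost d s + acost e s + int_len (aval d s) * int_len (aval e s)
      \<le> 4 * B\<^sup>2 * (asize d + asize e)\<^sup>2"
    if "acost d s \<le> 4 * B\<^sup>2 * (asize d)\<^sup>2" "acost e s \<le> 4 * B\<^sup>2 * (asize e)\<^sup>2" for d e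
  proof -
    have "int_len (aval d s) * int_len (aval e s) \<le> (2 * B * asize d) * (2 * B * asize e)"
      by (intro mult_mono len) simp_all
    also have "\<dots> \<le> 8 * B\<^sup>2 * (asize d * asize e)" by (simp add: power2_eq_square)
    finally show ?thesis using that by (simp add: power2_sum algebra_simps)
  qed
  show ?thesis
  proof (induction e)
    case (Const c)
    have "int_len (aval (Const c) s) \<le> 2 * B * asize (Const c)" by (rule len)
    also have "\<dots> \<le> 4 * B\<^sup>2 * (asize (Const c))\<^sup>2"
      using two_operands_le(1)[OF asize_pos asize_pos B, of "Const c" "Const c"]
      by (simp add: power2_eq_square)
    finally show ?case by simp
  next
    case (Reg x)
    have "int_len (aval (Reg x) s) \<le> 2 * B" using len[of "Reg x"] by simp
    then show ?case using sq[of 1] by simp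
  next
    case (Arr a e)
    have "int_len (aval (Arr a e) s) \<le> 2 * B"
      using s B int_len_bound[of "aval (Arr a e) s" B] by (simp add: bnd_def)
    then show ?case
      using Arr len[of e] two_operands_le(1)[OF asize_pos le_refl B, of e]
      by (simp add: power2_eq_square algebra_simps)
  qed (simp_all add: add mul)
qed

lemma bcost_bound:
  assumes s: "bnd B s" and B: "1 \<le> B"
  shows "bcost b s \<le> 4 * B\<^sup>2 * (bsize b)\<^sup>2"
proof -
  note len = int_len_aval[OF s B]
  have add: "acost d s + acost e s + int_len (aval d s) + int_len (aval e s)
      \<le> 4 * B\<^sup>2 * (asize d + asize e)\<^sup>2" for d e
    using acost_bound[OF s B, of d] acost_bound[OF s B, of e]
      two_operands_le(1)[OF asize_pos asize_pos B, of d e] len[of d] len[of e]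
    by (simp add: power2_sum algebra_simps)
  show ?thesis
  proof (induction b)
    case (Neg b)
    then show ?case
      using two_operands_le(2)[OF bsize_pos le_refl B, of b]
      by (simp del: One_nat_def add: power2_eq_square algebra_simps)
  next
    case (Conj b c)
    then show ?case
      using two_operands_le(2)[OF bsize_pos bsize_pos B, of b c]
      unfolding bcost.simps bsize.simps power2_sum distrib_left by linarith
  qed (simp_all add: add)
qed

section \<open>Written variables, cost of a program text, weakest preconditions\<close>

abbreviation set_reg :: "nat \<Rightarrow> int \<Rightarrow> state \<Rightarrow> state" where
  "set_reg x k s \<equiv> ((fst s)(x := k), snd s)"

fun wregs :: "com \<Rightarrow> nat set" where
  "wregs Skip = {}"
| "wregs (Assign x e) = {x}"
| "wregs (Store a i e) = {}"
| "wregs (Seq c d) = wregs c \<union> wregs d"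
| "wregs (Cond b c d) = wregs c \<union> wregs d"
| "wregs (Loop b c) = wregs c"

fun warrs :: "com \<Rightarrow> nat set" where
  "warrs Skip = {}"
| "warrs (Assign x e) = {}"
| "warrs (Store a i e) = {a}"
| "warrs (Seq c d) = warrs c \<union> warrs d"
| "warrs (Cond b c d) = warrs c \<union> warrs d"
| "warrs (Loop b c) = warrs c"

definition frame :: "com \<Rightarrow> state \<Rightarrow> state \<Rightarrow> bool" where
  "frame c s s' \<longleftrightarrow> (\<forall>x. x \<notin> wregs c \<longrightarrow> fst s' x = fst s x) \<and>
     (\<forall>a. a \<notin> warrs c \<longrightarrow> snd s' a = snd s a)"

lemma exec_frame: "exec c s t s' \<Longrightarrow> frame c s s'"
  by (induction rule: exec.induct) (auto simp: frame_def)

text \<open>Costs in units of \<open>B^2\<close>, each operation of the text counted once. The body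
  of a \<open>Loop\<close> is also counted once, since repetition is accounted for by the separate
  factor \<open>W\<close> in \<open>ok\<close>.\<close>

fun unit_cost :: "com \<Rightarrow> nat" where
  "unit_cost Skip = 1"
| "unit_cost (Assign x e) = 8 * (asize e)\<^sup>2"
| "unit_cost (Store a i e) = 8 * (asize i)\<^sup>2 + 8 * (asize e)\<^sup>2"
| "unit_cost (Seq c d) = unit_cost c + unit_cost d"
| "unit_cost (Cond b c d) = 4 * (bsize b)\<^sup>2 + unit_cost c + unit_cost d"
| "unit_cost (Loop b c) = 4 * (bsize b)\<^sup>2 + unit_cost c"

text \<open>\<open>W\<close> bounds how often any single operation of \<open>c\<close> is executed, and \<open>B\<close> bounds the bit lengths.\<close>

definition ok :: "nat \<Rightarrow> com \<Rightarrow> state \<Rightarrow> nat \<Rightarrow> (state \<Rightarrow> bool) \<Rightarrow> bool" where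
  "ok B c s W Q \<longleftrightarrow> (\<exists>t s'. exec c s t s' \<and> t \<le> unit_cost c * W * B\<^sup>2 \<and> bnd B s' \<and> Q s')"

lemma ok_conseq:
  assumes "ok B c s W Q" "W \<le> W'" "\<And>s'. bnd B s' \<Longrightarrow> frame c s s' \<Longrightarrow> Q s' \<Longrightarrow> Q' s'"
  shows "ok B c s W' Q'"
proof -
  obtain t s' where "exec c s t s'" "t \<le> unit_cost c * W * B\<^sup>2" "bnd B s'" "Q s'"
    using assms(1) unfolding ok_def by blast
  moreover have "unit_cost c * W * B\<^sup>2 \<le> unit_cost c * W' * B\<^sup>2" using assms(2) by simp
  ultimately show ?thesis unfolding ok_def using assms(3) exec_frame order_trans by blast
qed

text \<open>Both parts share the same \<open>W\<close>: it limits the executions of each single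
  operation, and adding up over operations happens in \<open>unit_cost\<close>.\<close>

lemma ok_Seq:
  assumes "ok B c s W Q" "\<And>s'. bnd B s' \<Longrightarrow> frame c s s' \<Longrightarrow> Q s' \<Longrightarrow> ok B d s' W Q'"
  shows "ok B (Seq c d) s W Q'"
proof -
  obtain t s' where 1: "exec c s t s'" "t \<le> unit_cost c * W * B\<^sup>2" "bnd B s'" "Q s'"
    using assms(1) unfolding ok_def by blast
  then obtain t' s'' where 2: "exec d s' t' s''" "t' \<le> unit_cost d * W * B\<^sup>2" "bnd B s''" "Q' s''"
    using assms(2) exec_frame unfolding ok_def by blast
  have "t + t' \<le> unit_cost (Seq c d) * W * B\<^sup>2" using 1(2) 2(2) by (simp add: distrib_right)
  with exec.Seq[OF 1(1) 2(1)] 2(3,4) show ?thesis unfolding ok_def by blast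
qed

text \<open>Meant for loop-free code; loops are treated by \<open>ok_For\<close>, hence
  \<open>False\<close> for \<open>Loop\<close>. The conditions on assigned values preserve
  \<open>bnd\<close>.\<close>

fun wp :: "nat \<Rightarrow> com \<Rightarrow> (state \<Rightarrow> bool) \<Rightarrow> state \<Rightarrow> bool" where
  "wp B Skip Q s = Q s"
| "wp B (Assign x e) Q s = (\<bar>aval e s\<bar> < 2 ^ B \<and> Q (set_reg x (aval e s) s))"
| "wp B (Store a i e) Q s = (\<bar>aval e s\<bar> < 2 ^ B \<and>
     Q (fst s, (snd s)(a := (snd s a)(aval i s := aval e s))))"
| "wp B (Seq c d) Q s = wp B c (wp B d Q) s"
| "wp B (Cond b c d) Q s = ((bval b s \<longrightarrow> wp B c Q s) \<and> (\<not> bval b s \<longrightarrow> wp B d Q s))"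
| "wp B (Loop b c) Q s = False"

lemma acost_int_len_bound:
  assumes "bnd B s" "1 \<le> B"
  shows "acost e s + int_len (aval e s) \<le> 8 * (asize e)\<^sup>2 * B\<^sup>2"
proof -
  have "2 * B * asize e \<le> 4 * B\<^sup>2 * (asize e)\<^sup>2"
    using two_operands_le(1)[OF asize_pos asize_pos assms(2), of e e]
    unfolding power2_eq_square by linarith
  then show ?thesis
    using acost_bound[OF assms, of e] int_len_aval[OF assms, of e] by (simp add: algebra_simps)
qed

lemma le_scale:
  fixes x k b W :: nat
  assumes "x \<le> k * b" "1 \<le> W"
  shows "x \<le> k * W * b"
proof -
  have "k * b * 1 \<le> k * b * W" using assms(2) by (rule mult_le_mono2)
  with assms(1) have "x \<le> k * b * W" by linarith
  then show ?thesis by (simp only: mult_ac)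
qed

lemma ok_Cond:
  assumes s: "bnd B s" and B: "1 \<le> B" and W: "1 \<le> W"
    and "bval b s \<Longrightarrow> ok B c s W Q" "\<not> bval b s \<Longrightarrow> ok B d s W Q"
  shows "ok B (Cond b c d) s W Q"
proof -
  have cost: "bcost b s \<le> 4 * (bsize b)\<^sup>2 * W * B\<^sup>2"
    by (rule le_scale[OF _ W]) (use bcost_bound[OF s B, of b] in \<open>simp add: mult_ac\<close>)
  show ?thesis
  proof (cases "bval b s")
    case True
    then obtain t s' where t: "exec c s t s'" "t \<le> unit_cost c * W * B\<^sup>2" "bnd B s'" "Q s'"
      using assms(4) unfolding ok_def by blast
    have "bcost b s + t \<le> unit_cost (Cond b c d) * W * B\<^sup>2"
      using cost t(2) by (simp add: algebra_simps)
    with exec.CondT[OF True t(1)] t(3,4) show ?thesis unfolding ok_def by blast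
  next
    case False
    then obtain t s' where t: "exec d s t s'" "t \<le> unit_cost d * W * B\<^sup>2" "bnd B s'" "Q s'"
      using assms(5) unfolding ok_def by blast
    have "bcost b s + t \<le> unit_cost (Cond b c d) * W * B\<^sup>2"
      using cost t(2) by (simp add: algebra_simps)
    with exec.CondF[OF False t(1)] t(3,4) show ?thesis unfolding ok_def by blast
  qed
qed

text \<open>Without loops every operation is executed at most once, so any \<open>W >= 1\<close>
  will do.\<close>

lemma ok_straight:
  assumes "bnd B s" "1 \<le> B" "1 \<le> W" "wp B c Q s"
  shows "ok B c s W Q"
  using assms(1,4)
proof (induction c arbitrary: s Q)
  case Skip
  then have "exec Skip s 1 s" "1 \<le> unit_cost Skip * W * B\<^sup>2" "Q s"
    using assms(2,3) exec.Skip by (simp_all add: Suc_le_eq)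
  with Skip.prems(1) show ?case unfolding ok_def by blast
next
  case (Assign x e)
  then have "bnd B (set_reg x (aval e s) s)" "Q (set_reg x (aval e s) s)" by (auto simp: bnd_def)
  moreover have "acost e s + int_len (aval e s) \<le> unit_cost (Assign x e) * W * B\<^sup>2"
    unfolding unit_cost.simps
    by (intro le_scale[OF _ assms(3)] acost_int_len_bound[OF Assign.prems(1) assms(2)])
  ultimately show ?case using exec.Assign[of x e s] unfolding ok_def by blast
next
  case (Store a i e)
  let ?s = "(fst s, (snd s)(a := (snd s a)(aval i s := aval e s)))"
  have "bnd B ?s" "Q ?s" using Store.prems by (auto simp: bnd_def)
  moreover have "acost i s + acost e s + int_len (aval i s) + int_len (aval e s)
      \<le> unit_cost (Store a i e) * W * B\<^sup>2"
    unfolding unit_cost.simps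
    by (rule le_scale[OF _ assms(3)])
      (use acost_int_len_bound[OF Store.prems(1) assms(2), of e]
        acost_int_len_bound[OF Store.prems(1) assms(2), of i] in \<open>simp add: distrib_right\<close>)
  ultimately show ?case using exec.Store[of a i e s] unfolding ok_def by blast
next
  case (Seq c d)
  have "ok B c s W (wp B d Q)" using Seq by simp
  from ok_Seq[OF this, of d Q] Seq.IH(2) show ?case by simp
next
  case (Cond b c d)
  then show ?case using assms(2,3) by (intro ok_Cond) auto
next
  case (Loop b c)
  then show ?case by simp
qed

section \<open>Counting loops\<close>

definition For :: "nat \<Rightarrow> aexp \<Rightarrow> com \<Rightarrow> com" where
  "For x e c = Seq (Assign x (Const 0))
     (Loop (Less (Reg x) e) (Seq c (Assign x (Add (Reg x) (Const 1)))))"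

lemma wregs_For [simp]: "wregs (For x e c) = insert x (wregs c)"
  and warrs_For [simp]: "warrs (For x e c) = warrs c"
  by (auto simp: For_def)

text \<open>The guard is tested \<open>R + 1\<close> times, whence \<open>(R + 1) * W\<close>. Since
  \<open>e\<close> is evaluated afresh at every test, it has to keep the value \<open>R\<close>
  throughout; \<open>bound\<close> may use the frame and the invariant for this. In
  \<open>step\<close> the invariant refers to the state after the counter has been advanced.\<close>

lemma ok_For:
  assumes s: "bnd B s" and B: "1 \<le> B" and W: "1 \<le> W" and R: "int R < 2 ^ B" and x: "x \<notin> wregs c"
    and W': "(R + 1) * W \<le> W'"
    and init: "Inv 0 (set_reg x 0 s)"
    and step: "\<And>i s'. \<lbrakk>i < R; bnd B s'; fst s' x = int i; frame (For x e c) s s'; Inv i s'\<rbrakk> \<Longrightarrow>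
      ok B c s' W (\<lambda>s''. Inv (Suc i) (set_reg x (int (Suc i)) s''))"
    and bound: "\<And>i s'. \<lbrakk>i \<le> R; bnd B s'; fst s' x = int i; frame (For x e c) s s'; Inv i s'\<rbrakk> \<Longrightarrow>
      aval e s' = int R"
  shows "ok B (For x e c) s W' (\<lambda>s'. Inv R s' \<and> fst s' x = int R)"
proof -
  let ?d = "Seq c (Assign x (Add (Reg x) (Const 1)))"
  let ?b = "Less (Reg x) e"
  let ?g = "4 * (asize e + 1)\<^sup>2 * W * B\<^sup>2"
  \<comment> \<open>Cost of one iteration. The increment has an expression of size 3, and
    \<open>72 = 8 * 3 ^ 2\<close> is its unit cost.\<close>
  let ?K = "(unit_cost c + 72) * W * B\<^sup>2 + ?g"
  have guard: "bcost ?b s' \<le> ?g" if "bnd B s'" for s'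
    by (rule le_scale[OF _ W]) (use bcost_bound[OF that B, of ?b] in \<open>simp add: mult_ac\<close>)
  \<comment> \<open>Induction on the number \<open>j\<close> of iterations still to come; the
    counter stands at \<open>R - j\<close>.\<close>
  have loop: "\<exists>t s''. exec (Loop ?b ?d) s' t s'' \<and> t \<le> j * ?K + ?g \<and> bnd B s'' \<and>
      Inv R s'' \<and> fst s'' x = int R"
    if "j \<le> R" "bnd B s'" "fst s' x = int (R - j)" "frame (For x e c) s s'" "Inv (R - j) s'" for j s'
    using that
  proof (induction j arbitrary: s')
    case 0
    then have "\<not> bval ?b s'" using bound[of R s'] by simp
    from exec.LoopF[OF this] guard[OF 0(2)] 0 show ?case by fastforce
  next
    case (Suc j)
    let ?i = "R - Suc j"
    have i: "?i < R" "Suc ?i = R - j" using Suc.prems(1) by simp_all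
    have b: "bval ?b s'" using bound[of ?i s'] i Suc.prems by simp
    have "ok B c s' W (\<lambda>s''. Inv (Suc ?i) (set_reg x (int (Suc ?i)) s''))"
      using step[of ?i s'] i Suc.prems by blast
    then obtain t s1 where 1: "exec c s' t s1" "t \<le> unit_cost c * W * B\<^sup>2" "bnd B s1"
      "Inv (Suc ?i) (set_reg x (int (Suc ?i)) s1)"
      unfolding ok_def by blast
    have fr: "frame c s' s1" using exec_frame[OF 1(1)] .
    then have x1: "fst s1 x = int ?i" using x Suc.prems(3) by (simp add: frame_def)
    let ?inc = "Add (Reg x) (Const 1)"
    let ?s2 = "set_reg x (int (R - j)) s1"
    have inc: "aval ?inc s1 = int (R - j)" using x1 i(2) by simp
    have 2: "exec (Assign x ?inc) s1 (acost ?inc s1 + int_len (aval ?inc s1)) ?s2"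
      using exec.Assign[of x ?inc s1] unfolding inc .
    have "acost ?inc s1 + int_len (aval ?inc s1) \<le> 72 * B\<^sup>2"
      using acost_int_len_bound[OF 1(3) B, of ?inc] by (simp add: power2_eq_square)
    then have 3: "acost ?inc s1 + int_len (aval ?inc s1) \<le> 72 * W * B\<^sup>2"
      using W by (rule le_scale)
    have "\<bar>int (R - j)\<bar> < 2 ^ B" using R by simp
    then have bnd2: "bnd B ?s2" using 1(3) by (auto simp: bnd_def)
    have "frame (For x e c) s ?s2" using fr Suc.prems(4) by (auto simp: frame_def)
    then obtain t' s'' where 4: "exec (Loop ?b ?d) ?s2 t' s''" "t' \<le> j * ?K + ?g"
      "bnd B s''" "Inv R s''" "fst s'' x = int R"
      using Suc.IH[of ?s2] bnd2 Suc.prems(1) 1(4) unfolding i(2) by auto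
    have "bcost ?b s' + (t + (acost ?inc s1 + int_len (aval ?inc s1))) + t' \<le> Suc j * ?K + ?g"
      using guard[OF Suc.prems(2)] 1(2) 3 4(2) unfolding mult_Suc distrib_right by linarith
    with exec.LoopT[OF b exec.Seq[OF 1(1) 2] 4(1)] 4(3-5) show ?case by blast
  qed
  let ?s0 = "set_reg x 0 s"
  have "bnd B ?s0" using s by (auto simp: bnd_def)
  moreover have "frame (For x e c) s ?s0" by (auto simp: frame_def)
  ultimately obtain t s' where t: "exec (Loop ?b ?d) ?s0 t s'" "t \<le> R * ?K + ?g" "bnd B s'"
    "Inv R s'" "fst s' x = int R"
    using loop[of R ?s0] init by auto
  have a: "exec (Assign x (Const 0)) s (acost (Const 0) s + int_len 0) ?s0"
    using exec.Assign[of x "Const 0" s] by simp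
  have "acost (Const 0) s + int_len 0 \<le> 8 * W * B\<^sup>2"
    by (rule le_scale[OF _ W]) (use acost_int_len_bound[OF s B, of "Const 0"] in simp)
  then have "acost (Const 0) s + int_len 0 + t \<le> 8 * W * B\<^sup>2 + (R + 1) * ?K"
    using t(2) by (simp add: distrib_right)
  also have "\<dots> \<le> (R + 1) * (8 * W * B\<^sup>2 + ?K)" by (simp add: distrib_left distrib_right)
  also have "\<dots> = unit_cost (For x e c) * ((R + 1) * W) * B\<^sup>2"
    by (simp add: For_def algebra_simps power2_eq_square)
  also have "\<dots> \<le> unit_cost (For x e c) * W' * B\<^sup>2"
    using W' by (simp only: mult_le_mono1 mult_le_mono2)
  finally show ?thesis
    using exec.Seq[OF a t(1)] t(3-5) unfolding ok_def For_def by blast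
qed

section \<open>Polytrees and bridges\<close>

definition links :: "arcs \<Rightarrow> (nat \<times> nat) set" where
  "links A = A \<union> A\<inverse>"

text \<open>Working form of "polytree": besides long undirected cycles it excludes antiparallel arcs
  and loops (the reflexive closure always joins \<open>u\<close> to itself). One condition thus
  replaces acyclicity and the forest condition together.\<close>

definition all_bridges :: "arcs \<Rightarrow> bool" where
  "all_bridges A \<longleftrightarrow> (\<forall>u v. (u, v) \<in> A \<longrightarrow> (u, v) \<notin> (links (A - {(u, v)}))\<^sup>*)"

lemma sym_links: "sym (links A)"
  by (auto simp: links_def sym_def)

lemma links_mono: "A \<subseteq> B \<Longrightarrow> links A \<subseteq> links B"
  by (auto simp: links_def)

lemma all_bridges_mono: "all_bridges B \<Longrightarrow> A \<subseteq> B \<Longrightarrow> all_bridges A"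
  unfolding all_bridges_def by (meson Diff_mono links_mono rtrancl_mono subset_refl subsetD)

lemma links_skeleton: "(a, b) \<in> links A \<longleftrightarrow> {a, b} \<in> skeleton A"
  by (auto simp: links_def skeleton_def doubleton_eq_iff)

lemma rtrancl_distinct_path:
  assumes "(x, y) \<in> r\<^sup>*"
  shows "\<exists>xs. xs \<noteq> [] \<and> hd xs = x \<and> last xs = y \<and> distinct xs \<and>
    successively (\<lambda>a b. (a, b) \<in> r) xs"
  using assms
proof (induction rule: rtrancl_induct)
  case base
  show ?case by (intro exI[of _ "[x]"]) simp
next
  case (step y z)
  then obtain xs where xs: "xs \<noteq> []" "hd xs = x" "last xs = y" "distinct xs"
    "successively (\<lambda>a b. (a, b) \<in> r) xs" by blast
  show ?case
  proof (cases "z \<in> set xs")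
    case True
    then obtain as bs where "xs = as @ z # bs" by (meson split_list)
    then have "xs = (as @ [z]) @ bs" by simp
    with xs show ?thesis
      by (intro exI[of _ "as @ [z]"]) (auto simp: successively_append_iff hd_append split: if_splits)
  next
    case False
    with xs step(2) show ?thesis
      by (intro exI[of _ "xs @ [z]"]) (auto simp: successively_append_iff)
  qed
qed

text \<open>A simple path around the arc \<open>(u, v)\<close> closes to an undirected cycle. It has
  at least three nodes, because a path of two nodes would be the reverse arc, giving a directed
  cycle.\<close>

lemma polytree_all_bridges:
  assumes dag: "acyclic A" and forest: "is_forest (skeleton A)"
  shows "all_bridges A"
  unfolding all_bridges_def
proof (intro allI impI notI)
  fix u v
  assume uv: "(u, v) \<in> A" and "(u, v) \<in> (links (A - {(u, v)}))\<^sup>*"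
  then obtain xs where xs: "xs \<noteq> []" "hd xs = u" "last xs = v" "distinct xs"
    and path: "successively (\<lambda>a b. (a, b) \<in> links (A - {(u, v)})) xs"
    using rtrancl_distinct_path by metis
  have "u \<noteq> v" using dag uv by (auto simp: acyclic_def)
  have edge: "{xs ! i, xs ! Suc i} \<in> skeleton (A - {(u, v)})" if "Suc i < length xs" for i
    using path that by (simp add: successively_conv_nth links_skeleton)
  have "2 \<le> length xs"
    using xs(1-3) \<open>u \<noteq> v\<close> by (cases xs; cases "tl xs") auto
  moreover have "length xs \<noteq> 2"
  proof
    assume "length xs = 2"
    then obtain a b where "xs = [a, b]" by (auto simp: numeral_2_eq_2 length_Suc_conv)
    with xs path have "(u, v) \<in> links (A - {(u, v)})" by simp
    then have "(v, u) \<in> A" by (auto simp: links_def)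
    with uv have "(u, u) \<in> A\<^sup>+" by auto
    with dag show False by (auto simp: acyclic_def)
  qed
  ultimately have len: "3 \<le> length xs" by simp
  have "ucycle (skeleton A) xs"
    unfolding ucycle_def
  proof (intro conjI allI impI)
    fix i assume i: "i < length xs"
    show "{xs ! i, xs ! (Suc i mod length xs)} \<in> skeleton A"
    proof (cases "Suc i < length xs")
      case True
      with edge[OF True] show ?thesis by (auto simp: skeleton_def)
    next
      case False
      then have "Suc i = length xs" using i by simp
      then have "xs ! i = v" "xs ! (Suc i mod length xs) = u"
        using xs by (auto simp: last_conv_nth hd_conv_nth dest: sym)
      then show ?thesis using uv by (auto simp: skeleton_def)
    qed
  qed (use len xs in auto)
  with forest show False by (auto simp: is_forest_def)
qed

text \<open>The walk may be stopped at its first visit to \<open>x\<close>, before any arc leaves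
  \<open>x\<close>.\<close>

lemma rtrancl_avoid_target: "(z, x) \<in> A\<^sup>* \<Longrightarrow> (z, x) \<in> (A - {x} \<times> UNIV)\<^sup>*"
proof (induction rule: converse_rtrancl_induct)
  case (step a b)
  then show ?case
    by (cases "a = x") (auto intro: converse_rtrancl_into_rtrancl)
qed simp

text \<open>On a directed cycle through \<open>x\<close> with first arc \<open>(x, z)\<close>, the
  way back from \<open>z\<close> can avoid all arcs leaving \<open>x\<close>, so
  \<open>(x, z)\<close> is no bridge.\<close>

lemma all_bridges_acyclic:
  assumes "all_bridges A"
  shows "acyclic A"
  unfolding acyclic_def
proof (intro allI notI)
  fix x assume "(x, x) \<in> A\<^sup>+"
  then obtain z where z: "(x, z) \<in> A" "(z, x) \<in> A\<^sup>*" by (meson tranclD)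
  have "(z, x) \<in> (A - {x} \<times> UNIV)\<^sup>*" using rtrancl_avoid_target[OF z(2)] .
  also have "\<dots> \<subseteq> (links (A - {(x, z)}))\<^sup>*" by (rule rtrancl_mono) (auto simp: links_def)
  finally have "(x, z) \<in> (links (A - {(x, z)}))\<^sup>*"
    by (meson sym_links sym_rtrancl symD)
  with assms z(1) show False by (auto simp: all_bridges_def)
qed

lemma successively_rtrancl:
  "successively (\<lambda>a b. (a, b) \<in> r) xs \<Longrightarrow> xs \<noteq> [] \<Longrightarrow> (hd xs, last xs) \<in> r\<^sup>*"
  by (induction xs rule: induct_list012) (auto intro: converse_rtrancl_into_rtrancl)

text \<open>The closing edge of a cycle comes from an arc in one of the two directions, and the rest
  of the cycle joins its ends without it.\<close>

lemma all_bridges_forest: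
  assumes "all_bridges A"
  shows "is_forest (skeleton A)"
  unfolding is_forest_def
proof (rule notI, elim exE)
  fix vs assume "ucycle (skeleton A) vs"
  then have len: "3 \<le> length vs" and dist: "distinct vs"
    and edge: "\<And>i. i < length vs \<Longrightarrow> {vs ! i, vs ! (Suc i mod length vs)} \<in> skeleton A"
    by (auto simp: ucycle_def)
  define m where "m = length vs - 1"
  have m: "2 \<le> m" "length vs = Suc m" using len by (auto simp: m_def)
  let ?a = "vs ! 0" and ?b = "vs ! m"
  have "{?b, ?a} \<in> skeleton A" using edge[of m] m by simp
  then have ab: "(?a, ?b) \<in> links A" by (simp add: links_skeleton insert_commute)
  \<comment> \<open>Both orientations of the closing edge are removed, so that the same path serves
    whichever of them is an arc.\<close>
  have path: "successively (\<lambda>a b. (a, b) \<in> links (A - {(?a, ?b), (?b, ?a)})) vs"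
    unfolding successively_conv_nth
  proof (intro allI impI)
    fix i assume i: "Suc i < length vs"
    have "{vs ! i, vs ! Suc i} \<in> skeleton A" using edge[of i] i by simp
    then have "(vs ! i, vs ! Suc i) \<in> links A" by (simp add: links_skeleton)
    moreover have "{vs ! i, vs ! Suc i} \<noteq> {?a, ?b}"
      using dist i m by (auto simp: doubleton_eq_iff nth_eq_iff_index_eq)
    ultimately show "(vs ! i, vs ! Suc i) \<in> links (A - {(?a, ?b), (?b, ?a)})"
      by (auto simp: links_def)
  qed
  have ne: "vs \<noteq> []" using len by auto
  have "(hd vs, last vs) \<in> (links (A - {(?a, ?b), (?b, ?a)}))\<^sup>*"
    by (rule successively_rtrancl[OF path ne])
  moreover have "hd vs = ?a" "last vs = ?b" using m ne by (auto simp: hd_conv_nth last_conv_nth)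
  ultimately have conn: "(?a, ?b) \<in> (links (A - {(?a, ?b), (?b, ?a)}))\<^sup>*" by simp
  from ab consider "(?a, ?b) \<in> A" | "(?b, ?a) \<in> A" by (auto simp: links_def)
  then show False
  proof cases
    case 1
    have "(?a, ?b) \<in> (links (A - {(?a, ?b)}))\<^sup>*"
      using conn rtrancl_mono[OF links_mono, of "A - {(?a, ?b), (?b, ?a)}" "A - {(?a, ?b)}"] by blast
    with 1 assms show False by (auto simp: all_bridges_def)
  next
    case 2
    have "(?a, ?b) \<in> (links (A - {(?b, ?a)}))\<^sup>*"
      using conn rtrancl_mono[OF links_mono, of "A - {(?a, ?b), (?b, ?a)}" "A - {(?b, ?a)}"] by blast
    then have "(?b, ?a) \<in> (links (A - {(?b, ?a)}))\<^sup>*"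
      by (meson sym_links sym_rtrancl symD)
    with 2 assms show False by (auto simp: all_bridges_def)
  qed
qed

lemma is_polytree_iff: "is_polytree n A \<longleftrightarrow> A \<subseteq> {..<n} \<times> {..<n} \<and> all_bridges A"
  unfolding is_polytree_def is_dag_def
  using polytree_all_bridges all_bridges_acyclic all_bridges_forest by blast

text \<open>Collapsing everything outside \<open>Y\<close> to the attachment point \<open>y\<close> turns a path into a path
  inside \<open>Y\<close>.\<close>

lemma rtrancl_retract:
  assumes "(a, b) \<in> (links (A \<union> C))\<^sup>*" "a \<in> Y" "b \<in> Y" "A \<subseteq> Y \<times> Y"
    and C: "\<And>p q. (p, q) \<in> C \<Longrightarrow> (p \<in> Y \<longrightarrow> p = y) \<and> (q \<in> Y \<longrightarrow> q = y)"
  shows "(a, b) \<in> (links A)\<^sup>*"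
proof -
  define g where "g x = (if x \<in> Y then x else y)" for x
  have "(g a, g b) \<in> (links A)\<^sup>*" using assms(1)
  proof (induction rule: rtrancl_induct)
    case (step p q)
    have "(p, q) \<in> A \<or> (q, p) \<in> A \<or> (p, q) \<in> C \<or> (q, p) \<in> C"
      using step(2) by (auto simp: links_def)
    then have "g p = g q \<or> (g p, g q) \<in> links A"
      using assms(4) C[of p q] C[of q p] unfolding g_def links_def by (elim disjE) auto
    with step.IH show ?case by (auto intro: rtrancl_into_rtrancl)
  qed simp
  with assms(2,3) show ?thesis by (simp add: g_def)
qed

text \<open>A path around an old arc is retracted to the side of that arc, the other side collapsing
  to the end of the new arc. The new arc is a bridge because without it no link leaves
  \<open>Z\<close>.\<close>

lemma all_bridges_join:
  assumes A: "all_bridges A" "A \<subseteq> Y \<times> Y" and B: "all_bridges B" "B \<subseteq> Z \<times> Z"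
    and YZ: "Y \<inter> Z = {}" and y: "y \<in> Y" and u: "u \<in> Z"
  shows "all_bridges (A \<union> B \<union> {(u, y)})"
  unfolding all_bridges_def
proof (intro allI impI notI)
  fix a b
  assume ab: "(a, b) \<in> A \<union> B \<union> {(u, y)}"
    and conn: "(a, b) \<in> (links (A \<union> B \<union> {(u, y)} - {(a, b)}))\<^sup>*"
  consider "(a, b) \<in> A" | "(a, b) \<in> B" | "(a, b) = (u, y)" using ab by blast
  then show False
  proof cases
    case 1
    then have "(a, b) \<notin> B" "(a, b) \<noteq> (u, y)" using A(2) B(2) YZ u by auto
    then have "A \<union> B \<union> {(u, y)} - {(a, b)} = (A - {(a, b)}) \<union> (B \<union> {(u, y)})" by auto
    with conn have "(a, b) \<in> (links ((A - {(a, b)}) \<union> (B \<union> {(u, y)})))\<^sup>*" by simp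
    then have "(a, b) \<in> (links (A - {(a, b)}))\<^sup>*"
      by (rule rtrancl_retract[where Y = Y and y = y]) (use 1 A(2) B(2) YZ u in auto)
    with 1 A(1) show False by (auto simp: all_bridges_def)
  next
    case 2
    then have "(a, b) \<notin> A" "(a, b) \<noteq> (u, y)" using A(2) B(2) YZ y by auto
    then have "A \<union> B \<union> {(u, y)} - {(a, b)} = (B - {(a, b)}) \<union> (A \<union> {(u, y)})" by auto
    with conn have "(a, b) \<in> (links ((B - {(a, b)}) \<union> (A \<union> {(u, y)})))\<^sup>*" by simp
    then have "(a, b) \<in> (links (B - {(a, b)}))\<^sup>*"
      by (rule rtrancl_retract[where Y = Z and y = u]) (use 2 A(2) B(2) YZ y in auto)
    with 2 B(1) show False by (auto simp: all_bridges_def)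
  next
    case 3
    have "b \<in> Z"
      using conn
    proof (induction rule: rtrancl_induct)
      case base
      show ?case using 3 u by simp
    next
      case (step p q)
      then show ?case using A(2) B(2) YZ 3 unfolding links_def by auto
    qed
    with 3 y YZ show False by auto
  qed
qed

text \<open>Converse of joining. \<open>Y\<close> is only the component of \<open>y\<close> once the
  arc is gone; all other components, isolated nodes included, go to \<open>Z\<close>. This asymmetry
  yields the last claim, which will force a childless and parentless \<open>d\<close> out of
  \<open>Y\<close>.\<close>

lemma all_bridges_cut:
  assumes A: "all_bridges A" "A \<subseteq> X \<times> X" and uy: "(u, y) \<in> A"
  obtains Y Z A1 A2 where "X = Y \<union> Z" "Y \<inter> Z = {}" "y \<in> Y" "u \<in> Z" "A1 \<subseteq> Y \<times> Y" "A2 \<subseteq> Z \<times> Z"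
    "A = A1 \<union> A2 \<union> {(u, y)}" "(u, y) \<notin> A1 \<union> A2"
    "\<And>x. x \<in> Y \<Longrightarrow> x \<noteq> y \<Longrightarrow> \<exists>z. (x, z) \<in> links A1"
proof -
  let ?A = "A - {(u, y)}"
  define Y where "Y = {x \<in> X. (y, x) \<in> (links ?A)\<^sup>*}"
  define Z where "Z = X - Y"
  have conn: "(u, y) \<notin> (links ?A)\<^sup>*" using A(1) uy by (auto simp: all_bridges_def)
  then have "(y, u) \<notin> (links ?A)\<^sup>*" by (meson sym_links sym_rtrancl symD)
  then have u: "u \<in> Z" using uy A(2) by (auto simp: Z_def Y_def)
  have closed: "(p \<in> Y) = (q \<in> Y)" if "(p, q) \<in> ?A" for p q
  proof -
    have "(p, q) \<in> links ?A" "(q, p) \<in> links ?A" "p \<in> X" "q \<in> X"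
      using that A(2) by (auto simp: links_def)
    then show ?thesis unfolding Y_def by (auto intro: rtrancl_into_rtrancl)
  qed
  define A1 where "A1 = ?A \<inter> Y \<times> Y"
  define A2 where "A2 = ?A \<inter> Z \<times> Z"
  have "?A \<subseteq> A1 \<union> A2" using closed A(2) by (fastforce simp: A1_def A2_def Z_def)
  then have "A = A1 \<union> A2 \<union> {(u, y)}" using uy by (auto simp: A1_def A2_def)
  moreover have "\<exists>z. (x, z) \<in> links A1" if "x \<in> Y" "x \<noteq> y" for x
  proof -
    have "(y, x) \<in> (links ?A)\<^sup>*" using that(1) by (simp add: Y_def)
    with that(2) obtain z where z: "(z, x) \<in> links ?A" by (metis rtranclE)
    with closed that(1) have "z \<in> Y" unfolding links_def by blast
    with z that(1) have "(x, z) \<in> links A1" by (auto simp: links_def A1_def)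
    then show ?thesis ..
  qed
  moreover have "X = Y \<union> Z" "Y \<inter> Z = {}" "y \<in> Y" "A1 \<subseteq> Y \<times> Y" "A2 \<subseteq> Z \<times> Z"
    "(u, y) \<notin> A1 \<union> A2"
    using uy A(2) by (auto simp: Y_def Z_def A1_def A2_def)
  ultimately show ?thesis using u that by metis
qed

section \<open>The dynamic program\<close>

lemma parents_outside: "A \<subseteq> Y \<times> Y \<Longrightarrow> v \<notin> Y \<Longrightarrow> parents A v = {}"
  by (auto simp: parents_def)

lemma parents_mono: "A \<subseteq> B \<Longrightarrow> parents A v \<subseteq> parents B v"
  by (auto simp: parents_def)

lemma set_encode_Un_disjoint:
  "finite A \<Longrightarrow> finite B \<Longrightarrow> A \<inter> B = {} \<Longrightarrow> set_encode (A \<union> B) = set_encode A + set_encode B"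
  by (simp add: set_encode_def sum.union_disjoint)

lemma set_encode_less:
  assumes "A \<subseteq> {..<k}"
  shows "set_encode A < 2 ^ k"
proof -
  have "set_encode A \<le> sum ((^) 2) {..<k}"
    unfolding set_encode_def by (rule sum_mono2) (use assms in auto)
  also have "\<dots> < 2 ^ k"
    using sum_power2[of k] by (simp add: lessThan_atLeast0)
  finally show ?thesis .
qed

definition non_sources :: "arcs \<Rightarrow> nat set" where
  "non_sources A = {v. parents A v \<noteq> {}}"

locale dp =
  fixes n :: nat and adm :: "nat \<Rightarrow> nat set set" and sc :: "nat \<Rightarrow> nat set \<Rightarrow> nat"
  assumes adm_empty: "v < n \<Longrightarrow> {} \<in> adm v"
    and sc_empty: "v < n \<Longrightarrow> sc v {} = 0"
begin

definition code :: "arcs \<Rightarrow> nat" where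
  "code A = set_encode ((\<lambda>(u, v). u * n + v) ` A)"

text \<open>The high part of a weight is the score, the low part (below \<open>2 ^ (n * n)\<close>) determines the
  digraph, so that the maximum weight alone reveals an optimal polytree.\<close>

definition wt :: "arcs \<Rightarrow> nat" where
  "wt A = (\<Sum>v<n. 2 ^ (n * n) * sc v (parents A v)) + code A"

text \<open>Weight during assembly: \<open>y\<close> may still lack some of its parents but is
  already credited with the score \<open>s\<close> of the full parent set.\<close>

definition pwt :: "nat \<Rightarrow> nat \<Rightarrow> arcs \<Rightarrow> nat" where
  "pwt y s A = (\<Sum>v<n. 2 ^ (n * n) * (if v = y then s else sc v (parents A v))) + code A"

definition valid :: "nat \<Rightarrow> nat set \<Rightarrow> arcs \<Rightarrow> bool" where
  "valid d X A \<longleftrightarrow> A \<subseteq> X \<times> X \<and> all_bridges A \<and> (\<forall>v<n. parents A v \<in> adm v) \<and> parents A d = {}"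

text \<open>Only \<open>y\<close> is exempt from \<open>adm\<close>: part of an admissible parent
  set need not be admissible.\<close>

definition pvalid :: "nat \<Rightarrow> nat set \<Rightarrow> nat \<Rightarrow> nat set \<Rightarrow> arcs \<Rightarrow> bool" where
  "pvalid y P d X A \<longleftrightarrow> y \<in> X \<and> A \<subseteq> X \<times> X \<and> all_bridges A \<and> parents A y = P \<and>
     (\<forall>v<n. v \<noteq> y \<longrightarrow> parents A v \<in> adm v) \<and> parents A d = {}"

text \<open>\<open>deriv M y s d us X a\<close>: the value \<open>a\<close> arises on the node set \<open>X\<close> by attaching the parents \<open>us\<close>
  to \<open>y\<close> one after the other, each with a part of \<open>X\<close> of its own; the part of \<open>y\<close> avoids \<open>d\<close>.\<close>

inductive deriv :: "(nat \<Rightarrow> nat set \<Rightarrow> nat) \<Rightarrow> nat \<Rightarrow> nat \<Rightarrow> nat \<Rightarrow> nat list \<Rightarrow> nat set \<Rightarrow> nat \<Rightarrow> bool"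
  for M y s d where
  base: "X \<subseteq> {..<n} \<Longrightarrow> y \<in> X \<Longrightarrow> d \<notin> X \<Longrightarrow> deriv M y s d [] X (M y X + 2 ^ (n * n) * s)"
| step: "deriv M y s d us Y a \<Longrightarrow> Z \<subseteq> {..<n} \<Longrightarrow> Y \<inter> Z = {} \<Longrightarrow> u \<in> Z \<Longrightarrow>
    deriv M y s d (us @ [u]) (Y \<union> Z) (a + M d Z + 2 ^ (u * n + y))"

text \<open>Every entry is attained by an actual polytree at all times. Besides correctness this
  gives the overflow bounds: derived values are weights of real digraphs, however many rounds have
  passed.\<close>

definition sound :: "(nat \<Rightarrow> nat set \<Rightarrow> nat) \<Rightarrow> bool" where
  "sound M \<longleftrightarrow> (\<forall>d\<le>n. \<forall>X. X \<subseteq> {..<n} \<longrightarrow> (\<exists>A. valid d X A \<and> M d X = wt A))"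

text \<open>The number of nodes with parents is the measure that one round raises by one.\<close>

definition complete :: "nat \<Rightarrow> (nat \<Rightarrow> nat set \<Rightarrow> nat) \<Rightarrow> bool" where
  "complete r M \<longleftrightarrow> (\<forall>d\<le>n. \<forall>X A. X \<subseteq> {..<n} \<longrightarrow> valid d X A \<longrightarrow> card (non_sources A) \<le> r \<longrightarrow>
     wt A \<le> M d X)"

lemma inj_code: "inj_on (\<lambda>(u, v). u * n + v) ({..<n} \<times> {..<n})"
proof (rule inj_onI, clarsimp)
  fix u v u' v' assume *: "v < n" "v' < n" "u * n + v = u' * n + v'"
  have "(a * n + b) div n = a \<and> (a * n + b) mod n = b" if "b < n" for a b using that by simp
  with * show "u = u' \<and> v = v'" by metis
qed

lemma code_image_less:
  assumes "A \<subseteq> {..<n} \<times> {..<n}"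
  shows "(\<lambda>(u, v). u * n + v) ` A \<subseteq> {..<n * n}"
proof clarsimp
  fix u v assume "(u, v) \<in> A"
  then have "Suc u \<le> n" "v < n" using assms by auto
  then have "u * n + v < Suc u * n" by simp
  also have "\<dots> \<le> n * n" using \<open>Suc u \<le> n\<close> by (rule mult_le_mono1)
  finally show "u * n + v < n * n" .
qed

lemma code_less: "A \<subseteq> {..<n} \<times> {..<n} \<Longrightarrow> code A < 2 ^ (n * n)"
  unfolding code_def by (intro set_encode_less code_image_less)

lemma code_Un:
  assumes "A \<subseteq> {..<n} \<times> {..<n}" "B \<subseteq> {..<n} \<times> {..<n}" "A \<inter> B = {}"
  shows "code (A \<union> B) = code A + code B"
proof -
  let ?g = "\<lambda>(u, v). u * n + v"
  have "finite A" "finite B" using assms(1,2) finite_subset by blast+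
  moreover have "?g ` A \<inter> ?g ` B = {}"
    using inj_on_image_Int[OF inj_code assms(1,2)] assms(3) by simp
  ultimately show ?thesis unfolding code_def image_Un by (intro set_encode_Un_disjoint) auto
qed

lemma parents_join:
  assumes A: "A \<subseteq> Y \<times> Y" and B: "B \<subseteq> Z \<times> Z" and YZ: "Y \<inter> Z = {}" and y: "y \<in> Y"
  shows "parents (A \<union> B \<union> {(u, y)}) v =
    (if v = y then insert u (parents A y) else if v \<in> Z then parents B v else parents A v)"
  using assms by (auto simp: parents_def)

text \<open>Reason why the recursion may simply add: the arc sets are disjoint, so their codes add,
  and a node other than \<open>y\<close> has parents on at most one side, the empty set on the other
  side scoring 0.\<close>

lemma pwt_join:
  assumes A: "A \<subseteq> Y \<times> Y" and B: "B \<subseteq> Z \<times> Z" and YZ: "Y \<inter> Z = {}" and y: "y \<in> Y" and u: "u \<in> Z"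
    and n: "Y \<subseteq> {..<n}" "Z \<subseteq> {..<n}"
  shows "pwt y s (A \<union> B \<union> {(u, y)}) = pwt y s A + wt B + 2 ^ (u * n + y)"
proof -
  let ?C = "A \<union> B \<union> {(u, y)}"
  have An: "A \<subseteq> {..<n} \<times> {..<n}" and Bn: "B \<subseteq> {..<n} \<times> {..<n}" using A B n by blast+
  have disj: "A \<inter> B = {}" "(A \<union> B) \<inter> {(u, y)} = {}" using A B YZ y u by auto
  have ABn: "A \<union> B \<subseteq> {..<n} \<times> {..<n}" using An Bn by simp
  have uyn: "{(u, y)} \<subseteq> {..<n} \<times> {..<n}" using y u n by auto
  have "code ?C = code A + code B + code {(u, y)}"
    using code_Un[OF An Bn disj(1)] code_Un[OF ABn uyn disj(2)] by (simp only:)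
  then have code: "code ?C = code A + code B + 2 ^ (u * n + y)"
    by (simp add: code_def)
  have "(if v = y then s else sc v (parents ?C v)) =
      (if v = y then s else sc v (parents A v)) + sc v (parents B v)" if "v < n" for v
  proof -
    consider "v = y" | "v \<noteq> y" "v \<in> Z" | "v \<noteq> y" "v \<notin> Z" by blast
    then show ?thesis
    proof cases
      case 1
      then have "parents B v = {}" using parents_outside[OF B] y YZ by blast
      with 1 that show ?thesis by (simp add: sc_empty)
    next
      case 2
      then have "parents A v = {}" using parents_outside[OF A] YZ by blast
      with 2 that show ?thesis unfolding parents_join[OF A B YZ y] by (simp add: sc_empty)
    next
      case 3
      then have "parents B v = {}" using parents_outside[OF B] by blast
      with 3 that show ?thesis unfolding parents_join[OF A B YZ y] by (simp add: sc_empty)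
    qed
  qed
  then have "(\<Sum>v<n. 2 ^ (n * n) * (if v = y then s else sc v (parents ?C v))) =
      (\<Sum>v<n. 2 ^ (n * n) * (if v = y then s else sc v (parents A v))) +
      (\<Sum>v<n. 2 ^ (n * n) * sc v (parents B v))"
    unfolding sum.distrib[symmetric] by (intro sum.cong) (simp_all add: distrib_left)
  with code show ?thesis unfolding pwt_def wt_def by simp
qed

lemma pwt_no_parents:
  assumes "y < n" "parents A y = {}"
  shows "pwt y s A = wt A + 2 ^ (n * n) * s"
proof -
  have eq: "2 ^ (n * n) * (if v = y then s else sc v (parents A v)) =
      2 ^ (n * n) * sc v (parents A v) + (if v = y then 2 ^ (n * n) * s else 0)" if "v < n" for v
    using assms that by (simp add: sc_empty)
  have "(\<Sum>v<n. 2 ^ (n * n) * (if v = y then s else sc v (parents A v))) =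
      (\<Sum>v<n. 2 ^ (n * n) * sc v (parents A v) + (if v = y then 2 ^ (n * n) * s else 0))"
    by (intro sum.cong refl eq) simp
  also have "\<dots> = (\<Sum>v<n. 2 ^ (n * n) * sc v (parents A v)) + 2 ^ (n * n) * s"
    using assms(1) by (simp add: sum.distrib)
  finally show ?thesis unfolding pwt_def wt_def by simp
qed

lemma pwt_sc: "pwt y (sc y (parents A y)) A = wt A"
  unfolding pwt_def wt_def by (auto intro!: sum.cong)

section \<open>Derivations correspond to polytrees\<close>

lemma deriv_sub: "deriv M y s d us X a \<Longrightarrow> X \<subseteq> {..<n} \<and> y \<in> X"
  by (induction rule: deriv.induct) auto

lemma deriv_ne: "deriv M y s d us X a \<Longrightarrow> d \<noteq> y"
  by (induction rule: deriv.induct) auto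

text \<open>Each step is realised by joining. \<open>d\<close> stays parentless because it is
  outside the initial part, parentless in every attached part, and different from \<open>y\<close>,
  the head of all new arcs.\<close>

lemma deriv_sound:
  assumes "deriv M y s d us X a" and M: "sound M" and y: "y < n" and d: "d \<le> n"
  shows "\<exists>A. pvalid y (set us) d X A \<and> a = pwt y s A"
  using assms(1)
proof (induction rule: deriv.induct)
  case (base X)
  then obtain A where A: "valid y X A" "M y X = wt A"
    using M y unfolding sound_def by (meson less_imp_le)
  have "parents A d = {}" using A(1) base(3) parents_outside by (auto simp: valid_def)
  with A base have "pvalid y (set []) d X A" unfolding valid_def pvalid_def by simp
  moreover have "M y X + 2 ^ (n * n) * s = pwt y s A"
    using A y by (simp add: pwt_no_parents valid_def)
  ultimately show ?case by blast
next
  case (step us Y a Z u)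
  then obtain A where A: "pvalid y (set us) d Y A" "a = pwt y s A" by blast
  obtain B where B: "valid d Z B" "M d Z = wt B" using M d step(2) unfolding sound_def by blast
  let ?C = "A \<union> B \<union> {(u, y)}"
  have sub: "A \<subseteq> Y \<times> Y" "B \<subseteq> Z \<times> Z" "y \<in> Y" using A(1) B(1) by (auto simp: pvalid_def valid_def)
  note par = parents_join[OF sub(1,2) step(3) sub(3), of u]
  have Yn: "Y \<subseteq> {..<n}" using deriv_sub[OF step(1)] by simp
  have "d \<noteq> y" using deriv_ne[OF step(1)] .
  then have "pvalid y (set (us @ [u])) d (Y \<union> Z) ?C"
    unfolding pvalid_def
    using A(1) B(1) sub par step(4) all_bridges_join[OF _ sub(1) _ sub(2) step(3) sub(3) step(4)]
    by (auto simp: pvalid_def valid_def)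
  moreover have "a + M d Z + 2 ^ (u * n + y) = pwt y s ?C"
    using pwt_join[OF sub(1,2) step(3) sub(3) step(4) Yn step(2)] A(2) B(2) by simp
  ultimately show ?case by blast
qed

text \<open>The last parent \<open>u\<close> is split off by cutting \<open>(u, y)\<close>. The
  count leaves out \<open>y\<close>, which is parentless in the initial part and absent from the
  attached ones. The condition on \<open>d\<close> is an invariant of the cutting that becomes
  \<open>d\<close> not in \<open>X\<close> once no parents are left, as the base case
  requires.\<close>

lemma deriv_complete:
  assumes M: "complete r M" and y: "y < n" and d: "d \<le> n"
  shows "X \<subseteq> {..<n} \<Longrightarrow> pvalid y (set us) d X A \<Longrightarrow> distinct us \<Longrightarrow>
    card (non_sources A - {y}) \<le> r \<Longrightarrow>
    d \<notin> X \<or> d \<in> set us \<or> us \<noteq> [] \<and> (\<forall>z. (d, z) \<notin> A) \<Longrightarrow>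
    \<exists>a. deriv M y s d us X a \<and> pwt y s A \<le> a"
proof (induction us arbitrary: X A rule: rev_induct)
  case Nil
  have par: "parents A y = {}" using Nil(2) by (simp add: pvalid_def)
  then have "valid y X A" using Nil(2) adm_empty[OF y] by (auto simp: pvalid_def valid_def)
  moreover have "non_sources A - {y} = non_sources A" using par by (auto simp: non_sources_def)
  ultimately have "wt A \<le> M y X" using M Nil y unfolding complete_def by (simp add: less_imp_le)
  moreover have "deriv M y s d [] X (M y X + 2 ^ (n * n) * s)"
    using Nil by (intro deriv.base) (auto simp: pvalid_def)
  ultimately show ?case using pwt_no_parents[OF y par, of s] by (intro exI) auto
next
  case (snoc u us)
  have A: "all_bridges A" "A \<subseteq> X \<times> X" and par: "parents A y = insert u (set us)"
    and dpar: "parents A d = {}" and pv: "\<And>v. v < n \<Longrightarrow> v \<noteq> y \<Longrightarrow> parents A v \<in> adm v"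
    using snoc.prems(2) by (auto simp: pvalid_def)
  have uy: "(u, y) \<in> A" using par by (auto simp: parents_def)
  obtain Y Z A1 A2 where cut: "X = Y \<union> Z" "Y \<inter> Z = {}" "y \<in> Y" "u \<in> Z" "A1 \<subseteq> Y \<times> Y" "A2 \<subseteq> Z \<times> Z"
    "A = A1 \<union> A2 \<union> {(u, y)}" "(u, y) \<notin> A1 \<union> A2"
    "\<And>x. x \<in> Y \<Longrightarrow> x \<noteq> y \<Longrightarrow> \<exists>z. (x, z) \<in> links A1"
    using all_bridges_cut[OF A uy] by metis
  have sub: "A1 \<subseteq> A" "A2 \<subseteq> A" using cut(7) by auto
  note parC = parents_join[OF cut(5,6,2,3), of u, folded cut(7)]
  have Yn: "Y \<subseteq> {..<n}" and Zn: "Z \<subseteq> {..<n}" using snoc.prems(1) cut(1) by auto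
  have "u \<notin> parents A1 y" using cut(8) by (simp add: parents_def)
  then have par1: "parents A1 y = set us"
    using parC[of y] par snoc.prems(3) by auto
  have par1': "parents A1 v \<in> adm v" if "v < n" "v \<noteq> y" for v
    using parC[of v] pv[OF that] parents_outside[OF cut(5), of v] adm_empty[OF that(1)] cut(2) that(2)
    by (cases "v \<in> Y"; cases "v \<in> Z") auto
  have par2: "parents A2 v \<in> adm v" if "v < n" for v
    using parC[of v] pv[OF that] parents_outside[OF cut(6), of v] adm_empty[OF that] cut(2,3)
    by (cases "v \<in> Z") auto
  have d1: "parents A1 d = {}" and d2: "parents A2 d = {}"
    using dpar parents_mono[OF sub(1), of d] parents_mono[OF sub(2), of d] by auto
  have "d \<noteq> y" using dpar par by auto
  have pv1: "pvalid y (set us) d Y A1"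
    using cut par1 par1' d1 all_bridges_mono[OF A(1) sub(1)] by (simp add: pvalid_def)
  have v2: "valid d Z A2"
    using cut par2 d2 all_bridges_mono[OF A(1) sub(2)] by (simp add: valid_def)
  have fin: "finite (non_sources A - {y})"
    by (rule finite_subset[of _ "{..<n}"])
      (use snoc.prems(1) parents_outside[OF A(2)] in \<open>auto simp: non_sources_def\<close>)
  have "non_sources A1 - {y} \<subseteq> non_sources A - {y}"
    using parents_mono[OF sub(1)] by (auto simp: non_sources_def)
  then have c1: "card (non_sources A1 - {y}) \<le> r"
    using card_mono[OF fin] snoc.prems(4) order_trans by blast
  have "non_sources A2 \<subseteq> non_sources A - {y}"
    using parents_mono[OF sub(2)] parents_outside[OF cut(6), of y] cut(2,3)
    by (fastforce simp: non_sources_def)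
  then have c2: "card (non_sources A2) \<le> r"
    using card_mono[OF fin] snoc.prems(4) order_trans by blast
  \<comment> \<open>A node of \<open>Y\<close> other than \<open>y\<close> has a link inside
    \<open>Y\<close>. Since \<open>d\<close> has no parents this is an arc leaving \<open>d\<close>,
    so the condition on \<open>d\<close> leaves only \<open>d\<close> among the parents, and
    \<open>u\<close> lies on the other side.\<close>
  have "d \<in> set us" if "d \<in> Y"
  proof -
    from that obtain z where "(d, z) \<in> links A1" using cut(9) \<open>d \<noteq> y\<close> by auto
    then have "(d, z) \<in> A" using d1 sub(1) by (auto simp: links_def parents_def)
    then have "d \<in> set (us @ [u])" using snoc.prems(5) A(2) by auto
    moreover have "d \<noteq> u" using that cut(2,4) by auto
    ultimately show "d \<in> set us" by simp
  qed
  then obtain a where a: "deriv M y s d us Y a" "pwt y s A1 \<le> a"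
    using snoc.IH[OF Yn pv1 _ c1] snoc.prems(3) by auto
  have "wt A2 \<le> M d Z" using M d Zn v2 c2 unfolding complete_def by blast
  then have "pwt y s A \<le> a + M d Z + 2 ^ (u * n + y)"
    using a(2) pwt_join[OF cut(5,6,2,3,4) Yn Zn, of s] cut(7) by simp
  moreover have "deriv M y s d (us @ [u]) X (a + M d Z + 2 ^ (u * n + y))"
    unfolding cut(1) by (rule deriv.step[OF a(1) Zn cut(2,4)])
  ultimately show ?case by blast
qed

section \<open>One relaxation, one round, all rounds\<close>

definition relaxed ::
  "(nat \<Rightarrow> nat set \<Rightarrow> nat) \<Rightarrow> nat \<Rightarrow> nat list \<Rightarrow> nat \<Rightarrow> nat \<Rightarrow> (nat \<Rightarrow> nat set \<Rightarrow> nat) \<Rightarrow> bool" where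
  "relaxed M y us s d M' \<longleftrightarrow> (\<forall>e X. e \<le> n \<longrightarrow> X \<subseteq> {..<n} \<longrightarrow>
     (e \<noteq> d \<longrightarrow> M' e X = M e X) \<and>
     (e = d \<longrightarrow> M d X \<le> M' d X \<and> (M' d X = M d X \<or> deriv M y s d us X (M' d X)) \<and>
        (\<forall>a. deriv M y s d us X a \<longrightarrow> a \<le> M' d X)))"

text \<open>The entries in \<open>D\<close> have already been used in round \<open>r\<close>.\<close>

definition progress :: "nat \<Rightarrow> (nat \<Rightarrow> nat set \<Rightarrow> nat) \<Rightarrow> (nat \<times> nat set \<times> nat) set \<Rightarrow> bool" where
  "progress r M D \<longleftrightarrow> sound M \<and> complete r M \<and>
     (\<forall>y P d X A. (y, P, d) \<in> D \<longrightarrow> X \<subseteq> {..<n} \<longrightarrow> valid d X A \<longrightarrow> parents A y = P \<longrightarrow> P \<noteq> {} \<longrightarrow>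
        d \<in> P \<or> (\<forall>z. (d, z) \<notin> A) \<longrightarrow> card (non_sources A) \<le> Suc r \<longrightarrow> wt A \<le> M d X)"

lemma relaxed_mono:
  "relaxed M y us s d M' \<Longrightarrow> e \<le> n \<Longrightarrow> X \<subseteq> {..<n} \<Longrightarrow> M e X \<le> M' e X"
  by (cases "e = d") (auto simp: relaxed_def)

text \<open>New table values are attained by \<open>deriv_sound\<close>; the triple just used is
  covered by \<open>deriv_complete\<close>; everything known before persists since entries never
  decrease.\<close>

lemma progress_relaxed:
  assumes P: "progress r M D" and M': "relaxed M y us s d M'"
    and y: "y < n" and d: "d \<le> n" and us: "distinct us" "set us \<in> adm y" and s: "s = sc y (set us)"
    and D: "D' \<subseteq> insert (y, set us, d) D" "\<And>y P e. (y, P, e) \<in> D' \<Longrightarrow> e \<le> n"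
  shows "progress r M' D'"
proof -
  have M: "sound M" "complete r M" using P by (auto simp: progress_def)
  note mono = relaxed_mono[OF M']
  have "\<exists>A. valid e X A \<and> M' e X = wt A" if e: "e \<le> n" and X: "X \<subseteq> {..<n}" for e X
  proof (cases "e = d \<and> M' d X \<noteq> M d X")
    case True
    then have "deriv M y s d us X (M' d X)" using M' d X by (auto simp: relaxed_def)
    from deriv_sound[OF this M(1) y d] obtain A where
      A: "pvalid y (set us) d X A" "M' d X = pwt y s A" by blast
    then have "valid d X A" using us by (auto simp: pvalid_def valid_def)
    moreover have "pwt y s A = wt A"
      using A(1) s pwt_sc[of y A] by (simp add: pvalid_def)
    ultimately show ?thesis using A True by auto
  next
    case False
    then have "M' e X = M e X" using M' e X by (auto simp: relaxed_def)
    then show ?thesis using M(1) e X by (simp add: sound_def)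
  qed
  then have "sound M'" by (auto simp: sound_def)
  moreover have "complete r M'"
    using M(2) mono unfolding complete_def by (meson order_trans)
  moreover have "wt A \<le> M' e X"
    if "(z, Q, e) \<in> D'" and X: "X \<subseteq> {..<n}" and A: "valid e X A" "parents A z = Q" "Q \<noteq> {}"
      "e \<in> Q \<or> (\<forall>x. (e, x) \<notin> A)" "card (non_sources A) \<le> Suc r" for z Q e X A
  proof (cases "(z, Q, e) \<in> D")
    case True
    then have "wt A \<le> M e X" using P X A unfolding progress_def by blast
    then show ?thesis using mono[OF D(2)[OF that(1)] X] by simp
  next
    case False
    then have eq: "z = y" "Q = set us" "e = d" using that(1) D(1) by auto
    have "finite (non_sources A)"
      by (rule finite_subset[of _ "{..<n}"])
        (use X A(1) parents_outside[of A X] in \<open>auto simp: non_sources_def valid_def\<close>)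
    moreover have "y \<in> non_sources A" using A eq by (auto simp: non_sources_def)
    \<comment> \<open>This is where the measure drops: \<open>y\<close> is one of the at most
      \<open>Suc r\<close> nodes with parents.\<close>
    ultimately have c: "card (non_sources A - {y}) \<le> r" using A(5) by simp
    have "y \<in> X" using A(1-3) eq parents_outside[of A X y] by (auto simp: valid_def)
    then have pv: "pvalid y (set us) d X A" using A eq by (auto simp: pvalid_def valid_def)
    obtain a where a: "deriv M y s d us X a" "pwt y s A \<le> a"
      using deriv_complete[OF M(2) y d X pv us(1) c, of s] A eq by auto
    have "a \<le> M' d X" using M' a(1) d X by (auto simp: relaxed_def)
    moreover have "pwt y s A = wt A" using A eq s pwt_sc[of y A] by simp
    ultimately show ?thesis using a(2) eq by simp
  qed
  ultimately show ?thesis unfolding progress_def by blast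
qed

text \<open>Once all triples have been used, every polytree with an arc falls under one of them; the
  arcless one is covered by \<open>complete r\<close> already.\<close>

lemma progress_round:
  assumes P: "progress r M D" and D: "\<And>y P d. y < n \<Longrightarrow> P \<in> adm y \<Longrightarrow> d \<le> n \<Longrightarrow> (y, P, d) \<in> D"
  shows "progress (Suc r) M {}"
proof -
  have M: "sound M" "complete r M" using P by (auto simp: progress_def)
  have "wt A \<le> M d X" if d: "d \<le> n" and X: "X \<subseteq> {..<n}" and A: "valid d X A"
    "card (non_sources A) \<le> Suc r" for d X A
  proof (cases "A = {}")
    case True
    then show ?thesis using M(2) d X A by (simp add: complete_def non_sources_def parents_def)
  next
    case False
    have "\<exists>y. parents A y \<noteq> {} \<and> (d \<in> parents A y \<or> (\<forall>z. (d, z) \<notin> A))"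
    proof (cases "\<exists>y. (d, y) \<in> A")
      case True
      then show ?thesis by (auto simp: parents_def)
    next
      case no_child: False
      obtain u y where "(u, y) \<in> A" using False by auto
      then show ?thesis using no_child by (auto simp: parents_def)
    qed
    then obtain y where y: "parents A y \<noteq> {}" "d \<in> parents A y \<or> (\<forall>z. (d, z) \<notin> A)" by blast
    then have "y \<in> X" using A(1) parents_outside[of A X y] by (auto simp: valid_def)
    then have "y < n" using X by auto
    then have "(y, parents A y, d) \<in> D" using D A(1) d by (simp add: valid_def)
    then show ?thesis using P X A y unfolding progress_def by blast
  qed
  then show ?thesis using M(1) unfolding progress_def complete_def by blast
qed

lemma valid_empty: "valid d X {}"
  by (simp add: valid_def all_bridges_def parents_def adm_empty)

lemma wt_empty: "wt {} = 0"
  by (simp add: wt_def code_def parents_def sc_empty)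

text \<open>Without nodes that have parents there are no arcs, so the zero table is right for
  \<open>r = 0\<close>.\<close>

lemma progress_init: "progress 0 (\<lambda>_ _. 0) {}"
proof -
  have "A = {}" if "X \<subseteq> {..<n}" "valid d X A" "card (non_sources A) \<le> 0" for d X A
  proof -
    have "finite (non_sources A)"
      by (rule finite_subset[of _ "{..<n}"])
        (use that(1,2) parents_outside[of A X] in \<open>auto simp: non_sources_def valid_def\<close>)
    with that(3) have "non_sources A = {}" by simp
    then show ?thesis by (auto simp: non_sources_def parents_def)
  qed
  then have "complete 0 (\<lambda>_ _. 0)" unfolding complete_def by (metis wt_empty le_refl)
  moreover have "sound (\<lambda>_ _. 0)" unfolding sound_def by (metis wt_empty valid_empty)
  ultimately show ?thesis by (simp add: progress_def)
qed

text \<open>At most \<open>n\<close> nodes can have parents, so \<open>complete n\<close> compares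
  with every polytree.\<close>

lemma progress_final:
  assumes "progress n M {}"
  shows "\<exists>A. valid n {..<n} A \<and> M n {..<n} = wt A \<and> (\<forall>B. valid n {..<n} B \<longrightarrow> wt B \<le> wt A)"
proof -
  obtain A where A: "valid n {..<n} A" "M n {..<n} = wt A"
    using assms unfolding progress_def sound_def by blast
  have "wt B \<le> wt A" if "valid n {..<n} B" for B
  proof -
    have "non_sources B \<subseteq> {..<n}"
      using that parents_outside[of B "{..<n}"] by (auto simp: valid_def non_sources_def)
    then have "card (non_sources B) \<le> n" using card_mono[of "{..<n}"] by fastforce
    with that assms show ?thesis unfolding progress_def complete_def A(2)[symmetric] by blast
  qed
  with A show ?thesis by blast
qed

lemma wt_div: "A \<subseteq> {..<n} \<times> {..<n} \<Longrightarrow> wt A div 2 ^ (n * n) = (\<Sum>v<n. sc v (parents A v))"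
  and wt_mod: "A \<subseteq> {..<n} \<times> {..<n} \<Longrightarrow> wt A mod 2 ^ (n * n) = code A"
  using code_less unfolding wt_def sum_distrib_left[symmetric] by (auto simp: div_add1_eq)

lemma pwt_bound:
  assumes "A \<subseteq> {..<n} \<times> {..<n}" "s \<le> S" "\<And>v. v < n \<Longrightarrow> v \<noteq> y \<Longrightarrow> sc v (parents A v) \<le> S"
  shows "pwt y s A < 2 ^ (n * n) * (n * S + 1)"
proof -
  have "(\<Sum>v<n. 2 ^ (n * n) * (if v = y then s else sc v (parents A v)))
      \<le> (\<Sum>v<n. 2 ^ (n * n) * S)"
    by (intro sum_mono mult_le_mono2) (use assms(2,3) in auto)
  also have "\<dots> = 2 ^ (n * n) * (n * S)" by simp
  finally show ?thesis using code_less[OF assms(1)] unfolding pwt_def by simp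
qed

end

section \<open>The program\<close>

lemma set_decode_less_subset: "x < 2 ^ k \<Longrightarrow> set_decode x \<subseteq> {..<k}"
proof
  fix i assume x: "x < 2 ^ k" and "i \<in> set_decode x"
  then have "odd (x div 2 ^ i)" by (simp add: set_decode_def)
  then have "x div 2 ^ i \<noteq> 0" by (metis even_zero)
  then have "2 ^ i \<le> x" by (simp add: div_eq_0_iff)
  with x have "(2::nat) ^ i < 2 ^ k" by linarith
  then show "i \<in> {..<k}" by simp
qed

text \<open>A number below \<open>3 ^ n\<close> encodes a pair of disjoint subsets of \<open>{..<n}\<close>: its ternary digits 1
  and 2 mark the two sets.\<close>

fun ones :: "nat \<Rightarrow> nat" where
  "ones c = (if c = 0 then 0 else 2 * ones (c div 3) + c mod 3 mod 2)"

fun twos :: "nat \<Rightarrow> nat" where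
  "twos c = (if c = 0 then 0 else 2 * twos (c div 3) + c mod 3 div 2)"

declare ones.simps [simp del] twos.simps [simp del]

lemma ones_0 [simp]: "ones 0 = 0" and twos_0 [simp]: "twos 0 = 0"
  by (simp_all add: ones.simps twos.simps)

lemma ones_eq: "ones c = 2 * ones (c div 3) + c mod 3 mod 2"
  by (cases "c = 0") (simp_all add: ones.simps[of c])

lemma twos_eq: "twos c = 2 * twos (c div 3) + c mod 3 div 2"
  by (cases "c = 0") (simp_all add: twos.simps[of c])

lemma ones_less: "c < 3 ^ m \<Longrightarrow> ones c < 2 ^ m"
proof (induction m arbitrary: c)
  case (Suc m)
  then have "c div 3 < 3 ^ m" by simp
  moreover have "c mod 3 mod 2 \<le> 1" by simp
  ultimately show ?case using Suc.IH[of "c div 3"] ones_eq[of c] by simp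
qed (simp add: ones.simps)

lemma twos_less: "c < 3 ^ m \<Longrightarrow> twos c < 2 ^ m"
proof (induction m arbitrary: c)
  case (Suc m)
  then have "c div 3 < 3 ^ m" by simp
  moreover have "c mod 3 div 2 \<le> 1" by simp
  ultimately show ?case using Suc.IH[of "c div 3"] twos_eq[of c] by simp
qed (simp add: twos.simps)

lemma ones_twos_disjoint: "set_decode (ones c) \<inter> set_decode (twos c) = {}"
proof (induction c rule: less_induct)
  case (less c)
  have "i \<notin> set_decode (ones c) \<or> i \<notin> set_decode (twos c)" for i
  proof (cases i)
    case 0
    consider "c mod 3 = 0" | "c mod 3 = 1" | "c mod 3 = 2" by linarith
    then show ?thesis using ones_eq[of c] twos_eq[of c] 0 by cases simp_all
  next
    case (Suc j)
    have "ones c div 2 = ones (c div 3)" "twos c div 2 = twos (c div 3)"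
      using ones_eq[of c] twos_eq[of c] by simp_all
    moreover have "j \<notin> set_decode (ones (c div 3)) \<or> j \<notin> set_decode (twos (c div 3))"
      using less[of "c div 3"] by (cases "c = 0") auto
    ultimately show ?thesis using Suc by simp
  qed
  then show ?case by blast
qed

text \<open>Guarantees that the loop over the numbers below \<open>3 ^ n\<close> meets every ordered
  pair of disjoint subsets.\<close>

lemma ones_twos_surj:
  "a < 2 ^ m \<Longrightarrow> b < 2 ^ m \<Longrightarrow> set_decode a \<inter> set_decode b = {} \<Longrightarrow>
    \<exists>c < 3 ^ m. ones c = a \<and> twos c = b"
proof (induction m arbitrary: a b)
  case (Suc m)
  have "set_decode (a div 2) \<inter> set_decode (b div 2) = {}"
    using Suc.prems(3) by (auto simp: set_decode_div_2)
  then obtain c where c: "c < 3 ^ m" "ones c = a div 2" "twos c = b div 2"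
    using Suc.IH[of "a div 2" "b div 2"] Suc.prems(1,2) less_mult_imp_div_less[of _ "2 ^ m" 2]
    by (auto simp: mult.commute)
  \<comment> \<open>Disjointness excludes the pair of low bits (1, 1), so
    \<open>a mod 2 + 2 * (b mod 2)\<close> is a ternary digit.\<close>
  have "\<not> (odd a \<and> odd b)" using Suc.prems(3) set_decode_0 by blast
  then consider "a mod 2 = 0" "b mod 2 = 0" | "a mod 2 = 1" "b mod 2 = 0" | "a mod 2 = 0" "b mod 2 = 1"
    by (metis mod_2_eq_odd even_iff_mod_2_eq_zero odd_iff_mod_2_eq_one)
  then have "a mod 2 + 2 * (b mod 2) < 3" "(a mod 2 + 2 * (b mod 2)) mod 2 = a mod 2"
    "(a mod 2 + 2 * (b mod 2)) div 2 = b mod 2"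
    by (cases; simp)+
  then have "ones (3 * c + (a mod 2 + 2 * (b mod 2))) = a"
    "twos (3 * c + (a mod 2 + 2 * (b mod 2))) = b" "3 * c + (a mod 2 + 2 * (b mod 2)) < 3 ^ Suc m"
    using c ones_eq[of "3 * c + (a mod 2 + 2 * (b mod 2))"]
      twos_eq[of "3 * c + (a mod 2 + 2 * (b mod 2))"] by simp_all
  then show ?case by blast
qed simp

text \<open>The machine has no shift; the power of two is looked up in array 2.\<close>

definition bit_test :: "aexp \<Rightarrow> aexp \<Rightarrow> bexp" where
  "bit_test x i = Equal (Mod (Div x (Arr 2 i)) (Const 2)) (Const 1)"

lemma bval_bit_test:
  assumes "aval x s = int a" "aval i s = int b" "snd s 2 (int b) = 2 ^ b"
  shows "bval (bit_test x i) s \<longleftrightarrow> b \<in> set_decode a"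
proof -
  have "aval x s div snd s 2 (aval i s) mod 2 = int (a div 2 ^ b mod 2)"
    using assms by (simp add: zdiv_int zmod_int)
  then show ?thesis
    unfolding bit_test_def set_decode_def by (simp add: odd_iff_mod_2_eq_one)
qed

text \<open>Registers: 2 \<open>n\<close>; 3 the common denominator; 5 \<open>3 ^ n\<close>; 16 \<open>2 ^ n\<close>; 6 the round; 7 the current
  node; 8 the number of its current entry, whose code starts at position 12; 9 the node that must
  have no parents; 15 the number of parents in the entry; 17 its scaled score; 18 the current
  parent, with index 11. Arrays: 2 powers of two; 3 and 4 the disjoint pairs; 5 the table; 6 the
  values derived for the current entry, stage by stage.\<close>

definition slot :: "aexp \<Rightarrow> aexp \<Rightarrow> aexp" where
  "slot d x = Add (Mul d (Reg 16)) x"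

text \<open>Array 6 stores values increased by one, so that 0 can mean "nothing derived". Row 0
  receives the base case of \<open>deriv\<close>, and all later rows are cleared of values left by
  earlier entries.\<close>

definition init_prog :: com where
  "init_prog = For 10 (Mul (Add (Reg 15) (Const 1)) (Reg 16))
     (Seq (Store 6 (Reg 10) (Const 0))
       (Cond (Conj (Less (Reg 10) (Reg 16))
           (Conj (bit_test (Reg 10) (Reg 7)) (Neg (bit_test (Reg 10) (Reg 9)))))
         (Store 6 (Reg 10) (Add (Add (Arr 5 (slot (Reg 7) (Reg 10))) (Reg 17)) (Const 1)))
         Skip))"

text \<open>The increase by one is inherited from the cell of the previous stage and not added
  again.\<close>

definition cand :: aexp where
  "cand = Add (Add (Arr 6 (slot (Reg 11) (Arr 4 (Reg 10)))) (Arr 5 (slot (Reg 9) (Arr 3 (Reg 10)))))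
     (Arr 2 (Add (Mul (Reg 18) (Reg 2)) (Reg 7)))"

definition cand_addr :: aexp where
  "cand_addr = slot (Add (Reg 11) (Const 1)) (Add (Arr 4 (Reg 10)) (Arr 3 (Reg 10)))"

definition stage_prog :: com where
  "stage_prog = For 10 (Reg 5)
     (Cond (Conj (bit_test (Arr 3 (Reg 10)) (Reg 18))
         (Conj (Less (Const 0) (Arr 6 (slot (Reg 11) (Arr 4 (Reg 10)))))
           (Less (Arr 6 cand_addr) cand)))
       (Store 6 cand_addr cand) Skip)"

definition stages_prog :: com where
  "stages_prog = For 11 (Reg 15)
     (Seq (Assign 18 (Arr 0 (Add (Reg 12) (Add (Reg 11) (Const 1))))) stage_prog)"

text \<open>Undoes the increase by one. A set without derivation yields -1 and never beats a table
  entry.\<close>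

definition max_prog :: com where
  "max_prog = For 10 (Reg 16)
     (Cond (Less (Arr 5 (slot (Reg 9) (Reg 10))) (Sub (Arr 6 (slot (Reg 15) (Reg 10))) (Const 1)))
       (Store 5 (slot (Reg 9) (Reg 10)) (Sub (Arr 6 (slot (Reg 15) (Reg 10))) (Const 1))) Skip)"

definition relax_prog :: com where
  "relax_prog = Seq init_prog (Seq stages_prog max_prog)"

lemma writes_init_prog [simp]: "wregs init_prog = {10}" "warrs init_prog = {6}"
  and writes_stage_prog [simp]: "wregs stage_prog = {10}" "warrs stage_prog = {6}"
  and writes_max_prog [simp]: "wregs max_prog = {10}" "warrs max_prog = {5}"
  by (auto simp: init_prog_def stage_prog_def max_prog_def)

lemma writes_stages_prog [simp]: "wregs stages_prog = {10, 11, 18}" "warrs stages_prog = {6}"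
  by (auto simp: stages_prog_def)

lemma writes_relax_prog [simp]: "wregs relax_prog = {10, 11, 18}" "warrs relax_prog = {5, 6}"
  by (auto simp: relax_prog_def)

section \<open>One relaxation on the machine\<close>

context dp
begin

definition tables :: "state \<Rightarrow> bool" where
  "tables s \<longleftrightarrow> fst s 2 = int n \<and> fst s 5 = 3 ^ n \<and> fst s 16 = 2 ^ n \<and>
     (\<forall>i\<le>n * n. snd s 2 (int i) = 2 ^ i) \<and>
     (\<forall>c<3 ^ n. snd s 3 (int c) = int (ones c) \<and> snd s 4 (int c) = int (twos c))"

definition stores :: "(nat \<Rightarrow> nat set \<Rightarrow> nat) \<Rightarrow> state \<Rightarrow> bool" where
  "stores M s \<longleftrightarrow> (\<forall>d X. d \<le> n \<longrightarrow> X \<subseteq> {..<n} \<longrightarrow>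
     snd s 5 (int (d * 2 ^ n + set_encode X)) = int (M d X))"

definition stage ::
  "(nat \<Rightarrow> nat set \<Rightarrow> nat) \<Rightarrow> nat \<Rightarrow> nat \<Rightarrow> nat \<Rightarrow> nat list \<Rightarrow> nat \<Rightarrow> state \<Rightarrow> bool" where
  "stage M y s d us i st \<longleftrightarrow> (\<forall>X. X \<subseteq> {..<n} \<longrightarrow>
     (let x = snd st 6 (int (i * 2 ^ n + set_encode X)) in
       (x = 0 \<or> (\<exists>a. x = int a + 1 \<and> deriv M y s d us X a)) \<and>
       (\<forall>a. deriv M y s d us X a \<longrightarrow> int a + 1 \<le> x)))"

lemma set_encode_sub: "X \<subseteq> {..<n} \<Longrightarrow> set_decode (set_encode X) = X \<and> set_encode X < 2 ^ n"
  using finite_subset set_encode_less by (metis finite_lessThan set_encode_inverse)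

lemma tables_pow: "tables s \<Longrightarrow> i \<le> n \<Longrightarrow> snd s 2 (int i) = 2 ^ i"
  unfolding tables_def by (meson le_square order_trans)

lemma ok_init_prog:
  assumes s: "bnd B s" "1 \<le> B" and T: "tables s" and M: "stores M s"
    and regs: "fst s 7 = int y" "fst s 9 = int d" "fst s 15 = int k" "fst s 17 = int (2 ^ (n * n) * p)"
    and y: "y < n" and d: "d \<le> n" and k: "(k + 1) * 2 ^ n < 2 ^ B"
    and bd: "\<And>us X a. deriv M y p d us X a \<Longrightarrow> a + 1 < 2 ^ B"
  shows "ok B init_prog s ((k + 1) * 2 ^ n + 1) (\<lambda>s'. stage M y p d [] 0 s' \<and>
    (\<forall>j. 2 ^ n \<le> j \<longrightarrow> j < (k + 1) * 2 ^ n \<longrightarrow> snd s' 6 (int j) = 0))"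
proof -
  \<comment> \<open>Intended content of cell \<open>j\<close>. Beyond row 0 it is 0, which the
    stages rely on because they take maxima into their rows.\<close>
  define val where "val j = (if j < 2 ^ n \<and> y \<in> set_decode j \<and> d \<notin> set_decode j
    then int (M y (set_decode j) + 2 ^ (n * n) * p) + 1 else 0)" for j
  let ?Inv = "\<lambda>x s'. \<forall>j<x. snd s' 6 (int j) = val j"
  have "int ((k + 1) * 2 ^ n) < int (2 ^ B)" using k by (simp only: of_nat_less_iff)
  then have k': "int ((k + 1) * 2 ^ n) < 2 ^ B" by simp
  have val: "\<bar>val j\<bar> < 2 ^ B" for j
  proof (cases "j < 2 ^ n \<and> y \<in> set_decode j \<and> d \<notin> set_decode j")
    case True
    then have "deriv M y p d [] (set_decode j) (M y (set_decode j) + 2 ^ (n * n) * p)"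
      by (intro deriv.base set_decode_less_subset) auto
    from bd[OF this] have "int (M y (set_decode j) + 2 ^ (n * n) * p + 1) < int (2 ^ B)"
      by (simp only: of_nat_less_iff)
    then show ?thesis using True by (simp add: val_def)
  qed (auto simp: val_def)
  have "ok B init_prog s ((k + 1) * 2 ^ n + 1)
    (\<lambda>s'. ?Inv ((k + 1) * 2 ^ n) s' \<and> fst s' 10 = int ((k + 1) * 2 ^ n))"
    unfolding init_prog_def
  proof (rule ok_For[OF s order_refl k'], goal_cases)
    case (4 x s')
    have fr: "\<And>r. r \<noteq> 10 \<Longrightarrow> fst s' r = fst s r" "\<And>a. a \<noteq> 6 \<Longrightarrow> snd s' a = snd s a"
      using 4(4) by (auto simp: frame_def)
    have T': "tables s'" using T fr by (simp add: tables_def)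
    have x: "aval (Reg 10) s' = int x" using 4(3) by simp
    have bits: "bval (bit_test (Reg 10) (Reg 7)) s' \<longleftrightarrow> y \<in> set_decode x"
      "bval (bit_test (Reg 10) (Reg 9)) s' \<longleftrightarrow> d \<in> set_decode x"
      using bval_bit_test[OF x _ tables_pow[OF T'], of "Reg 7" y]
        bval_bit_test[OF x _ tables_pow[OF T'], of "Reg 9" d] fr regs y d by simp_all
    have lt: "aval (Reg 10) s' < aval (Reg 16) s' \<longleftrightarrow> x < 2 ^ n"
      using x T' by (simp add: tables_def)
    have av: "aval (Add (Add (Arr 5 (slot (Reg 7) (Reg 10))) (Reg 17)) (Const 1)) s' = val x"
      if "x < 2 ^ n" "y \<in> set_decode x" "d \<notin> set_decode x"
    proof -
      have "snd s 5 (int (y * 2 ^ n + x)) = int (M y (set_decode x))"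
        using M y set_decode_less_subset[OF that(1)] unfolding stores_def
        by (metis less_imp_le set_decode_inverse)
      moreover have "aval (slot (Reg 7) (Reg 10)) s' = int (y * 2 ^ n + x)"
        using x T' fr regs by (simp add: slot_def tables_def)
      ultimately show ?thesis using that fr regs by (simp add: val_def)
    qed
    let ?s1 = "(fst s', (snd s')(6 := (snd s' 6)(int x := 0)))"
    have ev: "bval b ?s1 = bval b s'" if "b \<in> {bit_test (Reg 10) (Reg 7), bit_test (Reg 10) (Reg 9)}" for b
      using that by (auto simp: bit_test_def)
    have av1: "aval (Add (Add (Arr 5 (slot (Reg 7) (Reg 10))) (Reg 17)) (Const 1)) ?s1 =
        aval (Add (Add (Arr 5 (slot (Reg 7) (Reg 10))) (Reg 17)) (Const 1)) s'"
      by (simp add: slot_def)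
    show ?case
    proof (rule ok_straight[OF 4(2) s(2) order_refl])
      have inv: "snd s' 6 (int j) = val j" if "j < x" for j using 4(5) that by simp
      have "wp B (Cond (Conj (Less (Reg 10) (Reg 16))
           (Conj (bit_test (Reg 10) (Reg 7)) (Neg (bit_test (Reg 10) (Reg 9)))))
         (Store 6 (Reg 10) (Add (Add (Arr 5 (slot (Reg 7) (Reg 10))) (Reg 17)) (Const 1)))
         Skip) (\<lambda>s''. ?Inv (Suc x) (set_reg 10 (int (Suc x)) s'')) ?s1"
      proof (cases "x < 2 ^ n \<and> y \<in> set_decode x \<and> d \<notin> set_decode x")
        case True
        then show ?thesis
          using lt bits av av1 ev val[of x] inv x by (auto simp: less_Suc_eq simp del: aval.simps(3,4))
      next
        case False
        then have "val x = 0" by (auto simp: val_def)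
        then show ?thesis
          using False lt bits ev inv x by (auto simp: less_Suc_eq simp del: aval.simps(3,4))
      qed
      then show "wp B (Seq (Store 6 (Reg 10) (Const 0))
       (Cond (Conj (Less (Reg 10) (Reg 16))
           (Conj (bit_test (Reg 10) (Reg 7)) (Neg (bit_test (Reg 10) (Reg 9)))))
         (Store 6 (Reg 10) (Add (Add (Arr 5 (slot (Reg 7) (Reg 10))) (Reg 17)) (Const 1)))
         Skip)) (\<lambda>s''. ?Inv (Suc x) (set_reg 10 (int (Suc x)) s'')) s'"
        using 4(3) by (simp only: wp.simps(3,4) aval.simps(1,2)) simp
    qed
  next
    case (5 x s')
    then show ?case using regs T by (simp add: frame_def tables_def algebra_simps)
  qed simp_all
  then show ?thesis
  proof (rule ok_conseq)
    fix s' :: state assume *: "?Inv ((k + 1) * 2 ^ n) s' \<and> fst s' 10 = int ((k + 1) * 2 ^ n)"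
    have "stage M y p d [] 0 s'"
      unfolding stage_def
    proof (intro allI impI)
      fix X assume X: "X \<subseteq> {..<n}"
      have "set_encode X < (k + 1) * 2 ^ n" using set_encode_sub[OF X] by simp
      then have eq: "snd s' 6 (int (0 * 2 ^ n + set_encode X)) =
          (if y \<in> X \<and> d \<notin> X then int (M y X + 2 ^ (n * n) * p) + 1 else 0)"
        using * set_encode_sub[OF X] by (simp add: val_def)
      have dX: "deriv M y p d [] X a \<longleftrightarrow> y \<in> X \<and> d \<notin> X \<and> a = M y X + 2 ^ (n * n) * p" for a
        using X deriv.base[of X y d M p] by (auto elim: deriv.cases)
      show "let x = snd s' 6 (int (0 * 2 ^ n + set_encode X)) in
          (x = 0 \<or> (\<exists>a. x = int a + 1 \<and> deriv M y p d [] X a)) \<and>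
          (\<forall>a. deriv M y p d [] X a \<longrightarrow> int a + 1 \<le> x)"
        unfolding eq dX Let_def by auto
    qed
    moreover have "snd s' 6 (int j) = 0" if "2 ^ n \<le> j" "j < (k + 1) * 2 ^ n" for j
      using * that by (simp add: val_def)
    ultimately show "stage M y p d [] 0 s' \<and>
      (\<forall>j. 2 ^ n \<le> j \<longrightarrow> j < (k + 1) * 2 ^ n \<longrightarrow> snd s' 6 (int j) = 0)" by blast
  qed simp
qed

lemma pair_index_less: "y < n \<Longrightarrow> u < n \<Longrightarrow> u * n + y \<le> n * n"
  using code_image_less[of "{(u, y)}"] by auto

text \<open>Row \<open>i\<close> is only read and row \<open>Suc i\<close> collects maxima from
  zero; several pairs can have the same union, so one cell may be improved many times. The rows
  above stay zero for the next stages.\<close>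

lemma ok_stage_prog:
  assumes s: "bnd B s" "1 \<le> B" and T: "tables s" and M: "stores M s"
    and regs: "fst s 7 = int y" "fst s 9 = int d" "fst s 11 = int i" "fst s 18 = int u"
    and y: "y < n" and d: "d \<le> n" and u: "u < n" and B3: "3 ^ n < (2::nat) ^ B"
    and bd: "\<And>us X a. deriv M y p d us X a \<Longrightarrow> a + 1 < 2 ^ B"
    and stg: "stage M y p d us i s" and i: "i < k"
    and zero: "\<And>j. Suc i * 2 ^ n \<le> j \<Longrightarrow> j < (k + 1) * 2 ^ n \<Longrightarrow> snd s 6 (int j) = 0"
  shows "ok B stage_prog s (3 ^ n + 1) (\<lambda>s'. stage M y p d (us @ [u]) (Suc i) s' \<and>
    (\<forall>j. Suc (Suc i) * 2 ^ n \<le> j \<longrightarrow> j < (k + 1) * 2 ^ n \<longrightarrow> snd s' 6 (int j) = 0))"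
proof -
  define Z where "Z c = set_decode (ones c)" for c
  define Y where "Y c = set_decode (twos c)" for c
  define adr where "adr X = int (Suc i * 2 ^ n + set_encode X)" for X
  \<comment> \<open>Loop invariant for one cell: its content is derivable or 0, and it dominates the
    candidates of all pairs coded below \<open>c\<close>.\<close>
  define good where "good X x c \<longleftrightarrow> (x = 0 \<or> (\<exists>a. x = int a + 1 \<and> deriv M y p d (us @ [u]) X a)) \<and>
    (\<forall>c'<c. \<forall>a. X = Y c' \<union> Z c' \<longrightarrow> u \<in> Z c' \<longrightarrow> deriv M y p d us (Y c') a \<longrightarrow>
       int (a + M d (Z c') + 2 ^ (u * n + y)) + 1 \<le> x)" for X x c
  define Inv where "Inv c s' \<longleftrightarrow> (\<forall>j. j < Suc i * 2 ^ n \<or> Suc (Suc i) * 2 ^ n \<le> j \<longrightarrow>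
      snd s' 6 (int j) = snd s 6 (int j)) \<and>
    (\<forall>X. X \<subseteq> {..<n} \<longrightarrow> good X (snd s' 6 (adr X)) c)" for c and s' :: state
  have B3': "int (3 ^ n) < 2 ^ B" using B3 by (metis of_nat_less_iff of_nat_power of_nat_numeral)
  have adr_inj: "adr X \<noteq> adr X'" if "X \<subseteq> {..<n}" "X' \<subseteq> {..<n}" "X \<noteq> X'" for X X'
    using that set_encode_eq[of X X'] finite_subset[OF that(1)] finite_subset[OF that(2)]
    by (simp add: adr_def)
  have adr_range: "Suc i * 2 ^ n \<le> Suc i * 2 ^ n + set_encode X"
    "Suc i * 2 ^ n + set_encode X < Suc (Suc i) * 2 ^ n" if "X \<subseteq> {..<n}" for X
    using set_encode_sub[OF that] by simp_all
  have "ok B stage_prog s (3 ^ n + 1) (\<lambda>s'. Inv (3 ^ n) s' \<and> fst s' 10 = int (3 ^ n))"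
    unfolding stage_prog_def
  proof (rule ok_For[where W = 1, OF s order_refl B3'], goal_cases)
    case 3
    have "snd s 6 (adr X) = 0" if "X \<subseteq> {..<n}" for X
    proof -
      have "Suc (Suc i) * 2 ^ n \<le> (k + 1) * 2 ^ n" using i by (intro mult_le_mono1) simp
      then show ?thesis using zero[of "Suc i * 2 ^ n + set_encode X"] adr_range[OF that]
        unfolding adr_def by linarith
    qed
    then show ?case by (simp add: Inv_def good_def)
  next
    case (4 c s')
    have fr: "\<And>r. r \<noteq> 10 \<Longrightarrow> fst s' r = fst s r" "\<And>a. a \<noteq> 6 \<Longrightarrow> snd s' a = snd s a"
      using 4(4) by (auto simp: frame_def)
    have T': "tables s'" using T fr by (simp add: tables_def)
    have Yn: "Y c \<subseteq> {..<n}" and Zn: "Z c \<subseteq> {..<n}"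
      using twos_less ones_less 4(1) set_decode_less_subset by (auto simp: Y_def Z_def)
    have YZ: "Y c \<inter> Z c = {}" using ones_twos_disjoint[of c] by (auto simp: Y_def Z_def)
    have "set_encode (Y c \<union> Z c) = twos c + ones c"
      using set_encode_Un_disjoint[OF _ _ YZ] by (simp add: Y_def Z_def)
    moreover have A34: "snd s' 4 (fst s' 10) = int (twos c)" "snd s' 3 (fst s' 10) = int (ones c)"
      using T' 4(1,3) by (simp_all add: tables_def)
    ultimately have ev_addr: "aval cand_addr s' = adr (Y c \<union> Z c)"
      using T' fr regs by (simp add: cand_addr_def slot_def adr_def tables_def algebra_simps)
    define b where "b = snd s 6 (int (i * 2 ^ n + set_encode (Y c)))"
    have "i * 2 ^ n + set_encode (Y c) < Suc i * 2 ^ n" using set_encode_sub[OF Yn] by simp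
    then have "snd s' 6 (int (i * 2 ^ n + set_encode (Y c))) = b"
      using 4(5) unfolding Inv_def b_def by blast
    then have ev_b: "aval (Arr 6 (slot (Reg 11) (Arr 4 (Reg 10)))) s' = b"
      using A34 T' fr regs by (simp add: slot_def tables_def Y_def)
    have "snd s' 5 (int (d * 2 ^ n + set_encode (Z c))) = int (M d (Z c))"
      using M d Zn fr by (simp add: stores_def)
    then have ev_M: "aval (Arr 5 (slot (Reg 9) (Arr 3 (Reg 10)))) s' = int (M d (Z c))"
      using A34 T' fr regs by (simp add: slot_def tables_def Z_def)
    have "snd s' 2 (int (u * n + y)) = 2 ^ (u * n + y)"
      using T' pair_index_less[OF y u] unfolding tables_def by blast
    then have ev_p: "aval (Arr 2 (Add (Mul (Reg 18) (Reg 2)) (Reg 7))) s' = 2 ^ (u * n + y)"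
      using T' fr regs by (simp add: tables_def)
    have ev_cand: "aval cand s' = b + int (M d (Z c)) + 2 ^ (u * n + y)"
      unfolding cand_def using ev_b ev_M ev_p by (simp only: aval.simps(4))
    have ev_bit: "bval (bit_test (Arr 3 (Reg 10)) (Reg 18)) s' \<longleftrightarrow> u \<in> Z c"
      using bval_bit_test[of "Arr 3 (Reg 10)" s' "ones c" "Reg 18" u] A34 fr regs tables_pow[OF T', of u] u
      by (simp add: Z_def)
    have b: "b = 0 \<or> (\<exists>a. b = int a + 1 \<and> deriv M y p d us (Y c) a)"
      "\<And>a. deriv M y p d us (Y c) a \<Longrightarrow> int a + 1 \<le> b"
      using stg Yn unfolding stage_def b_def Let_def by blast+
    define x where "x = snd s' 6 (adr (Y c \<union> Z c))"
    have good: "good X (snd s' 6 (adr X)) c" if "X \<subseteq> {..<n}" for X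
      using 4(5) that by (simp add: Inv_def)
    have good_other: "good X z (Suc c)" if "good X z c" "X \<noteq> Y c \<union> Z c" for X z
      using that unfolding good_def less_Suc_eq by blast
    have YZn: "Y c \<union> Z c \<subseteq> {..<n}" using Yn Zn by simp
    have ev_x: "aval (Arr 6 cand_addr) s' = x" using ev_addr by (simp add: x_def)
    let ?b = "Conj (bit_test (Arr 3 (Reg 10)) (Reg 18))
      (Conj (Less (Const 0) (Arr 6 (slot (Reg 11) (Arr 4 (Reg 10))))) (Less (Arr 6 cand_addr) cand))"
    have ev_cond: "bval ?b s' \<longleftrightarrow> u \<in> Z c \<and> 0 < b \<and> x < b + int (M d (Z c)) + 2 ^ (u * n + y)"
      unfolding bval.simps ev_bit ev_x ev_cand ev_b by simp
    show ?case
    proof (rule ok_straight[OF 4(2) s(2) order_refl], unfold wp.simps, intro conjI impI)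
      assume "bval ?b s'"
      then have c: "u \<in> Z c" "0 < b" "x < b + int (M d (Z c)) + 2 ^ (u * n + y)"
        using ev_cond by blast+
      then obtain a where a: "b = int a + 1" "deriv M y p d us (Y c) a" using b(1) by auto
      let ?v = "a + M d (Z c) + 2 ^ (u * n + y)"
      have v: "aval cand s' = int ?v + 1" using ev_cand a(1) by simp
      have dv: "deriv M y p d (us @ [u]) (Y c \<union> Z c) ?v"
        by (rule deriv.step[OF a(2) Zn YZ c(1)])
      have "int (?v + 1) < int (2 ^ B)" using bd[OF dv] by (simp only: of_nat_less_iff)
      then show "\<bar>aval cand s'\<bar> < 2 ^ B" using v by simp
      have "good (Y c \<union> Z c) (int ?v + 1) (Suc c)"
        unfolding good_def
      proof (intro conjI allI impI)
        show "int ?v + 1 = 0 \<or> (\<exists>a. int ?v + 1 = int a + 1 \<and> deriv M y p d (us @ [u]) (Y c \<union> Z c) a)"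
          using dv by blast
        fix c' a' assume c': "c' < Suc c" "Y c \<union> Z c = Y c' \<union> Z c'" "u \<in> Z c'"
          "deriv M y p d us (Y c') a'"
        show "int (a' + M d (Z c') + 2 ^ (u * n + y)) + 1 \<le> int ?v + 1"
        proof (cases "c' = c")
          case True
          then show ?thesis using b(2)[of a'] c'(4) a(1) by simp
        next
          case False
          then have "int (a' + M d (Z c') + 2 ^ (u * n + y)) + 1 \<le> x"
            using good[OF YZn] c' unfolding good_def x_def by (meson less_SucE)
          then show ?thesis using c(3) a(1) by simp
        qed
      qed
      then have "good X (((snd s' 6)(adr (Y c \<union> Z c) := int ?v + 1)) (adr X)) (Suc c)"
        if "X \<subseteq> {..<n}" for X
        using good_other[OF good[OF that]] adr_inj[OF that YZn] by (cases "X = Y c \<union> Z c") auto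
      moreover have "((snd s' 6)(adr (Y c \<union> Z c) := int ?v + 1)) (int j) = snd s 6 (int j)"
        if "j < Suc i * 2 ^ n \<or> Suc (Suc i) * 2 ^ n \<le> j" for j
      proof -
        have "int j \<noteq> adr (Y c \<union> Z c)"
          using that adr_range[OF YZn] unfolding adr_def of_nat_eq_iff by linarith
        moreover have "snd s' 6 (int j) = snd s 6 (int j)" using 4(5) that unfolding Inv_def by blast
        ultimately show ?thesis by simp
      qed
      ultimately show "Inv (Suc c) (set_reg 10 (int (Suc c))
          (fst s', (snd s')(6 := (snd s' 6)(aval cand_addr s' := aval cand s'))))"
        unfolding Inv_def v ev_addr by simp
    next
      assume "\<not> bval ?b s'"
      then have c: "\<not> (u \<in> Z c \<and> 0 < b \<and> x < b + int (M d (Z c)) + 2 ^ (u * n + y))"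
        using ev_cond by blast
      have "int (a' + M d (Z c) + 2 ^ (u * n + y)) + 1 \<le> x"
        if "u \<in> Z c" "deriv M y p d us (Y c) a'" for a'
        using c b(2)[OF that(2)] that(1) by simp
      then have "good (Y c \<union> Z c) x (Suc c)"
        using good[OF YZn] unfolding good_def x_def[symmetric] less_Suc_eq by blast
      then have "good X (snd s' 6 (adr X)) (Suc c)" if "X \<subseteq> {..<n}" for X
        using good_other[OF good[OF that]] unfolding x_def by (cases "X = Y c \<union> Z c") auto
      then show "Inv (Suc c) (set_reg 10 (int (Suc c)) s')"
        using 4(5) unfolding Inv_def by simp
    qed
  next
    case (5 c s')
    then show ?case using T by (simp add: frame_def tables_def)
  qed simp_all
  then show ?thesis
  proof (rule ok_conseq)
    fix s' :: state assume *: "Inv (3 ^ n) s' \<and> fst s' 10 = int (3 ^ n)"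
    have "stage M y p d (us @ [u]) (Suc i) s'"
      unfolding stage_def Let_def adr_def[symmetric]
    proof (intro allI impI conjI)
      fix X assume X: "X \<subseteq> {..<n}"
      then have g: "good X (snd s' 6 (adr X)) (3 ^ n)" using * by (simp add: Inv_def)
      then show "snd s' 6 (adr X) = 0 \<or>
          (\<exists>a. snd s' 6 (adr X) = int a + 1 \<and> deriv M y p d (us @ [u]) X a)"
        by (simp add: good_def)
      fix v assume "deriv M y p d (us @ [u]) X v"
      then obtain Y0 Z0 a where D: "X = Y0 \<union> Z0" "v = a + M d Z0 + 2 ^ (u * n + y)"
        "deriv M y p d us Y0 a" "Z0 \<subseteq> {..<n}" "Y0 \<inter> Z0 = {}" "u \<in> Z0"
        by (cases rule: deriv.cases) auto
      have "Y0 \<subseteq> {..<n}" using deriv_sub[OF D(3)] by simp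
      \<comment> \<open>The pair of parts in the last step of the derivation was visited by the
        loop, under the number \<open>c\<close>.\<close>
      with D(4,5) obtain c where "c < 3 ^ n" "ones c = set_encode Z0" "twos c = set_encode Y0"
        using ones_twos_surj[of "set_encode Z0" n "set_encode Y0"] set_encode_sub by blast
      then have "c < 3 ^ n" "Z c = Z0" "Y c = Y0"
        using set_encode_sub \<open>Y0 \<subseteq> {..<n}\<close> D(4) by (auto simp: Z_def Y_def)
      then show "int v + 1 \<le> snd s' 6 (adr X)" using g D unfolding good_def by blast
    qed
    moreover have "snd s' 6 (int j) = 0" if "Suc (Suc i) * 2 ^ n \<le> j" "j < (k + 1) * 2 ^ n" for j
      using * that zero[of j] unfolding Inv_def by simp
    ultimately show "stage M y p d (us @ [u]) (Suc i) s' \<and>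
      (\<forall>j. Suc (Suc i) * 2 ^ n \<le> j \<longrightarrow> j < (k + 1) * 2 ^ n \<longrightarrow> snd s' 6 (int j) = 0)" by blast
  qed simp
qed

lemma stage_cong: "snd s' 6 = snd s 6 \<Longrightarrow> stage M y p d us i s' = stage M y p d us i s"
  by (simp add: stage_def)

text \<open>After \<open>i\<close> stages row \<open>i\<close> belongs to the prefix
  \<open>take i us\<close>. That the rows above are still zero is part of the invariant, since each
  stage starts from a cleared row.\<close>

lemma ok_stages_prog:
  assumes s: "bnd B s" "1 \<le> B" and T: "tables s" and M: "stores M s"
    and regs: "fst s 7 = int y" "fst s 9 = int d" "fst s 15 = int (length us)" "fst s 12 = int pos"
    and input: "\<And>i. i < length us \<Longrightarrow> snd s 0 (int (pos + (i + 1))) = int (us ! i)"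
    and y: "y < n" and d: "d \<le> n" and us: "set us \<subseteq> {..<n}" and B3: "3 ^ n < (2::nat) ^ B"
    and bd: "\<And>us X a. deriv M y p d us X a \<Longrightarrow> a + 1 < 2 ^ B"
    and stg: "stage M y p d [] 0 s"
    and zero: "\<And>j. 2 ^ n \<le> j \<Longrightarrow> j < (length us + 1) * 2 ^ n \<Longrightarrow> snd s 6 (int j) = 0"
  shows "ok B stages_prog s ((length us + 1) * (3 ^ n + 1)) (stage M y p d us (length us))"
proof -
  let ?k = "length us"
  let ?Inv = "\<lambda>i (s' :: state). stage M y p d (take i us) i s' \<and>
    (\<forall>j. Suc i * 2 ^ n \<le> j \<longrightarrow> j < (?k + 1) * 2 ^ n \<longrightarrow> snd s' 6 (int j) = 0)"
  have k: "int ?k < 2 ^ B" using s(1) regs(3) unfolding bnd_def by (metis abs_of_nat)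
  have "ok B stages_prog s ((?k + 1) * (3 ^ n + 1)) (\<lambda>s'. ?Inv ?k s' \<and> fst s' 11 = int ?k)"
    unfolding stages_prog_def
  proof (rule ok_For[where W = "3 ^ n + 1" and Inv = ?Inv, OF s _ k], goal_cases)
    case 4
    show ?case using stg zero stage_cong[of "set_reg 11 0 s" s] by simp
  next
    case (5 i s')
    have fr: "\<And>r. r \<notin> {10, 11, 18} \<Longrightarrow> fst s' r = fst s r" "\<And>a. a \<noteq> 6 \<Longrightarrow> snd s' a = snd s a"
      using 5(4) by (auto simp: frame_def)
    have ui: "us ! i < n" using us 5(1) by (meson lessThan_iff nth_mem subsetD)
    have "snd s' 0 (int (pos + (i + 1))) = int (us ! i)" using input[OF 5(1)] fr by simp
    then have ev: "aval (Arr 0 (Add (Reg 12) (Add (Reg 11) (Const 1)))) s' = int (us ! i)"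
      using fr regs 5(3) by (simp add: algebra_simps)
    let ?s1 = "set_reg 18 (int (us ! i)) s'"
    have "\<bar>int (us ! i)\<bar> < 2 ^ B"
      using 5(2) \<open>snd s' 0 (int (pos + (i + 1))) = int (us ! i)\<close> unfolding bnd_def by metis
    then have "ok B (Assign 18 (Arr 0 (Add (Reg 12) (Add (Reg 11) (Const 1))))) s' (3 ^ n + 1)
        (\<lambda>s''. s'' = ?s1)"
      using ev by (intro ok_straight[OF 5(2) s(2)]) (simp_all del: aval.simps)
    then show ?case
    proof (rule ok_Seq)
      fix s1 assume b1: "bnd B s1" and "s1 = ?s1"
      then have s1: "fst s1 7 = int y" "fst s1 9 = int d" "fst s1 11 = int i" "fst s1 18 = int (us ! i)"
        "snd s1 6 = snd s' 6" "tables s1" "stores M s1"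
        using fr regs 5(3) T M by (simp_all add: tables_def stores_def)
      have "ok B stage_prog s1 (3 ^ n + 1) (\<lambda>s''. stage M y p d (take i us @ [us ! i]) (Suc i) s'' \<and>
        (\<forall>j. Suc (Suc i) * 2 ^ n \<le> j \<longrightarrow> j < (?k + 1) * 2 ^ n \<longrightarrow> snd s'' 6 (int j) = 0))"
      proof (rule ok_stage_prog[OF b1 s(2) s1(6,7,1-4) y d ui B3 bd _ 5(1)])
        show "stage M y p d (take i us) i s1" using 5(5) s1(5) stage_cong[of s1 s'] by simp
        show "snd s1 6 (int j) = 0" if "Suc i * 2 ^ n \<le> j" "j < (?k + 1) * 2 ^ n" for j
          using 5(5) that unfolding s1(5) by blast
      qed
      then show "ok B stage_prog s1 (3 ^ n + 1) (\<lambda>s''. ?Inv (Suc i) (set_reg 11 (int (Suc i)) s''))"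
        by (rule ok_conseq)
          (use 5(1) in \<open>simp_all add: take_Suc_conv_app_nth stage_def\<close>)
    qed
  next
    case (6 i s')
    then show ?case using regs by (simp add: frame_def)
  qed simp_all
  then show ?thesis by (rule ok_conseq) simp_all
qed

lemma ok_max_prog:
  assumes s: "bnd B s" "1 \<le> B" and T: "tables s" and M: "stores M s"
    and regs: "fst s 9 = int d" "fst s 15 = int (length us)"
    and d: "d \<le> n" and stg: "stage M y p d us (length us) s"
  shows "ok B max_prog s (2 ^ n + 1) (\<lambda>s'. \<exists>M'. stores M' s' \<and> relaxed M y us p d M')"
proof -
  let ?k = "length us"
  define U where "U x = snd s 6 (int (?k * 2 ^ n + x)) - 1" for x
  define Inv where "Inv x s' \<longleftrightarrow>
    (\<forall>x'<x. snd s' 5 (int (d * 2 ^ n + x')) = max (snd s 5 (int (d * 2 ^ n + x'))) (U x')) \<and>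
    (\<forall>j. j < d * 2 ^ n \<or> d * 2 ^ n + x \<le> j \<longrightarrow> snd s' 5 (int j) = snd s 5 (int j))" for x and s' :: state
  have N: "int (2 ^ n) < 2 ^ B"
    using s(1) T unfolding bnd_def tables_def by (metis abs_of_nat of_nat_numeral of_nat_power)
  have "ok B max_prog s (2 ^ n + 1) (\<lambda>s'. Inv (2 ^ n) s' \<and> fst s' 10 = int (2 ^ n))"
    unfolding max_prog_def
  proof (rule ok_For[where W = 1 and Inv = Inv, OF s order_refl N], goal_cases)
    case (4 x s')
    have fr: "\<And>r. r \<noteq> 10 \<Longrightarrow> fst s' r = fst s r" "\<And>a. a \<noteq> 5 \<Longrightarrow> snd s' a = snd s a"
      using 4(4) by (auto simp: frame_def)
    note inv = 4(5)[unfolded Inv_def]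
    have r16: "fst s' 16 = 2 ^ n" using fr T by (simp add: tables_def)
    have ev_addr: "aval (slot (Reg 9) (Reg 10)) s' = int (d * 2 ^ n + x)"
      using fr regs r16 4(3) by (simp add: slot_def)
    have "aval (slot (Reg 15) (Reg 10)) s' = int (?k * 2 ^ n + x)"
      using fr regs r16 4(3) by (simp add: slot_def)
    then have ev_U: "aval (Sub (Arr 6 (slot (Reg 15) (Reg 10))) (Const 1)) s' = U x"
      using fr by (simp add: U_def)
    define m where "m = snd s 5 (int (d * 2 ^ n + x))"
    have "snd s' 5 (int (d * 2 ^ n + x)) = m" using conjunct2[OF inv] unfolding m_def by (meson order_refl)
    then have ev_M: "aval (Arr 5 (slot (Reg 9) (Reg 10))) s' = m"
      using ev_addr by simp
    have "m = int (M d (set_decode x))"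
      using M d set_decode_less_subset[OF 4(1)] unfolding stores_def m_def
      by (metis set_decode_inverse)
    \<comment> \<open>Table entries are natural numbers, so \<open>m < U x\<close> rules out the
      value -1 and makes the stored number nonnegative.\<close>
    then have m: "0 \<le> m" by simp
    have U: "U x < 2 ^ B" using s(1) unfolding bnd_def U_def by (smt (verit))
    show ?case
    proof (rule ok_straight[OF 4(2) s(2) order_refl], unfold wp.simps bval.simps ev_U ev_M ev_addr,
        intro conjI impI)
      assume "m < U x"
      with m U show "\<bar>U x\<bar> < 2 ^ B" by simp
      show "Inv (Suc x) (set_reg 10 (int (Suc x))
        (fst s', (snd s')(5 := (snd s' 5)(int (d * 2 ^ n + x) := U x))))"
        unfolding Inv_def
      proof (intro conjI allI impI)
        fix x' assume "x' < Suc x"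
        then consider "x' = x" | "x' < x" by linarith
        then show "snd (set_reg 10 (int (Suc x))
            (fst s', (snd s')(5 := (snd s' 5)(int (d * 2 ^ n + x) := U x)))) 5 (int (d * 2 ^ n + x'))
          = max (snd s 5 (int (d * 2 ^ n + x'))) (U x')"
          using inv \<open>m < U x\<close> unfolding m_def by cases simp_all
      next
        fix j assume "j < d * 2 ^ n \<or> d * 2 ^ n + Suc x \<le> j"
        then have "j < d * 2 ^ n \<or> d * 2 ^ n + x \<le> j" "j \<noteq> d * 2 ^ n + x" by linarith+
        then have "snd s' 5 (int j) = snd s 5 (int j)" "int j \<noteq> int (d * 2 ^ n + x)"
          using inv unfolding of_nat_eq_iff by blast+
        then show "snd (set_reg 10 (int (Suc x))
            (fst s', (snd s')(5 := (snd s' 5)(int (d * 2 ^ n + x) := U x)))) 5 (int j)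
          = snd s 5 (int j)" by simp
      qed
    next
      assume "\<not> m < U x"
      then have "max m (U x) = m" by simp
      then show "Inv (Suc x) (set_reg 10 (int (Suc x)) s')"
        using inv \<open>snd s' 5 (int (d * 2 ^ n + x)) = m\<close> unfolding m_def less_Suc_eq Inv_def
        by (auto simp del: of_nat_add of_nat_mult)
    qed
  next
    case (5 x s')
    then show ?case using T by (simp add: frame_def tables_def)
  qed (simp_all add: Inv_def)
  then show ?thesis
  proof (rule ok_conseq)
    fix s' :: state assume *: "Inv (2 ^ n) s' \<and> fst s' 10 = int (2 ^ n)"
    note inv = conjunct1[OF *, unfolded Inv_def]
    define M' where "M' e X = (if e = d then nat (max (int (M d X)) (U (set_encode X))) else M e X)"
      for e X
    have "stores M' s'"
      unfolding stores_def
    proof (intro allI impI)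
      fix e X assume e: "e \<le> n" and X: "X \<subseteq> {..<n}"
      note enc = set_encode_sub[OF X]
      show "snd s' 5 (int (e * 2 ^ n + set_encode X)) = int (M' e X)"
      proof (cases "e = d")
        case True
        have "snd s 5 (int (d * 2 ^ n + set_encode X)) = int (M d X)"
          using M d X unfolding stores_def by blast
        then show ?thesis using inv enc True by (simp add: M'_def le_max_iff_disj)
      next
        case False
        have "e * 2 ^ n + set_encode X < d * 2 ^ n \<or> d * 2 ^ n + 2 ^ n \<le> e * 2 ^ n + set_encode X"
        proof (cases "e < d")
          case True
          then have "Suc e * 2 ^ n \<le> d * 2 ^ n" by (intro mult_le_mono1) simp
          then show ?thesis using enc by simp
        next
          case ge: False
          then have "Suc d * 2 ^ n \<le> e * 2 ^ n" using False by (intro mult_le_mono1) simp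
          then show ?thesis by simp
        qed
        then have "snd s' 5 (int (e * 2 ^ n + set_encode X)) = snd s 5 (int (e * 2 ^ n + set_encode X))"
          using inv by blast
        also have "\<dots> = int (M e X)" using M e X unfolding stores_def by blast
        finally show ?thesis using False by (simp add: M'_def)
      qed
    qed
    moreover have "relaxed M y us p d M'"
      unfolding relaxed_def
    proof (intro allI impI conjI)
      fix e X assume "e \<le> n" and X: "X \<subseteq> {..<n}"
      show "M' e X = M e X" if "e \<noteq> d" using that by (simp add: M'_def)
      have U0: "U (set_encode X) = -1 \<or> (\<exists>a. U (set_encode X) = int a \<and> deriv M y p d us X a)"
        and U1: "deriv M y p d us X a \<Longrightarrow> int a \<le> U (set_encode X)" for a
        using stg[unfolded stage_def Let_def, rule_format, OF X] unfolding U_def by auto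
      show "M d X \<le> M' d X" by (simp add: M'_def)
      show "M' d X = M d X \<or> deriv M y p d us X (M' d X)"
        using U0 by (auto simp: M'_def max_def)
      show "a \<le> M' d X" if "deriv M y p d us X a" for a
        using U1[OF that] by (simp add: M'_def)
    qed
    ultimately show "\<exists>M'. stores M' s' \<and> relaxed M y us p d M'" by blast
  qed simp
qed

text \<open>All three phases are charged one common count, as \<open>ok_Seq\<close> demands. The
  stages determine its form: \<open>length us\<close> of them, each a loop of length
  \<open>3 ^ n\<close>.\<close>

lemma ok_relax_prog:
  assumes s: "bnd B s" "1 \<le> B" and T: "tables s" and M: "stores M s"
    and regs: "fst s 7 = int y" "fst s 9 = int d" "fst s 15 = int (length us)" "fst s 12 = int pos"
      "fst s 17 = int (2 ^ (n * n) * p)"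
    and input: "\<And>i. i < length us \<Longrightarrow> snd s 0 (int (pos + (i + 1))) = int (us ! i)"
    and y: "y < n" and d: "d \<le> n" and us: "set us \<subseteq> {..<n}" and B3: "3 ^ n < (2::nat) ^ B"
    and k: "(length us + 1) * 2 ^ n < 2 ^ B"
    and bd: "\<And>us X a. deriv M y p d us X a \<Longrightarrow> a + 1 < 2 ^ B"
  shows "ok B relax_prog s (2 * (length us + 1) * 3 ^ n)
    (\<lambda>s'. \<exists>M'. stores M' s' \<and> relaxed M y us p d M')"
proof -
  let ?W = "2 * (length us + 1) * 3 ^ n"
  have "(2::nat) ^ n \<le> 3 ^ n" by (rule power_mono) simp_all
  then have "(length us + 1) * 2 ^ n \<le> (length us + 1) * 3 ^ n" by (rule mult_le_mono2)
  moreover have "1 \<le> (length us + 1) * (3 ^ n :: nat)" by (simp add: Suc_le_eq)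
  moreover have "(3::nat) ^ n \<le> (length us + 1) * 3 ^ n" by simp
  ultimately have W1: "(length us + 1) * 2 ^ n + 1 \<le> ?W" and W3: "2 ^ n + 1 \<le> ?W"
    using \<open>2 ^ n \<le> 3 ^ n\<close> by linarith+
  have "3 ^ n + 1 \<le> 2 * (3::nat) ^ n" by simp
  then have "(length us + 1) * (3 ^ n + 1) \<le> (length us + 1) * (2 * 3 ^ n)" by (rule mult_le_mono2)
  then have W2: "(length us + 1) * (3 ^ n + 1) \<le> ?W" by (simp only: mult_ac)
  show ?thesis
    unfolding relax_prog_def
  proof (rule ok_Seq[OF ok_conseq[OF ok_init_prog[OF s T M regs(1,2,3,5) y d k bd] W1]])
    fix s1
    assume 1: "bnd B s1" "frame init_prog s s1" "stage M y p d [] 0 s1 \<and>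
      (\<forall>j. 2 ^ n \<le> j \<longrightarrow> j < (length us + 1) * 2 ^ n \<longrightarrow> snd s1 6 (int j) = 0)"
    have fr: "\<And>r. r \<noteq> 10 \<Longrightarrow> fst s1 r = fst s r" "\<And>a. a \<noteq> 6 \<Longrightarrow> snd s1 a = snd s a"
      using 1(2) by (auto simp: frame_def)
    have T1: "tables s1" and M1: "stores M s1" using T M fr by (simp_all add: tables_def stores_def)
    have "ok B stages_prog s1 ((length us + 1) * (3 ^ n + 1)) (stage M y p d us (length us))"
      by (rule ok_stages_prog[OF 1(1) s(2) T1 M1 _ _ _ _ _ y d us B3 bd])
        (use fr regs input 1(3) in simp_all)
    then show "ok B (Seq stages_prog max_prog) s1 ?W (\<lambda>s'. \<exists>M'. stores M' s' \<and> relaxed M y us p d M')"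
    proof (rule ok_Seq[OF ok_conseq[OF _ W2]])
      fix s2
      assume 2: "bnd B s2" "frame stages_prog s1 s2" "stage M y p d us (length us) s2"
      have fr2: "\<And>r. r \<notin> {10, 11, 18} \<Longrightarrow> fst s2 r = fst s1 r" "\<And>a. a \<noteq> 6 \<Longrightarrow> snd s2 a = snd s1 a"
        using 2(2) by (auto simp: frame_def)
      have T2: "tables s2" and M2: "stores M s2" using T1 M1 fr2 by (simp_all add: tables_def stores_def)
      have "ok B max_prog s2 (2 ^ n + 1) (\<lambda>s'. \<exists>M'. stores M' s' \<and> relaxed M y us p d M')"
        by (rule ok_max_prog[OF 2(1) s(2) T2 M2 _ _ d 2(3)]) (use fr fr2 regs in simp_all)
      then show "ok B max_prog s2 ?W (\<lambda>s'. \<exists>M'. stores M' s' \<and> relaxed M y us p d M')"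
        by (rule ok_conseq[OF _ W3])
    qed
  qed
qed

end

section \<open>Reading the input\<close>

text \<open>Index of the integer that counts the entries of \<open>v\<close>; the 1 skips the number
  of nodes at the front. In \<open>entry_pos\<close> the further 1 skips that count.\<close>

definition node_pos :: "entry list list \<Rightarrow> nat \<Rightarrow> nat" where
  "node_pos ess v = 1 + length (concat (map node_code (take v ess)))"

definition entry_pos :: "entry list list \<Rightarrow> nat \<Rightarrow> nat \<Rightarrow> nat" where
  "entry_pos ess v j = node_pos ess v + 1 + length (concat (map entry_code (take j (ess ! v))))"

lemma concat_map_split_nth:
  "i < length xs \<Longrightarrow>
    concat (map g xs) = concat (map g (take i xs)) @ g (xs ! i) @ concat (map g (drop (Suc i) xs))"
  by (subst id_take_nth_drop[of i xs]) simp_all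

lemma node_pos_0: "node_pos ess 0 = 1"
  by (simp add: node_pos_def)

lemma entry_pos_0: "entry_pos ess v 0 = node_pos ess v + 1"
  by (simp add: entry_pos_def)

lemma node_pos_Suc: "v < length ess \<Longrightarrow> node_pos ess (Suc v) = entry_pos ess v (length (ess ! v))"
  by (simp add: node_pos_def entry_pos_def take_Suc_conv_app_nth node_code_def)

text \<open>The 3 stands for the element count and the two integers of the score.\<close>

lemma entry_pos_Suc:
  assumes "j < length (ess ! v)" "ess ! v ! j = (us, p, q)"
  shows "entry_pos ess v (Suc j) = entry_pos ess v j + (length us + 3)"
  using assms by (simp add: entry_pos_def take_Suc_conv_app_nth entry_code_def)

lemma input_code_node:
  assumes "v < length ess"
  obtains pre post where "input_code ess = pre @ node_code (ess ! v) @ post" "length pre = node_pos ess v"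
  using concat_map_split_nth[OF assms, of node_code] that
  unfolding input_code_def node_pos_def by (metis One_nat_def append_Cons length_Cons plus_1_eq_Suc)

lemma input_code_entry:
  assumes "v < length ess" "j < length (ess ! v)"
  obtains pre post where "input_code ess = pre @ entry_code (ess ! v ! j) @ post"
    "length pre = entry_pos ess v j"
proof -
  obtain pre post where 1: "input_code ess = pre @ node_code (ess ! v) @ post"
    "length pre = node_pos ess v" using input_code_node[OF assms(1)] .
  let ?pre = "pre @ int (length (ess ! v)) # concat (map entry_code (take j (ess ! v)))"
  have "input_code ess = ?pre @ entry_code (ess ! v ! j) @
      (concat (map entry_code (drop (Suc j) (ess ! v))) @ post)"
    unfolding 1(1) node_code_def concat_map_split_nth[OF assms(2)] by simp
  moreover have "length ?pre = entry_pos ess v j" using 1(2) by (simp add: entry_pos_def)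
  ultimately show ?thesis using that by blast
qed

lemma input_code_node_nth:
  assumes "v < length ess"
  shows "node_pos ess v + length (ess ! v) < length (input_code ess)"
    "input_code ess ! node_pos ess v = int (length (ess ! v))"
proof -
  obtain pre post where 1: "input_code ess = pre @ node_code (ess ! v) @ post"
    "length pre = node_pos ess v" using input_code_node[OF assms] .
  have "length es \<le> length (concat (map entry_code es))" for es
    by (induction es) (auto simp: entry_code_def)
  then show "node_pos ess v + length (ess ! v) < length (input_code ess)"
    unfolding 1 by (simp add: node_code_def 1(2) less_Suc_eq_le trans_le_add1)
  show "input_code ess ! node_pos ess v = int (length (ess ! v))"
    unfolding 1(1) by (simp add: node_code_def nth_append flip: 1(2))
qed

lemma input_code_entry_nth:
  assumes "v < length ess" "j < length (ess ! v)" "ess ! v ! j = (us, p, q)"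
  shows "entry_pos ess v j + (length us + 2) < length (input_code ess)"
    "input_code ess ! entry_pos ess v j = int (length us)"
    "\<And>i. i < length us \<Longrightarrow> input_code ess ! (entry_pos ess v j + (i + 1)) = int (us ! i)"
    "input_code ess ! (entry_pos ess v j + (length us + 1)) = p"
    "input_code ess ! (entry_pos ess v j + (length us + 2)) = q"
proof -
  obtain pre post where 1: "input_code ess = pre @ (int (length us) # map int us @ [p, q]) @ post"
    "length pre = entry_pos ess v j"
    using input_code_entry[OF assms(1,2)] unfolding assms(3) entry_code_def by auto
  show "entry_pos ess v j + (length us + 2) < length (input_code ess)"
    "input_code ess ! entry_pos ess v j = int (length us)"
    "\<And>i. i < length us \<Longrightarrow> input_code ess ! (entry_pos ess v j + (i + 1)) = int (us ! i)"
    "input_code ess ! (entry_pos ess v j + (length us + 1)) = p"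
    "input_code ess ! (entry_pos ess v j + (length us + 2)) = q"
    unfolding 1(1) 1(2)[symmetric] by (simp_all add: nth_append nth_Cons split: nat.split)
qed

lemma length_input_code: "length ess < length (input_code ess)"
proof -
  have "length xs \<le> length (concat (map node_code xs))" for xs
    by (induction xs) (auto simp: node_code_def)
  then show ?thesis by (simp add: input_code_def less_Suc_eq_le)
qed

lemma code_len_length: "2 * length xs \<le> code_len xs"
  by (induction xs) (auto simp: code_len_def int_len_def)

lemma int_len_le_code_len: "x \<in> set xs \<Longrightarrow> int_len x \<le> code_len xs"
  unfolding code_len_def by (intro member_le_sum_list) auto

text \<open>A common denominator that needs no parsing: the product of all positive integers of the
  input, whatever they mean. Every positive denominator is a factor, and bit lengths add up, so it
  is at most \<open>2 ^ code_len\<close>.\<close>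

definition pos_prod :: "int list \<Rightarrow> nat" where
  "pos_prod xs = prod_list (map (\<lambda>x. if 0 < x then nat x else 1) xs)"

lemma pos_prod_simps [simp]:
  "pos_prod [] = 1" "pos_prod (x # xs) = (if 0 < x then nat x else 1) * pos_prod xs"
  "pos_prod (xs @ ys) = pos_prod xs * pos_prod ys"
  by (simp_all add: pos_prod_def)

lemma pos_prod_pos: "0 < pos_prod xs"
  by (induction xs) auto

lemma pos_prod_le: "pos_prod xs \<le> 2 ^ code_len xs"
proof (induction xs)
  case (Cons x xs)
  have "nat \<bar>x\<bar> < 2 ^ int_len x"
    using abs_less_int_len[of x] by (simp add: nat_less_iff)
  then have "(if 0 < x then nat x else 1) \<le> 2 ^ int_len x" by auto
  from mult_le_mono[OF this Cons] show ?case by (simp add: code_len_def power_add)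
qed (simp add: code_len_def)

lemma pos_prod_dvd: "x \<in> set xs \<Longrightarrow> 0 < x \<Longrightarrow> x dvd int (pos_prod xs)"
  by (induction xs) auto

section \<open>The rounds\<close>

definition entry_p :: aexp where
  "entry_p = Arr 0 (Add (Reg 12) (Add (Reg 15) (Const 1)))"

definition entry_q :: aexp where
  "entry_q = Arr 0 (Add (Reg 12) (Add (Reg 15) (Const 2)))"

definition usable :: bexp where
  "usable = Conj (Less (Const 0) entry_q) (Neg (Less entry_p (Const 0)))"

definition sources_prog :: com where
  "sources_prog = For 9 (Add (Reg 2) (Const 1)) relax_prog"

definition entry_prog :: com where
  "entry_prog = Seq (Assign 15 (Arr 0 (Reg 12)))
     (Seq (Cond usable
       (Seq (Assign 17 (Mul (Arr 2 (Mul (Reg 2) (Reg 2))) (Mul entry_p (Div (Reg 3) entry_q))))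
         sources_prog) Skip)
       (Assign 12 (Add (Reg 12) (Add (Reg 15) (Const 3)))))"

definition node_prog :: com where
  "node_prog = Seq (Assign 13 (Arr 0 (Reg 12)))
     (Seq (Assign 12 (Add (Reg 12) (Const 1))) (For 8 (Reg 13) entry_prog))"

definition rounds_prog :: com where
  "rounds_prog = For 6 (Reg 2) (Seq (Assign 12 (Const 1)) (For 7 (Reg 2) node_prog))"

lemma writes_sources_prog [simp]: "wregs sources_prog = {9, 10, 11, 18}" "warrs sources_prog = {5, 6}"
  by (auto simp: sources_prog_def)

lemma writes_entry_prog [simp]:
  "wregs entry_prog = {9, 10, 11, 12, 15, 17, 18}" "warrs entry_prog = {5, 6}"
  by (auto simp: entry_prog_def)

lemma writes_node_prog [simp]:
  "wregs node_prog = {8, 9, 10, 11, 12, 13, 15, 17, 18}" "warrs node_prog = {5, 6}"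
  by (auto simp: node_prog_def)

lemma writes_rounds_prog [simp]:
  "wregs rounds_prog = {6, 7, 8, 9, 10, 11, 12, 13, 15, 17, 18}" "warrs rounds_prog = {5, 6}"
  by (auto simp: rounds_prog_def)

section \<open>Size bounds for an encoded instance\<close>

locale pt_input =
  fixes n :: nat and F :: "nat \<Rightarrow> nat set set" and f :: "nat \<Rightarrow> nat set \<Rightarrow> ereal"
    and ess :: "entry list list"
  assumes inst: "pt_instance n F f" and length_ess: "length ess = n"
    and F_eq: "\<And>v. v < n \<Longrightarrow> F v = (\<lambda>(us, p, q). set us) ` set (ess ! v)"
    and entry: "\<And>v us p q. v < n \<Longrightarrow> (us, p, q) \<in> set (ess ! v) \<Longrightarrow>
      distinct us \<and> 0 \<le> q \<and> f v (set us) = score_val p q"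
begin

definition I :: "int list" where "I = input_code ess"
definition L :: nat where "L = code_len I"
text \<open>\<open>L * L\<close> bits for the arc code, \<open>2 * L\<close> for one scaled score
  (numerator times common denominator), \<open>L\<close> for summing \<open>n\<close> of them, and
  one spare bit for the strict bound on values increased by one.\<close>

definition B :: nat where "B = L * L + 3 * L + 1"
definition den :: nat where "den = pos_prod I"

text \<open>Entries of negative score never help: dropping all parents of the node has score 0.\<close>

definition adm :: "nat \<Rightarrow> nat set set" where
  "adm v = {set us | us p q. (us, p, q) \<in> set (ess ! v) \<and> 0 < q \<and> 0 \<le> p}"

text \<open>The floor merely produces a natural number: on admissible sets the product is already an
  integer, as \<open>den\<close> is a multiple of the denominator.\<close>

definition sc :: "nat \<Rightarrow> nat set \<Rightarrow> nat" where
  "sc v P = nat \<lfloor>real den * real_of_ereal (f v P)\<rfloor>"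

lemma L_ge: "2 * length I \<le> L" "n < length I" "n + 1 \<le> L" "2 \<le> L" "length I + 1 \<le> L"
proof -
  show 1: "2 * length I \<le> L" unfolding L_def by (rule code_len_length)
  show 2: "n < length I" using length_input_code[of ess] by (simp add: I_def length_ess)
  show "n + 1 \<le> L" "2 \<le> L" "length I + 1 \<le> L" using 1 2 by linarith+
qed

lemma L_less: "L < 2 ^ L"
  by (rule less_exp)

lemma B_ge: "1 \<le> B" "2 * L + 1 \<le> B" "L \<le> B"
  by (simp_all add: B_def)

lemma less_B: "x \<le> 2 ^ (2 * L) \<Longrightarrow> x < (2::nat) ^ B"
proof -
  assume x: "x \<le> 2 ^ (2 * L)"
  have "(2::nat) ^ (2 * L) < 2 ^ B" using B_ge by (intro power_strict_increasing) simp_all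
  with x show ?thesis by linarith
qed

lemma L_less_B: "x \<le> L \<Longrightarrow> int x < 2 ^ B"
proof -
  assume "x \<le> L"
  also have "L \<le> 2 ^ L" using L_less by simp
  also have "(2::nat) ^ L \<le> 2 ^ (2 * L)" by (intro power_increasing) simp_all
  finally have "int x < int (2 ^ B)" unfolding of_nat_less_iff by (rule less_B)
  then show ?thesis by simp
qed

lemma pow3_le: "(3::nat) ^ n \<le> 2 ^ (2 * L)"
proof -
  have "(3::nat) ^ n \<le> 4 ^ n" by (rule power_mono) simp_all
  also have "(4::nat) ^ n = 2 ^ (2 * n)" by (simp add: power_mult)
  also have "\<dots> \<le> 2 ^ (2 * L)" using L_ge(3) by (intro power_increasing) simp_all
  finally show ?thesis .
qed

lemma entry_mem:
  assumes "v < n" "(us, p, q) \<in> set (ess ! v)"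
  shows "set us \<subseteq> {..<n}" "p \<in> set I" "q \<in> set I" "length us + 3 \<le> length I"
proof -
  have "set us \<in> F v" using assms F_eq by force
  moreover have "F v \<subseteq> Pow ({..<n} - {v})" using inst assms(1) by (simp add: pt_instance_def)
  ultimately show "set us \<subseteq> {..<n}" by auto
  obtain j where j: "j < length (ess ! v)" "ess ! v ! j = (us, p, q)"
    using assms(2) by (auto simp: in_set_conv_nth)
  have v: "v < length ess" using assms(1) length_ess by simp
  note nth = input_code_entry_nth[OF v j, folded I_def]
  show "length us + 3 \<le> length I" using nth(1) by linarith
  show "p \<in> set I" using nth(1,4) by (metis add_2_eq_Suc' add_Suc_right less_SucI Suc_lessD nth_mem Suc_eq_plus1)
  show "q \<in> set I" using nth(1,5) by (metis nth_mem)
qed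

lemma sc_entry:
  assumes "v < n" "(us, p, q) \<in> set (ess ! v)" "0 < q" "0 \<le> p"
  shows "int (sc v (set us)) = p * (int den div q)" "sc v (set us) \<le> 2 ^ (2 * L)"
proof -
  have "q dvd int den" unfolding den_def using entry_mem(3)[OF assms(1,2)] assms(3) by (rule pos_prod_dvd)
  then have den: "int den = q * (int den div q)" by simp
  have "f v (set us) = ereal (real_of_int p / real_of_int q)"
    using entry[OF assms(1,2)] assms(3) by (simp add: score_val_def)
  then have "real den * real_of_ereal (f v (set us)) = real_of_int (int den) * (real_of_int p / real_of_int q)"
    by simp
  also have "\<dots> = real_of_int (p * (int den div q))"
    by (subst den) (use assms(3) in simp)
  finally have "sc v (set us) = nat (p * (int den div q))" unfolding sc_def by (simp only: floor_of_int)
  moreover have "0 \<le> p * (int den div q)" using assms(3,4) by (simp add: pos_imp_zdiv_nonneg_iff)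
  ultimately show eq: "int (sc v (set us)) = p * (int den div q)" by simp
  have "p < 2 ^ int_len p" using abs_less_int_len[of p] by simp
  also have "(2::int) ^ int_len p \<le> 2 ^ L"
    using int_len_le_code_len[OF entry_mem(2)[OF assms(1,2)]] by (intro power_increasing) (simp_all add: L_def)
  finally have p: "p \<le> 2 ^ L" by simp
  have "int den div q \<le> int den"
    using assms(3) by (metis div_by_1 int_one_le_iff_zero_less of_nat_0_le_iff zdiv_mono2 zero_less_one)
  also have "int den \<le> int (2 ^ L)" unfolding of_nat_le_iff den_def L_def by (rule pos_prod_le)
  finally have "int den div q \<le> 2 ^ L" by simp
  with p have "p * (int den div q) \<le> 2 ^ L * 2 ^ L"
    using assms(3) by (intro mult_mono) (simp_all add: pos_imp_zdiv_nonneg_iff)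
  then have "int (sc v (set us)) \<le> int (2 ^ (2 * L))" unfolding eq by (simp add: mult_2 power_add)
  then show "sc v (set us) \<le> 2 ^ (2 * L)" unfolding of_nat_le_iff .
qed

sublocale dp n adm sc
proof
  fix v assume v: "v < n"
  \<comment> \<open>Normalisation forces the entry listed for the empty set to be
    \<open>0 / q\<close> with \<open>0 < q\<close>, hence the empty set is admissible.\<close>
  have 0: "{} \<in> F v" "f v {} = 0" using inst v by (auto simp: pt_instance_def)
  then obtain us p q where e: "(us, p, q) \<in> set (ess ! v)" "set us = {}"
    using F_eq[OF v] by force
  from entry[OF v e(1)] e(2) 0(2) have "0 < q" "p = 0"
    by (auto simp: score_val_def zero_ereal_def split: if_splits)
  with e show "{} \<in> adm v" unfolding adm_def by force
  show "sc v {} = 0" by (simp add: sc_def 0(2))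
qed

lemma sc_bound: "v < n \<Longrightarrow> P \<in> adm v \<Longrightarrow> sc v P \<le> 2 ^ (2 * L)"
  using sc_entry(2) by (auto simp: adm_def)

lemma pwt_less_B:
  assumes "A \<subseteq> {..<n} \<times> {..<n}" "s \<le> 2 ^ (2 * L)" "\<And>v. v < n \<Longrightarrow> v \<noteq> y \<Longrightarrow> parents A v \<in> adm v"
  shows "pwt y s A + 1 < 2 ^ B"
proof -
  have "pwt y s A < 2 ^ (n * n) * (n * 2 ^ (2 * L) + 1)"
    using assms sc_bound by (intro pwt_bound) auto
  also have "\<dots> \<le> 2 ^ (L * L) * (2 ^ L * 2 ^ (2 * L))"
  proof (rule mult_le_mono)
    have "n * n \<le> L * L" using L_ge(3) by (intro mult_le_mono) simp_all
    then show "(2::nat) ^ (n * n) \<le> 2 ^ (L * L)" by (intro power_increasing) simp_all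
    have "n * 2 ^ (2 * L) + 1 \<le> (n + 1) * 2 ^ (2 * L)" by simp
    also have "\<dots> \<le> 2 ^ L * 2 ^ (2 * L)"
      using order_trans[OF L_ge(3) less_imp_le[OF L_less]] by (rule mult_le_mono1)
    finally show "n * 2 ^ (2 * L) + 1 \<le> 2 ^ L * 2 ^ (2 * L)" .
  qed
  also have "\<dots> = 2 ^ (L * L + 3 * L)" by (simp add: power_add flip: power_add)
  finally have "pwt y s A + 1 \<le> 2 ^ (L * L + 3 * L)" by simp
  also have "\<dots> < 2 ^ B" by (simp add: B_def)
  finally show ?thesis .
qed

text \<open>Soundness turns the derived value into the weight of an actual digraph, whose size is
  bounded a priori.\<close>

lemma deriv_less_B:
  assumes "sound M" "y < n" "d \<le> n" "s \<le> 2 ^ (2 * L)" "deriv M y s d us X a"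
  shows "a + 1 < 2 ^ B"
proof -
  obtain A where A: "pvalid y (set us) d X A" "a = pwt y s A"
    using deriv_sound[OF assms(5,1-3)] by blast
  moreover have "X \<times> X \<subseteq> {..<n} \<times> {..<n}" using deriv_sub[OF assms(5)] by auto
  ultimately show ?thesis using pwt_less_B[of A s y] assms(4) unfolding pvalid_def by blast
qed

definition env :: "state \<Rightarrow> bool" where
  "env s \<longleftrightarrow> tables s \<and> fst s 3 = int den \<and> (\<forall>i<length I. snd s 0 (int i) = I ! i)"

lemma env_frame:
  "env s \<Longrightarrow> frame c s s' \<Longrightarrow> {2, 3, 5, 16} \<inter> wregs c = {} \<Longrightarrow> {0, 2, 3, 4} \<inter> warrs c = {} \<Longrightarrow> env s'"
  by (auto simp: env_def tables_def frame_def)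

lemma env_upd: "env s \<Longrightarrow> x \<notin> {2, 3, 5, 16} \<Longrightarrow> env (set_reg x k s)"
  by (auto simp: env_def tables_def)

lemma stores_upd: "stores M (set_reg x k s) = stores M s"
  by (simp add: stores_def)

definition state_ok :: "nat \<Rightarrow> (nat \<times> nat set \<times> nat) set \<Rightarrow> state \<Rightarrow> bool" where
  "state_ok r D s \<longleftrightarrow> (\<exists>M. stores M s \<and> progress r M D)"

lemma state_ok_regs [simp]: "state_ok r D (g, snd s) = state_ok r D s"
  by (simp add: state_ok_def stores_def)

lemma ok_sources_prog:
  assumes s: "bnd B s" and env: "env s" and so: "state_ok r D s"
    and v: "v < n" and j: "j < length (ess ! v)" and e: "ess ! v ! j = (us, p, q)" and pq: "0 < q" "0 \<le> p"
    and regs: "fst s 7 = int v" "fst s 15 = int (length us)" "fst s 12 = int (entry_pos ess v j)"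
      "fst s 17 = int (2 ^ (n * n) * sc v (set us))"
    and D: "\<And>y P d. (y, P, d) \<in> D \<Longrightarrow> d \<le> n"
  shows "ok B sources_prog s (4 * L\<^sup>2 * 3 ^ n) (state_ok r (D \<union> {(v, set us, d) | d. d \<le> n}))"
proof -
  let ?D = "\<lambda>d. D \<union> {(v, set us, e) | e. e < d}"
  let ?Inv = "\<lambda>d s'. state_ok r (?D d) s'"
  have mem: "(us, p, q) \<in> set (ess ! v)" using j e by (metis nth_mem)
  have us: "set us \<subseteq> {..<n}" "length us + 3 \<le> length I" using entry_mem[OF v mem] by auto
  have k: "length us + 1 \<le> L" using us(2) L_ge(5) by linarith
  have adm: "set us \<in> adm v" using mem pq by (auto simp: adm_def)
  have dist: "distinct us" using entry[OF v mem] by simp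
  have n1: "int (n + 1) < 2 ^ B" using L_ge(3) by (intro L_less_B) simp
  have v': "v < length ess" using v length_ess by simp
  note nth = input_code_entry_nth[OF v' j e, folded I_def]
  have B3: "3 ^ n < (2::nat) ^ B" using pow3_le by (rule less_B)
  have "(2::nat) ^ n \<le> 2 ^ L" using L_ge(3) by (intro power_increasing) simp_all
  with order_trans[OF k less_imp_le[OF L_less]] have "(length us + 1) * 2 ^ n \<le> 2 ^ L * 2 ^ L"
    by (rule mult_le_mono)
  then have k2: "(length us + 1) * 2 ^ n < 2 ^ B" by (intro less_B) (simp add: mult_2 power_add)
  \<comment> \<open>\<open>d\<close> takes \<open>n + 1\<close> values, so the guard is tested
    \<open>n + 2 <= 2 * L\<close> times; \<open>length us + 1 <= L\<close> bounds the other
    factor.\<close>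
  have W: "(n + 1 + 1) * (2 * (length us + 1) * 3 ^ n) \<le> 4 * L\<^sup>2 * 3 ^ n"
  proof -
    have "(n + 1 + 1) * (2 * (length us + 1) * 3 ^ n) \<le> (2 * L) * (2 * L * 3 ^ n)"
      using L_ge(3,4) k by (intro mult_le_mono) simp_all
    then show ?thesis by (simp add: power2_eq_square mult_ac)
  qed
  have "ok B sources_prog s (4 * L\<^sup>2 * 3 ^ n) (\<lambda>s'. ?Inv (n + 1) s' \<and> fst s' 9 = int (n + 1))"
    unfolding sources_prog_def
  proof (rule ok_For[where Inv = ?Inv, OF s B_ge(1) _ n1 _ W], goal_cases)
    case (4 d s')
    have fr: "\<And>r. r \<notin> {9, 10, 11, 18} \<Longrightarrow> fst s' r = fst s r"
      "\<And>a. a \<notin> {5, 6} \<Longrightarrow> snd s' a = snd s a"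
      using 4(4) by (auto simp: frame_def)
    have env': "env s'" using env fr by (simp add: env_def tables_def)
    then have T': "tables s'" by (simp add: env_def)
    obtain M where M: "stores M s'" "progress r M (?D d)" using 4(5) by (auto simp: state_ok_def)
    have dn: "d \<le> n" using 4(1) by simp
    have snd: "sound M" using M(2) by (simp add: progress_def)
    have "ok B relax_prog s' (2 * (length us + 1) * 3 ^ n)
      (\<lambda>s''. \<exists>M'. stores M' s'' \<and> relaxed M v us (sc v (set us)) d M')"
    proof (rule ok_relax_prog[OF 4(2) B_ge(1) T' M(1) _ _ _ _ _ _ v dn us(1) B3 k2])
      show "snd s' 0 (int (entry_pos ess v j + (i + 1))) = int (us ! i)" if "i < length us" for i
      proof -
        have "entry_pos ess v j + (i + 1) < length I" using nth(1) that by linarith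
        then show ?thesis using env' nth(3)[OF that] unfolding env_def by metis
      qed
      show "a + 1 < 2 ^ B" if "deriv M v (sc v (set us)) d us' X a" for us' X a
        using deriv_less_B[OF snd v dn sc_bound[OF v adm] that] .
    qed (use fr regs 4(3) in simp_all)
    then show ?case
    proof (rule ok_conseq)
      fix s'' assume "\<exists>M'. stores M' s'' \<and> relaxed M v us (sc v (set us)) d M'"
      then obtain M' where M': "stores M' s''" "relaxed M v us (sc v (set us)) d M'" by blast
      have "progress r M' (?D (Suc d))"
        by (rule progress_relaxed[OF M(2) M'(2) v dn dist adm refl])
          (use D dn in \<open>auto simp: less_Suc_eq\<close>)
      with M'(1) show "?Inv (Suc d) (set_reg 9 (int (Suc d)) s'')"
        by (auto simp: state_ok_def stores_upd)
    qed simp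
  next
    case (5 d s')
    then show ?case using env by (simp add: frame_def env_def tables_def)
  qed (use so in \<open>simp_all add: Suc_le_eq\<close>)
  then show ?thesis
    by (rule ok_conseq) (simp_all add: less_Suc_eq_le)
qed

section \<open>Triples used so far, and the loops over entries, nodes and rounds\<close>

definition node_done :: "nat \<Rightarrow> (nat \<times> nat set \<times> nat) set" where
  "node_done v = {(y, P, d). y < v \<and> P \<in> adm y \<and> d \<le> n}"

definition entry_done :: "nat \<Rightarrow> nat \<Rightarrow> (nat \<times> nat set \<times> nat) set" where
  "entry_done v j = node_done v \<union>
     {(v, set us, d) | us p q d. d \<le> n \<and> (us, p, q) \<in> set (take j (ess ! v)) \<and> 0 < q \<and> 0 \<le> p}"

lemma node_done_0: "node_done 0 = {}"
  by (simp add: node_done_def)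

lemma entry_done_0: "entry_done v 0 = node_done v"
  by (simp add: entry_done_def)

lemma entry_done_Suc:
  assumes "j < length (ess ! v)" "ess ! v ! j = (us, p, q)"
  shows "entry_done v (Suc j) =
    entry_done v j \<union> (if 0 < q \<and> 0 \<le> p then {(v, set us, d) | d. d \<le> n} else {})"
  using assms by (auto simp: entry_done_def take_Suc_conv_app_nth)

lemma entry_done_length: "entry_done v (length (ess ! v)) = node_done (Suc v)"
  by (auto simp: entry_done_def node_done_def adm_def less_Suc_eq)

lemma entry_done_le: "(y, P, d) \<in> entry_done v j \<Longrightarrow> d \<le> n"
  by (auto simp: entry_done_def node_done_def)

text \<open>Skipping an unusable entry is harmless because \<open>entry_done\<close> counts only
  entries of finite nonnegative score; the read position advances in both branches.\<close>

lemma ok_entry_prog: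
  assumes s: "bnd B s" and env: "env s" and so: "state_ok r (entry_done v j) s"
    and v: "v < n" and j: "j < length (ess ! v)"
    and regs: "fst s 7 = int v" "fst s 12 = int (entry_pos ess v j)"
  shows "ok B entry_prog s (4 * L\<^sup>2 * 3 ^ n)
    (\<lambda>s'. state_ok r (entry_done v (Suc j)) s' \<and> fst s' 12 = int (entry_pos ess v (Suc j)))"
proof -
  obtain us p q where e: "ess ! v ! j = (us, p, q)" by (cases "ess ! v ! j")
  let ?k = "length us" and ?pos = "entry_pos ess v j" and ?W = "4 * L\<^sup>2 * 3 ^ n"
  have mem: "(us, p, q) \<in> set (ess ! v)" using j e by (metis nth_mem)
  have v': "v < length ess" using v length_ess by simp
  note nth = input_code_entry_nth[OF v' j e, folded I_def]
  have W: "1 \<le> ?W" using L_ge(4) by (simp add: Suc_le_eq)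
  have input: "snd s 0 (int i) = I ! i" if "i < length I" for i
    using env that by (simp add: env_def)
  have inputs: "snd s 0 (int ?pos) = int ?k" "snd s 0 (int (?pos + (?k + 1))) = p"
    "snd s 0 (int (?pos + (?k + 2))) = q"
    using nth(1,2,4,5) by (simp_all only: input)
  have k: "\<bar>int ?k\<bar> < 2 ^ B" using s inputs(1) unfolding bnd_def by metis
  have "ok B (Assign 15 (Arr 0 (Reg 12))) s ?W (\<lambda>s'. s' = set_reg 15 (int ?k) s)"
    by (rule ok_straight[OF s B_ge(1) W]) (use k regs inputs(1) in simp)
  then show ?thesis
    unfolding entry_prog_def
  proof (rule ok_Seq)
    fix s1 assume b1: "bnd B s1" and s1: "s1 = set_reg 15 (int ?k) s"
    have env1: "env s1" using env env_upd s1 by simp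
    have so1: "state_ok r (entry_done v j) s1" using so s1 by simp
    have regs1: "fst s1 7 = int v" "fst s1 12 = int ?pos" "fst s1 15 = int ?k" "snd s1 0 = snd s 0"
      using regs s1 by simp_all
    have ev: "aval entry_p s1 = p" "aval entry_q s1 = q"
      using inputs regs1 by (simp_all add: entry_p_def entry_q_def algebra_simps)
    have usable: "bval usable s1 \<longleftrightarrow> 0 < q \<and> 0 \<le> p"
      unfolding usable_def by (simp add: ev linorder_not_less)
    let ?c = "Cond usable (Seq (Assign 17 (Mul (Arr 2 (Mul (Reg 2) (Reg 2)))
      (Mul entry_p (Div (Reg 3) entry_q)))) sources_prog) Skip"
    have "ok B ?c s1 ?W (state_ok r (entry_done v (Suc j)))"
    proof (rule ok_Cond[OF b1 B_ge(1) W])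
      assume "bval usable s1"
      then have pq: "0 < q" "0 \<le> p" using usable by auto
      let ?w = "int (2 ^ (n * n) * sc v (set us))"
      have adm: "set us \<in> adm v" using mem pq by (auto simp: adm_def)
      have "snd s1 2 (int (n * n)) = 2 ^ (n * n)" "fst s1 2 = int n" "fst s1 3 = int den"
        using env1 unfolding env_def tables_def by blast+
      then have w: "aval (Mul (Arr 2 (Mul (Reg 2) (Reg 2))) (Mul entry_p (Div (Reg 3) entry_q))) s1 = ?w"
        using ev sc_entry(1)[OF v mem pq] by simp
      \<comment> \<open>The scaled score for register 17 is the partial weight of the arcless
        digraph, so the general overflow bound applies to it.\<close>
      have "pwt v (sc v (set us)) {} + 1 < 2 ^ B"
        using pwt_less_B[of "{}"] sc_bound[OF v adm] adm_empty by (simp add: parents_def)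
      moreover have "pwt v (sc v (set us)) {} = 2 ^ (n * n) * sc v (set us)"
        using pwt_no_parents[OF v, of "{}"] by (simp add: parents_def wt_empty)
      ultimately have "int (2 ^ (n * n) * sc v (set us)) < int (2 ^ B)"
        unfolding of_nat_less_iff by simp
      then have "\<bar>?w\<bar> < 2 ^ B" by simp
      then have "ok B (Assign 17 (Mul (Arr 2 (Mul (Reg 2) (Reg 2))) (Mul entry_p (Div (Reg 3) entry_q))))
          s1 ?W (\<lambda>s'. s' = set_reg 17 ?w s1)"
        by (intro ok_straight[OF b1 B_ge(1) W]) (simp only: wp.simps w simp_thms)
      then show "ok B (Seq (Assign 17 (Mul (Arr 2 (Mul (Reg 2) (Reg 2)))
          (Mul entry_p (Div (Reg 3) entry_q)))) sources_prog) s1 ?W (state_ok r (entry_done v (Suc j)))"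
      proof (rule ok_Seq)
        fix s2 assume b2: "bnd B s2" and s2: "s2 = set_reg 17 ?w s1"
        have "ok B sources_prog s2 ?W (state_ok r (entry_done v j \<union> {(v, set us, d) | d. d \<le> n}))"
          by (rule ok_sources_prog[OF b2 _ _ v j e pq])
            (use s2 env1 env_upd so1 regs1 entry_done_le in auto)
        then show "ok B sources_prog s2 ?W (state_ok r (entry_done v (Suc j)))"
          using entry_done_Suc[OF j e] pq by simp
      qed
    next
      assume "\<not> bval usable s1"
      then have "entry_done v (Suc j) = entry_done v j" using usable entry_done_Suc[OF j e] by auto
      then show "ok B Skip s1 ?W (state_ok r (entry_done v (Suc j)))"
        using so1 by (intro ok_straight[OF b1 B_ge(1) W]) simp
    qed
    then show "ok B (Seq ?c (Assign 12 (Add (Reg 12) (Add (Reg 15) (Const 3))))) s1 ?W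
      (\<lambda>s'. state_ok r (entry_done v (Suc j)) s' \<and> fst s' 12 = int (entry_pos ess v (Suc j)))"
    proof (rule ok_Seq)
      fix s3 assume b3: "bnd B s3" and f3: "frame ?c s1 s3" and so3: "state_ok r (entry_done v (Suc j)) s3"
      have r3: "fst s3 12 = int ?pos" "fst s3 15 = int ?k" using f3 regs1 by (simp_all add: frame_def)
      have pos: "entry_pos ess v (Suc j) = ?pos + (?k + 3)" by (rule entry_pos_Suc[OF j e])
      have "?pos + (?k + 3) \<le> L" using nth(1) L_ge(5) by linarith
      then have "int (?pos + (?k + 3)) < 2 ^ B" by (rule L_less_B)
      then show "ok B (Assign 12 (Add (Reg 12) (Add (Reg 15) (Const 3)))) s3 ?W
        (\<lambda>s'. state_ok r (entry_done v (Suc j)) s' \<and> fst s' 12 = int (entry_pos ess v (Suc j)))"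
        using so3 r3 pos by (intro ok_straight[OF b3 B_ge(1) W]) simp
    qed
  qed
qed

lemma ok_node_prog:
  assumes s: "bnd B s" and env: "env s" and so: "state_ok r (node_done v) s" and v: "v < n"
    and regs: "fst s 7 = int v" "fst s 12 = int (node_pos ess v)"
  shows "ok B node_prog s (4 * L ^ 3 * 3 ^ n)
    (\<lambda>s'. state_ok r (node_done (Suc v)) s' \<and> fst s' 12 = int (node_pos ess (Suc v)))"
proof -
  let ?m = "length (ess ! v)" and ?W = "4 * L ^ 3 * 3 ^ n" and ?V = "4 * L\<^sup>2 * 3 ^ n"
  have v': "v < length ess" using v length_ess by simp
  note nth = input_code_node_nth[OF v', folded I_def]
  have W: "1 \<le> ?W" and V: "1 \<le> ?V" using L_ge(4) by (simp_all add: Suc_le_eq)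
  have m: "?m + 1 \<le> L" using nth(1) L_ge(1) by linarith
  have "(?m + 1) * ?V \<le> L * ?V" using m by (rule mult_le_mono1)
  then have WV: "(?m + 1) * ?V \<le> ?W" by (simp add: power2_eq_square power3_eq_cube mult_ac)
  have mB: "int ?m < 2 ^ B" using m by (intro L_less_B) simp
  have "node_pos ess v + 1 \<le> L" using nth(1) L_ge(1) by linarith
  then have pB: "int (node_pos ess v + 1) < 2 ^ B" by (rule L_less_B)
  have "snd s 0 (int (node_pos ess v)) = int ?m" using env nth by (simp add: env_def)
  then have 1: "ok B (Assign 13 (Arr 0 (Reg 12))) s ?W (\<lambda>s'. s' = set_reg 13 (int ?m) s)"
    using mB regs by (intro ok_straight[OF s B_ge(1) W]) simp
  have 2: "ok B (Assign 12 (Add (Reg 12) (Const 1))) (set_reg 13 (int ?m) s) ?W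
    (\<lambda>s'. s' = set_reg 12 (int (node_pos ess v + 1)) (set_reg 13 (int ?m) s))"
    if "bnd B (set_reg 13 (int ?m) s)"
    using pB regs by (intro ok_straight[OF that B_ge(1) W]) (simp add: add.commute)
  show ?thesis
    unfolding node_prog_def
  proof (rule ok_Seq[OF 1])
    fix s1 assume b1: "bnd B s1" and s1: "s1 = set_reg 13 (int ?m) s"
    show "ok B (Seq (Assign 12 (Add (Reg 12) (Const 1))) (For 8 (Reg 13) entry_prog)) s1 ?W
      (\<lambda>s'. state_ok r (node_done (Suc v)) s' \<and> fst s' 12 = int (node_pos ess (Suc v)))"
    proof (rule ok_Seq[OF 2[OF b1[unfolded s1], folded s1]])
      fix s2 assume b2: "bnd B s2" and s2: "s2 = set_reg 12 (int (node_pos ess v + 1)) s1"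
      let ?Inv = "\<lambda>j (s' :: state). state_ok r (entry_done v j) s' \<and> fst s' 12 = int (entry_pos ess v j)"
      have "ok B (For 8 (Reg 13) entry_prog) s2 ?W (\<lambda>s'. ?Inv ?m s' \<and> fst s' 8 = int ?m)"
      proof (rule ok_For[where Inv = ?Inv, OF b2 B_ge(1) V mB _ WV], goal_cases)
        case 1
        show ?case by simp
      next
        case 2
        show ?case using so s1 s2 by (simp add: entry_done_0 entry_pos_0)
      next
        case (3 j s')
        have fr: "\<And>r. r \<notin> {8, 9, 10, 11, 12, 15, 17, 18} \<Longrightarrow> fst s' r = fst s r \<or> r = 13"
          "\<And>a. a \<notin> {5, 6} \<Longrightarrow> snd s' a = snd s a"
          using 3(4) s1 s2 by (auto simp: frame_def)
        have env1: "env s1" unfolding s1 by (rule env_upd[OF env]) simp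
        have "env s2" unfolding s2 by (rule env_upd[OF env1]) simp
        then have "env s'" using env_frame[OF _ 3(4)] by simp
        moreover have "fst s' 7 = int v" using fr(1)[of 7] regs by simp
        ultimately have "ok B entry_prog s' ?V (\<lambda>s'. state_ok r (entry_done v (Suc j)) s' \<and>
            fst s' 12 = int (entry_pos ess v (Suc j)))"
          using 3 by (intro ok_entry_prog[OF 3(2) _ _ v 3(1)]) simp_all
        then show ?case by (rule ok_conseq) simp_all
      next
        case (4 j s')
        then show ?case using s1 s2 by (simp add: frame_def)
      qed
      then show "ok B (For 8 (Reg 13) entry_prog) s2 ?W
        (\<lambda>s'. state_ok r (node_done (Suc v)) s' \<and> fst s' 12 = int (node_pos ess (Suc v)))"
        by (rule ok_conseq) (simp_all add: entry_done_length node_pos_Suc v')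
    qed
  qed
qed

text \<open>The loops over entries, nodes and rounds each contribute a factor of at most
  \<open>L\<close>, raising \<open>4 * L^2\<close> for one entry to
  \<open>4 * L ^ 5\<close>.\<close>

lemma ok_rounds_prog:
  assumes s: "bnd B s" and env: "env s" and so: "state_ok 0 {} s"
  shows "ok B rounds_prog s (4 * L ^ 5 * 3 ^ n) (state_ok n {})"
proof -
  let ?U = "4 * L ^ 3 * 3 ^ n" and ?V = "4 * L ^ 4 * 3 ^ n" and ?W = "4 * L ^ 5 * 3 ^ n"
  have U: "1 \<le> ?U" and V: "1 \<le> ?V" using L_ge(4) by (simp_all add: Suc_le_eq)
  have "(n + 1) * ?U \<le> L * ?U" "(n + 1) * ?V \<le> L * ?V" using L_ge(3) by (simp_all only: mult_le_mono1)
  then have UV: "(n + 1) * ?U \<le> ?V" and VW: "(n + 1) * ?V \<le> ?W"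
    by (simp_all add: eval_nat_numeral mult_ac)
  have nB: "int n < 2 ^ B" using L_ge(3) by (intro L_less_B) simp
  have "ok B rounds_prog s ?W (\<lambda>s'. state_ok n {} s' \<and> fst s' 6 = int n)"
    unfolding rounds_prog_def
  proof (rule ok_For[where Inv = "\<lambda>r. state_ok r {}", OF s B_ge(1) V nB _ VW], goal_cases)
    case (3 r s')
    have env': "env s'" using env_frame[OF env 3(4)] by simp
    have "ok B (Assign 12 (Const 1)) s' ?V (\<lambda>s1. s1 = set_reg 12 1 s')"
      using L_less_B[of 1] L_ge(4) by (intro ok_straight[OF 3(2) B_ge(1) V]) simp
    then show ?case
    proof (rule ok_Seq)
      fix s1 assume b1: "bnd B s1" and s1: "s1 = set_reg 12 1 s'"
      have env1: "env s1" using env' env_upd s1 by simp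
      let ?Inv = "\<lambda>v (s' :: state). state_ok r (node_done v) s' \<and> fst s' 12 = int (node_pos ess v)"
      have "ok B (For 7 (Reg 2) node_prog) s1 ?V (\<lambda>s'. ?Inv n s' \<and> fst s' 7 = int n)"
      proof (rule ok_For[where Inv = ?Inv, OF b1 B_ge(1) U nB _ UV], goal_cases)
        case 1
        show ?case by simp
      next
        case 2
        show ?case using 3(5) s1 by (simp add: node_done_0 node_pos_0)
      next
        case (3 v s2)
        have "env s2" using env_frame[OF env1 3(4)] by simp
        then have "ok B node_prog s2 ?U (\<lambda>s'. state_ok r (node_done (Suc v)) s' \<and>
            fst s' 12 = int (node_pos ess (Suc v)))"
          using 3 by (intro ok_node_prog[OF 3(2) _ _ 3(1)]) simp_all
        then show ?case by (rule ok_conseq) simp_all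
      next
        case (4 v s2)
        have "env s2" using env_frame[OF env1 4(4)] by simp
        then show ?case by (simp add: env_def tables_def)
      qed
      then show "ok B (For 7 (Reg 2) node_prog) s1 ?V
        (\<lambda>s''. state_ok (Suc r) {} (set_reg 6 (int (Suc r)) s''))"
      proof (rule ok_conseq)
        fix s2 assume "?Inv n s2 \<and> fst s2 7 = int n"
        then obtain M where M: "stores M s2" "progress r M (node_done n)"
          by (auto simp: state_ok_def)
        have "progress (Suc r) M {}" by (rule progress_round[OF M(2)]) (simp add: node_done_def)
        with M(1) show "state_ok (Suc r) {} (set_reg 6 (int (Suc r)) s2)"
          by (auto simp: state_ok_def stores_upd)
      qed simp
    qed
  next
    case (4 r s')
    have "env s'" using env_frame[OF env 4(4)] by simp
    then show ?case by (simp add: env_def tables_def)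
  qed (use so in simp_all)
  then show ?thesis by (rule ok_conseq) simp_all
qed

end

section \<open>Set-up and output\<close>

definition prod_prog :: com where
  "prod_prog = For 4 (Reg 0) (Cond (Less (Const 0) (Arr 0 (Reg 4)))
     (Assign 3 (Mul (Reg 3) (Arr 0 (Reg 4)))) Skip)"

definition pow2_prog :: com where
  "pow2_prog = For 4 (Mul (Reg 2) (Reg 2))
     (Store 2 (Add (Reg 4) (Const 1)) (Mul (Const 2) (Arr 2 (Reg 4))))"

definition pow3_prog :: com where
  "pow3_prog = For 4 (Reg 2) (Assign 5 (Mul (Const 3) (Reg 5)))"

definition pairs_prog :: com where
  "pairs_prog = For 4 (Reg 5) (Seq
     (Store 3 (Reg 4) (Add (Mul (Const 2) (Arr 3 (Div (Reg 4) (Const 3))))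
        (Mod (Mod (Reg 4) (Const 3)) (Const 2))))
     (Store 4 (Reg 4) (Add (Mul (Const 2) (Arr 4 (Div (Reg 4) (Const 3))))
        (Div (Mod (Reg 4) (Const 3)) (Const 2)))))"

definition setup_prog :: com where
  "setup_prog = Seq (Seq (Assign 2 (Arr 0 (Const 0))) (Seq (Assign 3 (Const 1)) (Seq (Assign 5 (Const 1))
     (Store 2 (Const 0) (Const 1)))))
     (Seq prod_prog (Seq pow2_prog (Seq (Assign 16 (Arr 2 (Reg 2))) (Seq pow3_prog pairs_prog))))"

text \<open>\<open>Reg 16 - 1\<close> is the code \<open>2 ^ n - 1\<close> of the whole node set,
  and row \<open>n\<close> is the unrestricted one. The remainder modulo \<open>2 ^ (n * n)\<close>
  drops the score and keeps the adjacency matrix, whose bit \<open>u * n + v\<close> is the arc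
  \<open>(u, v)\<close>.\<close>

definition out_prog :: com where
  "out_prog = Seq (Assign 14 (Mod (Arr 5 (slot (Reg 2) (Sub (Reg 16) (Const 1))))
       (Arr 2 (Mul (Reg 2) (Reg 2)))))
     (For 4 (Mul (Reg 2) (Reg 2)) (Cond (bit_test (Reg 14) (Reg 4))
       (Seq (Store 1 (Reg 1) (Div (Reg 4) (Reg 2)))
         (Seq (Store 1 (Add (Reg 1) (Const 1)) (Mod (Reg 4) (Reg 2)))
           (Assign 1 (Add (Reg 1) (Const 2))))) Skip))"

definition polytree_prog :: com where
  "polytree_prog = Seq setup_prog (Seq rounds_prog out_prog)"

lemma writes_prod_prog [simp]: "wregs prod_prog = {3, 4}" "warrs prod_prog = {}"
  and writes_pow2_prog [simp]: "wregs pow2_prog = {4}" "warrs pow2_prog = {2}"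
  and writes_pow3_prog [simp]: "wregs pow3_prog = {4, 5}" "warrs pow3_prog = {}"
  and writes_pairs_prog [simp]: "wregs pairs_prog = {4}" "warrs pairs_prog = {3, 4}"
  by (auto simp: prod_prog_def pow2_prog_def pow3_prog_def pairs_prog_def)

lemma set_encode_lessThan: "set_encode {..<k} = 2 ^ k - 1"
  using sum_power2[of k] by (simp add: set_encode_def lessThan_atLeast0)

lemma code_len_take: "code_len (take i xs) \<le> code_len xs"
proof -
  have "code_len xs = code_len (take i xs) + code_len (drop i xs)"
    unfolding code_len_def by (metis append_take_drop_id map_append sum_list_append)
  then show ?thesis by simp
qed

context pt_input
begin

lemma less_B_int: "x \<le> 2 ^ (2 * L) \<Longrightarrow> int x < 2 ^ B"
  using less_B[of x] by (metis of_nat_less_iff of_nat_numeral of_nat_power)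

lemma L_square_le: "L * L \<le> 2 ^ (2 * L)" "2 * (n * n) \<le> 2 ^ (2 * L)" "n * n \<le> L * L"
proof -
  have "L * L \<le> 2 ^ L * 2 ^ L" using L_less by (intro mult_le_mono) simp_all
  then show "L * L \<le> 2 ^ (2 * L)" by (simp add: mult_2 power_add)
  have "n < 2 ^ n" by (rule less_exp)
  then have "2 * n \<le> 2 ^ (n + 1)" by simp
  also have "(2::nat) ^ (n + 1) \<le> 2 ^ L" using L_ge(3) by (intro power_increasing) simp_all
  finally have 1: "2 * n \<le> 2 ^ L" .
  have "n \<le> 2 ^ L" using L_ge(3) L_less by linarith
  with 1 have "2 * n * n \<le> 2 ^ L * 2 ^ L" by (rule mult_le_mono)
  then show "2 * (n * n) \<le> 2 ^ (2 * L)" by (simp add: mult_2[of L] power_add mult.assoc)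
  show "n * n \<le> L * L" using L_ge(3) by (intro mult_le_mono) simp_all
qed

lemma square_bound: "n * n + 1 \<le> 2 * (L * L)"
proof -
  have "1 \<le> L * L" using mult_le_mono[of 1 L 1 L] L_ge(4) by simp
  with L_square_le(3) show ?thesis by linarith
qed

lemma ok_prod_prog:
  assumes s: "bnd B s" and "fst s 0 = int (length I)" "\<And>i. i < length I \<Longrightarrow> snd s 0 (int i) = I ! i"
    "fst s 3 = 1"
  shows "ok B prod_prog s L (\<lambda>s'. fst s' 3 = int den)"
proof -
  let ?Inv = "\<lambda>i (s' :: state). fst s' 3 = int (pos_prod (take i I))"
  have R: "int (length I) < 2 ^ B" using L_ge(5) by (intro L_less_B) simp
  have W: "(length I + 1) * 1 \<le> L" using L_ge(5) by simp
  have "ok B prod_prog s L (\<lambda>s'. ?Inv (length I) s' \<and> fst s' 4 = int (length I))"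
    unfolding prod_prog_def
  proof (rule ok_For[where Inv = ?Inv, OF s B_ge(1) order_refl R _ W], goal_cases)
    case (3 i s')
    have x: "snd s' 0 (int i) = I ! i" using 3 assms(3) by (simp add: frame_def)
    have step: "pos_prod (take (Suc i) I) = pos_prod (take i I) * (if 0 < I ! i then nat (I ! i) else 1)"
      using 3(1) by (simp add: take_Suc_conv_app_nth)
    have "pos_prod (take (Suc i) I) \<le> 2 ^ code_len (take (Suc i) I)" by (rule pos_prod_le)
    also have "\<dots> \<le> 2 ^ (2 * L)"
      using code_len_take[of "Suc i" I] by (intro power_increasing) (simp_all add: L_def)
    finally have b: "int (pos_prod (take (Suc i) I)) < 2 ^ B" by (rule less_B_int)
    show ?case
      by (rule ok_straight[OF 3(2) B_ge(1) order_refl])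
        (use 3(3,5) x step b in \<open>auto simp: abs_mult\<close>)
  next
    case (4 i s')
    then show ?case using assms(2) by (simp add: frame_def)
  qed (use assms(4) in simp_all)
  then show ?thesis by (rule ok_conseq) (simp_all add: den_def)
qed

lemma ok_pow2_prog:
  assumes s: "bnd B s" and "fst s 2 = int n" "snd s 2 0 = 1"
  shows "ok B pow2_prog s (2 * (L * L)) (\<lambda>s'. \<forall>i\<le>n * n. snd s' 2 (int i) = 2 ^ i)"
proof -
  let ?Inv = "\<lambda>j (s' :: state). \<forall>i\<le>j. snd s' 2 (int i) = 2 ^ i"
  have R: "int (n * n) < 2 ^ B" using L_square_le by (intro less_B_int) linarith
  have W: "(n * n + 1) * 1 \<le> 2 * (L * L)" using square_bound by simp
  have "ok B pow2_prog s (2 * (L * L)) (\<lambda>s'. ?Inv (n * n) s' \<and> fst s' 4 = int (n * n))"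
    unfolding pow2_prog_def
  proof (rule ok_For[where Inv = ?Inv, OF s B_ge(1) order_refl R _ W], goal_cases)
    case (3 j s')
    have "Suc j < B" using 3(1) L_square_le(3) L_ge(4) by (simp add: B_def)
    then have "(2::int) ^ Suc j < 2 ^ B" by (intro power_strict_increasing) simp_all
    then show ?case
      by (intro ok_straight[OF 3(2) B_ge(1) order_refl])
        (use 3(3,5) in \<open>auto simp: le_Suc_eq\<close>)
  next
    case (4 j s')
    then show ?case using assms(2) by (simp add: frame_def)
  qed (use assms(3) in simp_all)
  then show ?thesis by (rule ok_conseq) simp_all
qed

lemma ok_pow3_prog:
  assumes s: "bnd B s" and "fst s 2 = int n" "fst s 5 = 1"
  shows "ok B pow3_prog s L (\<lambda>s'. fst s' 5 = 3 ^ n)"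
proof -
  let ?Inv = "\<lambda>i (s' :: state). fst s' 5 = 3 ^ i"
  have R: "int n < 2 ^ B" using L_ge(3) by (intro L_less_B) simp
  have W: "(n + 1) * 1 \<le> L" using L_ge(3) by simp
  have "ok B pow3_prog s L (\<lambda>s'. ?Inv n s' \<and> fst s' 4 = int n)"
    unfolding pow3_prog_def
  proof (rule ok_For[where Inv = ?Inv, OF s B_ge(1) order_refl R _ W], goal_cases)
    case (3 i s')
    have "(3::nat) ^ Suc i \<le> 3 ^ n" using 3(1) by (intro power_increasing) simp_all
    also note pow3_le
    finally have "int (3 ^ Suc i) < 2 ^ B" by (rule less_B_int)
    then show ?case
      by (intro ok_straight[OF 3(2) B_ge(1) order_refl]) (use 3(5) in simp)
  next
    case (4 i s')
    then show ?case using assms(2) by (simp add: frame_def)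
  qed (use assms(3) in simp_all)
  then show ?thesis by (rule ok_conseq) simp_all
qed

lemma ok_pairs_prog:
  assumes s: "bnd B s" and "fst s 5 = 3 ^ n" "snd s 3 0 = 0" "snd s 4 0 = 0"
  shows "ok B pairs_prog s (2 * 3 ^ n)
    (\<lambda>s'. \<forall>c<3 ^ n. snd s' 3 (int c) = int (ones c) \<and> snd s' 4 (int c) = int (twos c))"
proof -
  \<comment> \<open>The cell for 0 must be known from the start: the first iteration reads it, as
    \<open>0 div 3 = 0\<close>, while the loop has written nothing yet. Arrays being initially zero
    makes it correct.\<close>
  let ?Inv = "\<lambda>c (s' :: state). \<forall>b. b < c \<or> b = 0 \<longrightarrow>
    snd s' 3 (int b) = int (ones b) \<and> snd s' 4 (int b) = int (twos b)"
  have R: "int (3 ^ n) < 2 ^ B" using pow3_le by (rule less_B_int)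
  have W: "(3 ^ n + 1) * 1 \<le> 2 * (3::nat) ^ n" by simp
  have "ok B pairs_prog s (2 * 3 ^ n) (\<lambda>s'. ?Inv (3 ^ n) s' \<and> fst s' 4 = int (3 ^ n))"
    unfolding pairs_prog_def
  proof (rule ok_For[where Inv = ?Inv, OF s B_ge(1) order_refl R _ W], goal_cases)
    case (3 c s')
    have "c div 3 < c \<or> c div 3 = 0" by auto
    then have prev: "snd s' 3 (int (c div 3)) = int (ones (c div 3))"
      "snd s' 4 (int (c div 3)) = int (twos (c div 3))"
      using 3(5) by blast+
    have "(2::nat) ^ n \<le> 2 ^ (2 * L)" using L_ge(3) by (intro power_increasing) simp_all
    then have "int (ones c) < 2 ^ B" "int (twos c) < 2 ^ B"
      using ones_less[OF 3(1)] twos_less[OF 3(1)] by (intro less_B_int; linarith)+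
    moreover have "aval (Add (Mul (Const 2) (Arr 3 (Div (Reg 4) (Const 3))))
        (Mod (Mod (Reg 4) (Const 3)) (Const 2))) s' = int (ones c)"
      using prev(1) ones_eq[of c] 3(3) by (simp add: zdiv_int zmod_int)
    moreover have "aval (Add (Mul (Const 2) (Arr 4 (Div (Reg 4) (Const 3))))
        (Div (Mod (Reg 4) (Const 3)) (Const 2))) (fst s', (snd s')(3 := h)) = int (twos c)" for h
      using prev(2) twos_eq[of c] 3(3) by (simp add: zdiv_int zmod_int)
    ultimately show ?case
      by (intro ok_straight[OF 3(2) B_ge(1) order_refl], simp only: wp.simps)
        (use 3(3,5) in \<open>auto simp: less_Suc_eq\<close>)
  next
    case (4 c s')
    then show ?case using assms(2) by (simp add: frame_def)
  qed (use assms(3,4) in simp_all)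
  then show ?thesis by (rule ok_conseq) simp_all
qed

lemma bnd_init: "bnd B (init_state I)"
proof -
  have "int (length I) < 2 ^ B" using L_ge(5) by (intro L_less_B) simp
  moreover have "\<bar>I ! i\<bar> < 2 ^ B" if "i < length I" for i
  proof -
    have "\<bar>I ! i\<bar> < 2 ^ int_len (I ! i)" by (rule abs_less_int_len)
    also have "(2::int) ^ int_len (I ! i) \<le> 2 ^ B"
      using int_len_le_code_len[OF nth_mem[OF that]] B_ge(3)
      by (intro power_increasing) (simp_all add: L_def)
    finally show ?thesis .
  qed
  ultimately show ?thesis unfolding bnd_def init_state_def by (auto simp: nat_less_iff)
qed

lemma ok_setup_prog:
  "ok B setup_prog (init_state I) (4 * L ^ 5 * 3 ^ n)
    (\<lambda>s'. env s' \<and> state_ok 0 {} s' \<and> fst s' 1 = 0)"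
proof -
  let ?s = "init_state I" and ?W = "4 * L ^ 5 * 3 ^ n"
  have "L \<le> L ^ 5" "L\<^sup>2 \<le> L ^ 5" using L_ge(4) by (simp_all add: self_le_power power_increasing)
  moreover have 3: "1 \<le> (3::nat) ^ n" by simp
  ultimately have "L * 1 \<le> L ^ 5 * 3 ^ n" "L\<^sup>2 * 1 \<le> L ^ 5 * 3 ^ n" "1 * 3 ^ n \<le> L ^ 5 * 3 ^ n"
    using L_ge(4) by (intro mult_le_mono; simp add: Suc_le_eq)+
  then have W: "L \<le> ?W" "2 * (L * L) \<le> ?W" "2 * 3 ^ n \<le> ?W"
    unfolding power2_eq_square mult.assoc mult_1_right mult_1 by linarith+
  then have W1: "1 \<le> ?W" using L_ge(4) by linarith
  have in0: "snd ?s 0 (int i) = I ! i" if "i < length I" for i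
    using that by (simp add: init_state_def)
  have "0 < length I" using L_ge(2) by linarith
  then have n0: "snd ?s 0 0 = int n"
    using in0[of 0] by (simp add: I_def input_code_def length_ess)
  let ?s1 = "((fst ?s)(2 := int n, 3 := 1, 5 := 1), (snd ?s)(2 := (snd ?s 2)(0 := 1)))"
  have small: "int n < 2 ^ B" "(1::int) < 2 ^ B"
    using L_less_B[of n] L_less_B[of 1] L_ge(3,4) by simp_all
  have "ok B (Seq (Assign 2 (Arr 0 (Const 0))) (Seq (Assign 3 (Const 1)) (Seq (Assign 5 (Const 1))
     (Store 2 (Const 0) (Const 1))))) ?s ?W (\<lambda>s'. s' = ?s1)"
    by (rule ok_straight[OF bnd_init B_ge(1) W1]) (use small n0 in simp)
  then show ?thesis
    unfolding setup_prog_def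
  proof (rule ok_Seq)
    fix s1 assume b1: "bnd B s1" and "s1 = ?s1"
    then have s1: "fst s1 0 = int (length I)" "fst s1 1 = 0" "fst s1 2 = int n" "fst s1 3 = 1"
      "fst s1 5 = 1" "\<And>i. i < length I \<Longrightarrow> snd s1 0 (int i) = I ! i" "snd s1 2 0 = 1"
      "\<And>i. snd s1 3 i = 0" "\<And>i. snd s1 4 i = 0" "\<And>i. snd s1 5 i = 0"
      using in0 by (simp_all add: init_state_def)
    show "ok B (Seq prod_prog (Seq pow2_prog (Seq (Assign 16 (Arr 2 (Reg 2))) (Seq pow3_prog pairs_prog))))
      s1 ?W (\<lambda>s'. env s' \<and> state_ok 0 {} s' \<and> fst s' 1 = 0)"
    proof (rule ok_Seq[OF ok_conseq[OF ok_prod_prog[OF b1 s1(1) s1(6) s1(4)] W(1)]])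
      fix s2 assume b2: "bnd B s2" and f2: "frame prod_prog s1 s2" and s2: "fst s2 3 = int den"
      note fr2 = f2[unfolded frame_def writes_prod_prog]
      have "ok B pow2_prog s2 (2 * (L * L)) (\<lambda>s'. \<forall>i\<le>n * n. snd s' 2 (int i) = 2 ^ i)"
        using fr2 s1 by (intro ok_pow2_prog[OF b2]) simp_all
      then show "ok B (Seq pow2_prog (Seq (Assign 16 (Arr 2 (Reg 2))) (Seq pow3_prog pairs_prog)))
        s2 ?W (\<lambda>s'. env s' \<and> state_ok 0 {} s' \<and> fst s' 1 = 0)"
      proof (rule ok_Seq[OF ok_conseq[OF _ W(2)]])
        fix s3 assume b3: "bnd B s3" and f3: "frame pow2_prog s2 s3"
          and s3: "\<forall>i\<le>n * n. snd s3 2 (int i) = 2 ^ i"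
        note fr3 = f3[unfolded frame_def writes_pow2_prog]
        have "snd s3 2 (int n) = 2 ^ n" using s3 le_square[of n] by blast
        moreover have n3: "fst s3 2 = int n" using fr2 fr3 s1 by simp
        ultimately have pow: "aval (Arr 2 (Reg 2)) s3 = 2 ^ n" by simp
        moreover have "\<bar>snd s3 2 (int n)\<bar> < 2 ^ B" using b3 unfolding bnd_def by blast
        ultimately have "ok B (Assign 16 (Arr 2 (Reg 2))) s3 ?W (\<lambda>s'. s' = set_reg 16 (2 ^ n) s3)"
          using n3 by (intro ok_straight[OF b3 B_ge(1) W1]) simp
        then show "ok B (Seq (Assign 16 (Arr 2 (Reg 2))) (Seq pow3_prog pairs_prog))
          s3 ?W (\<lambda>s'. env s' \<and> state_ok 0 {} s' \<and> fst s' 1 = 0)"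
        proof (rule ok_Seq)
          fix s4 assume b4: "bnd B s4" and s4: "s4 = set_reg 16 (2 ^ n) s3"
          have "ok B pow3_prog s4 L (\<lambda>s'. fst s' 5 = 3 ^ n)"
            using fr2 fr3 s1 s4 by (intro ok_pow3_prog[OF b4]) simp_all
          then show "ok B (Seq pow3_prog pairs_prog) s4 ?W
            (\<lambda>s'. env s' \<and> state_ok 0 {} s' \<and> fst s' 1 = 0)"
          proof (rule ok_Seq[OF ok_conseq[OF _ W(1)]])
            fix s5 assume b5: "bnd B s5" and f5: "frame pow3_prog s4 s5" and s5: "fst s5 5 = 3 ^ n"
            note fr5 = f5[unfolded frame_def writes_pow3_prog]
            have "ok B pairs_prog s5 (2 * 3 ^ n)
              (\<lambda>s'. \<forall>c<3 ^ n. snd s' 3 (int c) = int (ones c) \<and> snd s' 4 (int c) = int (twos c))"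
              using fr2 fr3 fr5 s1 s4 s5 by (intro ok_pairs_prog[OF b5]) simp_all
            then show "ok B pairs_prog s5 ?W (\<lambda>s'. env s' \<and> state_ok 0 {} s' \<and> fst s' 1 = 0)"
            proof (rule ok_conseq[OF _ W(3)])
              fix s6 assume f6: "frame pairs_prog s5 s6"
                and s6: "\<forall>c<3 ^ n. snd s6 3 (int c) = int (ones c) \<and> snd s6 4 (int c) = int (twos c)"
              note fr6 = f6[unfolded frame_def writes_pairs_prog]
              have env6: "fst s6 1 = 0" "fst s6 2 = int n" "fst s6 3 = int den" "fst s6 5 = 3 ^ n"
                "fst s6 16 = 2 ^ n" "\<And>i. i < length I \<Longrightarrow> snd s6 0 (int i) = I ! i"
                "snd s6 2 = snd s3 2" "\<And>i. snd s6 5 i = 0"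
                using fr2 fr3 fr5 fr6 s1 s2 s4 s5 by simp_all
              have "stores (\<lambda>_ _. 0) s6" using env6 by (simp add: stores_def)
              then have "state_ok 0 {} s6" using progress_init unfolding state_ok_def by blast
              moreover have "env s6" using env6 s3 s6 by (simp add: env_def tables_def)
              ultimately show "env s6 \<and> state_ok 0 {} s6 \<and> fst s6 1 = 0" using env6(1) by blast
            qed
          qed
        qed
      qed
    qed
  qed
qed

section \<open>Decoding the optimal polytree\<close>

definition arc_list :: "nat \<Rightarrow> nat \<Rightarrow> (nat \<times> nat) list" where
  "arc_list w c = map (\<lambda>x. (x div n, x mod n)) (filter (\<lambda>x. x \<in> set_decode w) [0..<c])"

lemma arc_list_code:
  assumes "A \<subseteq> {..<n} \<times> {..<n}"
  shows "distinct (arc_list (code A) (n * n))" "set (arc_list (code A) (n * n)) = A"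
proof -
  have "inj_on (\<lambda>x. (x div n, x mod n)) S" for S
    by (rule inj_onI) (metis Pair_inject div_mult_mod_eq)
  then show "distinct (arc_list (code A) (n * n))"
    by (simp add: arc_list_def distinct_map)
  have "finite A" using assms finite_subset by blast
  then have "set_decode (code A) = (\<lambda>(u, v). u * n + v) ` A" by (simp add: code_def)
  moreover have "(\<lambda>(u, v). u * n + v) ` A \<subseteq> {..<n * n}" by (rule code_image_less[OF assms])
  ultimately have "set (arc_list (code A) (n * n)) = (\<lambda>x. (x div n, x mod n)) ` (\<lambda>(u, v). u * n + v) ` A"
    unfolding arc_list_def set_map set_filter by (intro arg_cong2[where f = image] refl) auto
  also have "\<dots> = (\<lambda>a. a) ` A"
    unfolding image_image by (rule image_cong) (use assms in auto)
  finally show "set (arc_list (code A) (n * n)) = A" by simp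
qed

lemma ok_out_prog:
  assumes s: "bnd B s" and env: "env s" and so: "state_ok n {} s" and r1: "fst s 1 = 0"
  shows "ok B out_prog s (4 * L ^ 5 * 3 ^ n) (\<lambda>s'. \<exists>A. valid n {..<n} A \<and>
    (\<forall>A'. valid n {..<n} A' \<longrightarrow> wt A' \<le> wt A) \<and>
    result s' = concat (map (\<lambda>(u, v). [int u, int v]) (arc_list (code A) (n * n))))"
proof -
  let ?W = "4 * L ^ 5 * 3 ^ n"
  obtain M where M: "stores M s" "progress n M {}" using so by (auto simp: state_ok_def)
  obtain A where A: "valid n {..<n} A" "M n {..<n} = wt A" "\<forall>A'. valid n {..<n} A' \<longrightarrow> wt A' \<le> wt A"
    using progress_final[OF M(2)] by blast
  have An: "A \<subseteq> {..<n} \<times> {..<n}" using A(1) by (simp add: valid_def)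
  let ?w = "code A"
  have "L\<^sup>2 \<le> L ^ 5" using L_ge(4) by (simp add: power_increasing)
  then have "L\<^sup>2 * 1 \<le> L ^ 5 * 3 ^ n" by (intro mult_le_mono) simp_all
  then have "2 * (L * L) \<le> ?W" unfolding power2_eq_square mult.assoc mult_1_right by linarith
  moreover note square_bound
  ultimately have W: "(n * n + 1) * 1 \<le> ?W" unfolding mult_1_right by linarith
  have W1: "1 \<le> ?W" using L_ge(4) by (simp add: Suc_le_eq)
  have T: "tables s" using env by (simp add: env_def)
  have pow: "snd s 2 (int (n * n)) = 2 ^ (n * n)" using T unfolding tables_def by blast
  have "snd s 5 (int (n * 2 ^ n + set_encode {..<n})) = int (wt A)"
    using M(1) A(2) unfolding stores_def by (metis order_refl)
  moreover have "int (set_encode {..<n}) = 2 ^ n - 1" by (simp add: set_encode_lessThan of_nat_diff)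
  then have "int (n * 2 ^ n + set_encode {..<n}) = aval (slot (Reg 2) (Sub (Reg 16) (Const 1))) s"
    using T by (simp add: slot_def tables_def)
  ultimately have "aval (Mod (Arr 5 (slot (Reg 2) (Sub (Reg 16) (Const 1)))) (Arr 2 (Mul (Reg 2) (Reg 2)))) s
      = int (wt A) mod 2 ^ (n * n)"
    using T pow by (simp add: tables_def)
  also have "\<dots> = int ?w" using wt_mod[OF An] by (metis of_nat_numeral of_nat_power zmod_int)
  finally have ev: "aval (Mod (Arr 5 (slot (Reg 2) (Sub (Reg 16) (Const 1))))
      (Arr 2 (Mul (Reg 2) (Reg 2)))) s = int ?w" .
  have "int ?w < 2 ^ B"
  proof -
    have "int ?w < int (2 ^ (n * n))" unfolding of_nat_less_iff by (rule code_less[OF An])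
    moreover have "\<bar>snd s 2 (int (n * n))\<bar> < 2 ^ B" using s unfolding bnd_def by blast
    ultimately show ?thesis unfolding pow of_nat_power of_nat_numeral by linarith
  qed
  then have "ok B (Assign 14 (Mod (Arr 5 (slot (Reg 2) (Sub (Reg 16) (Const 1))))
      (Arr 2 (Mul (Reg 2) (Reg 2))))) s ?W (\<lambda>s'. s' = set_reg 14 (int ?w) s)"
    using ev by (intro ok_straight[OF s B_ge(1) W1]) (simp del: aval.simps)
  then show ?thesis
    unfolding out_prog_def
  proof (rule ok_Seq)
    fix s1 assume b1: "bnd B s1" and s1: "s1 = set_reg 14 (int ?w) s"
    let ?out = "\<lambda>c. concat (map (\<lambda>(u, v). [int u, int v]) (arc_list ?w c))"
    define Inv where "Inv c s' \<longleftrightarrow> fst s' 1 = int (2 * length (arc_list ?w c)) \<and> result s' = ?out c"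
      for c s'
    let ?c = "Cond (bit_test (Reg 14) (Reg 4))
       (Seq (Store 1 (Reg 1) (Div (Reg 4) (Reg 2)))
         (Seq (Store 1 (Add (Reg 1) (Const 1)) (Mod (Reg 4) (Reg 2)))
           (Assign 1 (Add (Reg 1) (Const 2))))) Skip"
    have R: "int (n * n) < 2 ^ B" using L_square_le by (intro less_B_int) linarith
    have "ok B (For 4 (Mul (Reg 2) (Reg 2)) ?c) s1 ?W (\<lambda>s'. Inv (n * n) s' \<and> fst s' 4 = int (n * n))"
    proof (rule ok_For[where Inv = Inv, OF b1 B_ge(1) order_refl R _ W], goal_cases)
      case 1
      show ?case by simp
    next
      case 2
      show ?case using r1 s1 by (simp add: Inv_def arc_list_def result_def)
    next
      case (3 c s')
      have fr: "\<And>r. r \<notin> {1, 4} \<Longrightarrow> fst s' r = fst s1 r" "\<And>a. a \<noteq> 1 \<Longrightarrow> snd s' a = snd s1 a"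
        using 3(4) by (auto simp: frame_def)
      have r2: "fst s' 2 = int n" using fr s1 T by (simp add: tables_def)
      have "snd s' 2 (int c) = 2 ^ c" using fr s1 T 3(1) by (simp add: tables_def)
      then have bit: "bval (bit_test (Reg 14) (Reg 4)) s' \<longleftrightarrow> c \<in> set_decode ?w"
        using fr s1 3(3) by (intro bval_bit_test) simp_all
      let ?l = "length (arc_list ?w c)"
      have inv: "fst s' 1 = int (2 * ?l)" "result s' = ?out c" using 3(5) by (simp_all add: Inv_def)
      show ?case
      proof (rule ok_straight[OF 3(2) B_ge(1) order_refl])
        show "wp B ?c (\<lambda>s''. Inv (Suc c) (set_reg 4 (int (Suc c)) s'')) s'"
        proof (cases "c \<in> set_decode ?w")
          case True
          have arcs: "arc_list ?w (Suc c) = arc_list ?w c @ [(c div n, c mod n)]"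
            using True by (simp add: arc_list_def)
          \<comment> \<open>At most one arc per bit read, two integers per arc: the output counter
            cannot overflow.\<close>
          have "length (arc_list ?w (Suc c)) \<le> Suc c"
            unfolding arc_list_def using length_filter_le[of _ "[0..<Suc c]"] by (metis length_map length_upt minus_nat.diff_0)
          then have "2 * ?l + 2 \<le> 2 * (n * n)" using arcs 3(1) by simp
          then have l: "int (2 * ?l + 2) < 2 ^ B" using L_square_le(2) by (intro less_B_int) linarith
          have "int c < 2 ^ B" using R 3(1) by linarith
          moreover have "int c div int n \<le> int c" "int c mod int n \<le> int c" 
            using div_le_dividend[of c n] mod_less_eq_dividend[of c n]
            by (metis of_nat_le_iff zdiv_int, metis of_nat_le_iff zmod_int)
          moreover have "0 \<le> int c div int n" "0 \<le> int c mod int n"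
            by (simp_all flip: zdiv_int zmod_int)
          ultimately have small: "\<bar>int c div int n\<bar> < 2 ^ B" "\<bar>int c mod int n\<bar> < 2 ^ B"
            by linarith+
          \<comment> \<open>Array 1 after both writes; the result is extended by exactly these two
            cells.\<close>
          define h where "h = (snd s' 1)(fst s' 1 := int c div int n, fst s' 1 + 1 := int c mod int n)"
          have h: "h (int (2 * ?l)) = int (c div n)" "h (int (2 * ?l + 1)) = int (c mod n)"
            "\<And>i. i < 2 * ?l \<Longrightarrow> h (int i) = snd s' 1 (int i)"
            unfolding h_def inv(1) by (simp_all add: zdiv_int zmod_int)
          have "[0..<2 * ?l + 2] = [0..<2 * ?l] @ [2 * ?l, 2 * ?l + 1]" by simp
          then have "map (\<lambda>i. h (int i)) [0..<2 * ?l + 2] =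
              map (\<lambda>i. h (int i)) [0..<2 * ?l] @ [int (c div n), int (c mod n)]"
            using h(1,2) by (simp only: map_append list.map)
          also have "map (\<lambda>i. h (int i)) [0..<2 * ?l] = map (\<lambda>i. snd s' 1 (int i)) [0..<2 * ?l]"
            by (rule map_cong) (use h(3) in auto)
          also have "\<dots> = result s'" unfolding result_def inv(1) nat_int ..
          finally have res: "map (\<lambda>i. h (int i)) [0..<2 * ?l + 2] = ?out (Suc c)"
            unfolding inv(2) arcs by simp
          have "Inv (Suc c) s''" if "fst s'' 1 = fst s' 1 + 2" "snd s'' 1 = h" for s''
          proof -
            have r: "fst s'' 1 = int (2 * ?l + 2)" using that(1) inv(1) by simp
            have "result s'' = ?out (Suc c)" unfolding result_def that(2) r nat_int by (rule res)
            with r arcs show ?thesis by (simp add: Inv_def)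
          qed
          moreover have "\<bar>fst s' 1 + 2\<bar> < 2 ^ B" using l inv(1) by simp
          ultimately show ?thesis
            using True bit small 3(3) r2 by (simp add: h_def)
        next
          case False
          then have "arc_list ?w (Suc c) = arc_list ?w c" by (simp add: arc_list_def)
          then show ?thesis using False bit inv by (simp add: Inv_def result_def)
        qed
      qed
    next
      case (4 c s')
      then show ?case using s1 T by (simp add: frame_def tables_def)
    qed
    then show "ok B (For 4 (Mul (Reg 2) (Reg 2)) ?c) s1 ?W (\<lambda>s'. \<exists>A. valid n {..<n} A \<and>
      (\<forall>A'. valid n {..<n} A' \<longrightarrow> wt A' \<le> wt A) \<and>
      result s' = concat (map (\<lambda>(u, v). [int u, int v]) (arc_list (code A) (n * n))))"
      by (rule ok_conseq) (use A in \<open>auto simp: Inv_def\<close>)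
  qed
qed

section \<open>From maximum weight to maximum score\<close>

lemma f_adm:
  assumes "v < n" "P \<in> adm v"
  shows "f v P = ereal (real (sc v P) / real den)"
proof -
  obtain us p q where e: "(us, p, q) \<in> set (ess ! v)" "P = set us" "0 < q" "0 \<le> p"
    using assms(2) by (auto simp: adm_def)
  have "q dvd int den"
    unfolding den_def using entry_mem(3)[OF assms(1) e(1)] e(3) by (rule pos_prod_dvd)
  then have "q * int (sc v P) = p * int den" using sc_entry(1)[OF assms(1) e(1,3,4)] e(2) by simp
  then have "real_of_int q * real (sc v P) = real_of_int p * real den"
    by (metis of_int_mult of_int_of_nat_eq)
  moreover have "0 < real den" using pos_prod_pos by (simp add: den_def)
  ultimately have "real_of_int p / real_of_int q = real (sc v P) / real den"
    using e(3) by (simp add: field_simps)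
  then show ?thesis using entry[OF assms(1) e(1)] e(2,3) by (simp add: score_val_def)
qed

text \<open>A set fails to be admissible by not being listed, by denominator 0 (both give minus
  infinity), or by a negative numerator.\<close>

lemma f_not_adm:
  assumes "v < n" "P \<notin> adm v"
  shows "f v P \<le> 0"
proof (cases "P \<in> F v")
  case True
  then obtain us p q where e: "(us, p, q) \<in> set (ess ! v)" "P = set us" using F_eq[OF assms(1)] by force
  then have "\<not> (0 < q \<and> 0 \<le> p)" using assms(2) by (auto simp: adm_def)
  then show ?thesis
    using entry[OF assms(1) e(1)] e(2) by (auto simp: score_val_def divide_nonpos_nonneg)
next
  case False
  then have "f v P = - \<infinity>" using inst assms(1) by (simp add: pt_instance_def)
  then show ?thesis by simp
qed

text \<open>With one denominator for all nodes, comparing scores of valid digraphs is comparing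
  integer sums.\<close>

lemma score_valid:
  assumes "\<forall>v<n. parents A v \<in> adm v"
  shows "score n f A = ereal (real (\<Sum>v<n. sc v (parents A v)) / real den)"
proof -
  have "score n f A = (\<Sum>v<n. ereal (real (sc v (parents A v)) / real den))"
    unfolding score_def using assms f_adm by (intro sum.cong) auto
  then show ?thesis by (simp add: sum_divide_distrib)
qed

text \<open>Division by \<open>2 ^ (n * n)\<close> is monotone and recovers the scaled score, so
  maximum weight implies maximum score among valid digraphs. An arbitrary polytree is first pruned
  to a valid one.\<close>

lemma optimal_of_max_weight:
  assumes A: "valid n {..<n} A" "\<forall>A'. valid n {..<n} A' \<longrightarrow> wt A' \<le> wt A"
  shows "optimal_polytree n f A"
  unfolding optimal_polytree_def
proof (intro conjI allI impI)
  have An: "A \<subseteq> {..<n} \<times> {..<n}" using A(1) by (simp add: valid_def)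
  show "is_polytree n A" using A(1) by (simp add: is_polytree_iff valid_def)
  fix C assume "is_polytree n C"
  then have C: "C \<subseteq> {..<n} \<times> {..<n}" "all_bridges C" by (simp_all add: is_polytree_iff)
  \<comment> \<open>Nodes with an inadmissible parent set lose all their parents: the score does not
    drop, and a subset of the arcs is still a polytree.\<close>
  define C' where "C' = {(u, v) \<in> C. parents C v \<in> adm v}"
  have par: "parents C' v = (if parents C v \<in> adm v then parents C v else {})" for v
    by (auto simp: C'_def parents_def)
  have sub: "C' \<subseteq> C" by (auto simp: C'_def)
  have adm: "\<forall>v<n. parents C' v \<in> adm v" using adm_empty by (simp add: par)
  have "parents C' n = {}" using parents_outside[of C' "{..<n}" n] sub C(1) by auto
  then have "valid n {..<n} C'"
    using adm C sub all_bridges_mono[OF C(2) sub] by (auto simp: valid_def)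
  then have "wt C' div 2 ^ (n * n) \<le> wt A div 2 ^ (n * n)" using A(2) by (intro div_le_mono) simp
  then have "(\<Sum>v<n. sc v (parents C' v)) \<le> (\<Sum>v<n. sc v (parents A v))"
    using wt_div[OF An] wt_div[of C'] sub C(1) by auto
  then have "real (\<Sum>v<n. sc v (parents C' v)) \<le> real (\<Sum>v<n. sc v (parents A v))"
    by (rule of_nat_mono)
  moreover have "\<forall>v<n. parents A v \<in> adm v" using A(1) by (simp add: valid_def)
  ultimately have le: "score n f C' \<le> score n f A"
    using score_valid[OF adm] score_valid[of A] by (simp only: ereal_less_eq(3) divide_right_mono of_nat_0_le_iff)
  have "f v (parents C v) \<le> f v (parents C' v)" if "v < n" for v
    using f_not_adm[OF that, of "parents C v"] inst that by (auto simp: par pt_instance_def)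
  then have "score n f C \<le> score n f C'" unfolding score_def by (intro sum_mono) simp
  with le show "score n f C \<le> score n f A" by simp
qed

lemma B_le: "B \<le> L ^ 4"
proof -
  have "3 * L \<le> 2 * L\<^sup>2" using L_ge(4) by (simp add: power2_eq_square)
  moreover have "4 \<le> L\<^sup>2" using power_mono[OF L_ge(4), of 2] by simp
  moreover have "4 * L\<^sup>2 \<le> L\<^sup>2 * L\<^sup>2" using calculation(2) by (rule mult_le_mono1)
  ultimately have "B \<le> L\<^sup>2 * L\<^sup>2" unfolding B_def power2_eq_square[of L, symmetric] by linarith
  then show ?thesis by (simp flip: power_add)
qed

text \<open>The exponent collects \<open>unit_cost polytree_prog\<close> for the program constant, 2
  for the factor 4, 5 for the loops, and 8 for \<open>B^2\<close>, as
  \<open>B <= L ^ 4\<close>.\<close>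

lemma polytree_prog_correct:
  "\<exists>t ys A. runs polytree_prog I t ys \<and> t \<le> 3 ^ n * code_len I ^ (unit_cost polytree_prog + 15) \<and>
     encodes_arcs A ys \<and> optimal_polytree n f A"
proof -
  let ?W = "4 * L ^ 5 * 3 ^ n" and ?K = "unit_cost polytree_prog"
  have "ok B polytree_prog (init_state I) ?W (\<lambda>s'. \<exists>A. valid n {..<n} A \<and>
    (\<forall>A'. valid n {..<n} A' \<longrightarrow> wt A' \<le> wt A) \<and>
    result s' = concat (map (\<lambda>(u, v). [int u, int v]) (arc_list (code A) (n * n))))"
    unfolding polytree_prog_def
  proof (rule ok_Seq[OF ok_setup_prog])
    fix s1 assume b1: "bnd B s1" and s1: "env s1 \<and> state_ok 0 {} s1 \<and> fst s1 1 = 0"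
    show "ok B (Seq rounds_prog out_prog) s1 ?W (\<lambda>s'. \<exists>A. valid n {..<n} A \<and>
      (\<forall>A'. valid n {..<n} A' \<longrightarrow> wt A' \<le> wt A) \<and>
      result s' = concat (map (\<lambda>(u, v). [int u, int v]) (arc_list (code A) (n * n))))"
    proof (rule ok_Seq[OF ok_rounds_prog[OF b1]])
      fix s2 assume b2: "bnd B s2" and f2: "frame rounds_prog s1 s2" and s2: "state_ok n {} s2"
      have "env s2" using env_frame[OF _ f2] s1 by simp
      moreover have "fst s2 1 = 0" using f2 s1 by (simp add: frame_def)
      ultimately show "ok B out_prog s2 ?W (\<lambda>s'. \<exists>A. valid n {..<n} A \<and>
        (\<forall>A'. valid n {..<n} A' \<longrightarrow> wt A' \<le> wt A) \<and>
        result s' = concat (map (\<lambda>(u, v). [int u, int v]) (arc_list (code A) (n * n))))"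
        using ok_out_prog[OF b2 _ s2] by blast
    qed (use s1 in auto)
  qed
  then obtain t s A where run: "exec polytree_prog (init_state I) t s" "t \<le> ?K * ?W * B\<^sup>2"
    and A: "valid n {..<n} A" "\<forall>A'. valid n {..<n} A' \<longrightarrow> wt A' \<le> wt A"
    and res: "result s = concat (map (\<lambda>(u, v). [int u, int v]) (arc_list (code A) (n * n)))"
    unfolding ok_def by blast
  have "A \<subseteq> {..<n} \<times> {..<n}" using A(1) by (simp add: valid_def)
  from arc_list_code[OF this] res have "encodes_arcs A (result s)"
    unfolding encodes_arcs_def by blast
  moreover have "t \<le> 3 ^ n * L ^ (?K + 15)"
  proof -
    \<comment> \<open>A constant factor \<open>K\<close> is absorbed as
      \<open>K <= 2 ^ K <= L ^ K\<close>, using \<open>2 <= L\<close>.\<close>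
    have "?K \<le> 2 ^ ?K" using less_exp[of ?K] by simp
    also have "(2::nat) ^ ?K \<le> L ^ ?K" using L_ge(4) by (intro power_mono) simp_all
    finally have K: "?K \<le> L ^ ?K" .
    have 4: "4 \<le> L\<^sup>2" using power_mono[OF L_ge(4), of 2] by simp
    have B2: "B\<^sup>2 \<le> (L ^ 4)\<^sup>2" using B_le by (intro power_mono) simp_all
    note run(2)
    also have "?K * ?W * B\<^sup>2 \<le> L ^ ?K * (L\<^sup>2 * L ^ 5 * 3 ^ n) * (L ^ 4)\<^sup>2"
      by (intro mult_le_mono K B2 4 order_refl)
    also have "\<dots> = 3 ^ n * L ^ (?K + 15)" by (simp add: power_add power_mult[symmetric] mult_ac flip: power_add)
    finally show ?thesis .
  qed
  ultimately show ?thesis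
    using run(1) optimal_of_max_weight[OF A] unfolding runs_def L_def by blast
qed

end

theorem theorem3p1:
  shows "\<exists>(prog :: com) (k :: nat). \<forall>n F f I.
    pt_instance n F f \<longrightarrow> encodes n F f I \<longrightarrow>
    (\<exists>t ys A. runs prog I t ys \<and> t \<le> 3 ^ n * code_len I ^ k \<and>
       encodes_arcs A ys \<and> optimal_polytree n f A)"
proof (rule exI[of _ polytree_prog], rule exI[of _ "unit_cost polytree_prog + 15"], intro allI impI)
  fix n F f I
  assume inst: "pt_instance n F f" and "encodes n F f I"
  from this(2) obtain ess where ess: "I = input_code ess" "length ess = n"
    and enc: "\<forall>v < n. distinct (map (\<lambda>(us, p, q). set us) (ess ! v)) \<and>
      F v = (\<lambda>(us, p, q). set us) ` set (ess ! v) \<and>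
      (\<forall>(us, p, q) \<in> set (ess ! v). distinct us \<and> 0 \<le> q \<and> f v (set us) = score_val p q)"
    unfolding encodes_def by (elim exE conjE) (rule that)
  have input: "pt_input n F f ess"
  proof (rule pt_input.intro[OF inst ess(2)])
    show "F v = (\<lambda>(us, p, q). set us) ` set (ess ! v)" if "v < n" for v
      using enc that by blast
    show "distinct us \<and> 0 \<le> q \<and> f v (set us) = score_val p q"
      if "v < n" "(us, p, q) \<in> set (ess ! v)" for v us p q
      using enc that by fastforce
  qed
  show "\<exists>t ys A. runs polytree_prog I t ys \<and>
      t \<le> 3 ^ n * code_len I ^ (unit_cost polytree_prog + 15) \<and>
      encodes_arcs A ys \<and> optimal_polytree n f A"
    using pt_input.polytree_prog_correct[OF input] unfolding pt_input.I_def[OF input] ess(1) .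
qed

end
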